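(* Let $F\subset[0,1]^d$ be a self-affine sponge (in the setting described in the context) satisfying the very strong SPPC, and let $\nu_{\mathbf p}$ be the self-affine measure associated with a probability vector $\mathbf p=(p(i))_{i\in\mathcal I}$ with strictly positive entries. Then \[ \max_{\sigma\in\mathcal B}\overline S(\mathbf p,\sigma)\le \dim_{\mathrm A}\nu_{\mathbf p}\le \max_{\sigma\in\mathcal A}\overline S(\mathbf p,\sigma) \quad\text{and}\quad \min_{\sigma\in\mathcal A}\underline S(\mathbf p,\sigma)\le \dim_{\mathrm L}\nu_{\mathbf p}\le \min_{\sigma\in\mathcal B}\underline S(\mathbf p,\sigma), \] where \[ \overline S(\mathbf p,\sigma)=\sum_{n=1}^d\max_{i\in\mathcal I_n^\sigma}\frac{\log P^\sigma_{n-1}(i)}{\log\lambda_i^{(\sigma_n)}},\qquad \underline S(\mathbf p,\sigma)=\sum_{n=1}^d\min_{i\in\mathcal I_n^\sigma}\frac{\log P^\sigma_{n-1}(i)}{\log\lambda_i^{(\sigma_n)}}. \] In particular, for the $\sigma$-ordered coordinate-wise natural measure $\mathbf q^\sigma$, \[ \overline S(\mathbf q^\sigma,\sigma)=s_0^\sigma(\emptyset)+\sum_{n=1}^{d-1}\max_{i\in\mathcal I_n^\sigma}s_n^\sigma(i),\qquad \underline S(\mathbf q^\sigma,\sigma)=s_0^\sigma(\emptyset)+\sum_{n=1}^{d-1}\min_{i\in\mathcal I_n^\sigma}s_n^\sigma(i). \]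
   Context: Setting: $d\ge1$, $\mathcal I=\{1,\dots,N\}$, and for $i\in\mathcal I$, $f_i(x)=A_ix+t_i$ on $\mathbb R^d$ with $A_i=\mathrm{diag}(\lambda_i^{(1)},\dots,\lambda_i^{(d)})$, all $\lambda_i^{(n)}\in(0,1)$, $t_i\in\mathbb R^d$. Assume $f_i([0,1]^d)\subset[0,1]^d$ for all $i$, there are no $i\ne j$ with $f_i=f_j$ on $[0,1]^d$, and every pair of coordinates is distinguishable: for all $m\neq n$ there is $i$ with $\lambda_i^{(n)}\ne\lambda_i^{(m)}$. $F$ is the attractor: the unique nonempty compact set with $F=\bigcup_i f_i(F)$. Let $\Sigma=\mathcal I^{\mathbb N}$, $\pi(\mathbf i)=\lim_k f_{i_1}\circ\cdots\circ f_{i_k}(0)$, $\mu_{\mathbf p}=\mathbf p^{\mathbb N}$ the Bernoulli measure and $\nu_{\mathbf p}=\mu_{\mathbf p}\circ\pi^{-1}$. Dimensions of a compactly supported Borel probability measure $\nu$: $\dim_{\mathrm A}\nu$ is the infimum of $s\ge0$ for which there is $C>0$ with $\nu(B(x,R))/\nu(B(x,r))\le C(R/r)^s$ for all $x\in\mathrm{supp}\,\nu$ and $0<r<R<|\mathrm{supp}\,\nu|$; $\dim_{\mathrm L}\nu$ is the supremum of $s\ge0$ for which there is $C>0$ with $\nu(B(x,R))/\nu(B(x,r))\ge C(R/r)^s$ for all such $x,r,R$ (and $\dim_{\mathrm L}\nu=0$ if $|\mathrm{supp}\,\nu|=0$). Stopping: for $\mathbf i\in\Sigma$, $r>0$, $1\le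 n\le d$, $L_{\mathbf i}(r,n)$ is the unique integer with $\prod_{\ell=1}^{L_{\mathbf i}(r,n)}\lambda_{i_\ell}^{(n)}\le r<\prod_{\ell=1}^{L_{\mathbf i}(r,n)-1}\lambda_{i_\ell}^{(n)}$. For a permutation $\sigma=(\sigma_1,\dots,\sigma_d)$ of $\{1,\dots,d\}$ ($\sigma\in\mathcal S_d$): $\mathbf i$ determines a strictly $\sigma$-ordered cylinder at scale $r$ if, writing $L=L_{\mathbf i}(r,\sigma_d)$, $\prod_{\ell=1}^{L}\lambda_{i_\ell}^{(\sigma_d)}<\prod_{\ell=1}^{L}\lambda_{i_\ell}^{(\sigma_{d-1})}<\dots<\prod_{\ell=1}^{L}\lambda_{i_\ell}^{(\sigma_1)}$. $\mathbf i$ determines a $\sigma$-ordered cube at scale $r$ if $L_{\mathbf i}(r,\sigma_d)\le L_{\mathbf i}(r,\sigma_{d-1})\le\dots\le L_{\mathbf i}(r,\sigma_1)$, where ties are resolved by the rule: if coordinates $k<m$ have $L_{\mathbf i}(r,k)=L_{\mathbf i}(r,m)$, then $k$ precedes $m$ in $\sigma$ iff $\prod_{\ell=1}^{L_{\mathbf i}(r,k)}\lambda_{i_\ell}^{(k)}\ge\prod_{\ell=1}^{L_{\mathbf i}(r,k)}\lambda_{i_\ell}^{(m)}$. $\mathcal A$ is the set of $\sigma\in\mathcal S_d$ such that some $\mathbf i\in\Sigma$, $r>0$ determine a $\sigma$-ordered cube at scale $r$; $\mathcal B$ is the set of $\sigma$ such that some $\mathbf i,r$ determine a strictly $\sigma$-ordered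 cylinder at scale $r$. Projections: $E_n^\sigma$ is the span of the coordinate axes $\sigma_1,\dots,\sigma_n$ and $\Pi_n^\sigma$ the orthogonal projection onto it. $f_i,f_j$ overlap exactly on $E_n^\sigma$ if $\Pi_n^\sigma f_i(x)=\Pi_n^\sigma f_j(x)$ for all $x\in[0,1]^d$. SPPC: for every $\sigma\in\mathcal A$, $1\le n\le d$, $i,j\in\mathcal I$, either $f_i,f_j$ overlap exactly on $E_n^\sigma$ or $\Pi_n^\sigma(f_i((0,1)^d))\cap\Pi_n^\sigma(f_j((0,1)^d))=\emptyset$. Very strong SPPC: the same with $(0,1)^d$ replaced by $[0,1]^d$. Index sets: for $\sigma\in\mathcal S_d$ and $1\le n\le d-1$, $\mathcal I_n^\sigma$ is the set of $j\in\mathcal I$ for which there is no $i<j$ such that $f_i,f_j$ overlap exactly on $E_n^\sigma$; $\mathcal I_d^\sigma=\mathcal I$; $\mathcal I_0^\sigma=\{\emptyset\}$. For $j\in\mathcal I$, $\Pi_n^\sigma j$ is the unique $i\in\mathcal I_n^\sigma$ such that $f_i,f_j$ overlap exactly on $E_n^\sigma$ ($\Pi_d^\sigma$ is the identity, $\Pi_0^\sigma j=\emptyset$). Define $p_n^\sigma(i)=\sum_{j\in\mathcal I:\Pi_n^\sigma j=i}p(j)$ for $i\in\mathcal I_n^\sigma$, $1\le n\le d$, and $p_0^\sigma(\emptyset)=1$; for $1\le n\le d$ and $i\in\mathcal I_n^\sigma$, $P^\sigma_{n-1}(i)=p_n^\sigma(i)/p_{n-1}^\sigma(\Pi_{n-1}^\sigma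 i)$. Natural measure: for $0\le n\le d-1$ and $i\in\mathcal I_n^\sigma$, $s_n^\sigma(i)$ is the unique number with $\sum_{j\in\mathcal I_{n+1}^\sigma:\,\Pi_n^\sigma j=i}\big(\lambda_j^{(\sigma_{n+1})}\big)^{s_n^\sigma(i)}=1$. The $\sigma$-ordered coordinate-wise natural measure is $\mathbf q^\sigma=(q^\sigma(i))_{i\in\mathcal I}$, $q^\sigma(i)=\prod_{n=1}^d\big(\lambda^{(\sigma_n)}_{\Pi_n^\sigma i}\big)^{s_{n-1}^\sigma(\Pi_{n-1}^\sigma i)}$. *)

theory Defs
  imports "HOL-Probability.Probability" "HOL-Combinatorics.Multiset_Permutations"
begin

text \<open>Setting.  Coordinates of R^d are indexed by a finite linearly ordered type 'n
 (so d = CARD('n) \<ge> 1, and the order on 'n plays the role of the order 1<...<d).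
 Maps are indexed by I = {1..N}; map i has contraction ratios lam i c (c a coordinate)
 and translation t i.  Symbolic sequences are w :: nat => nat with w l = i_(l+1).
 A permutation sigma = (sigma_1,...,sigma_d) is a list of coordinates with
 sigma_n = sigma ! (n-1).\<close>

definition ifs :: "(nat \<Rightarrow> 'n::finite \<Rightarrow> real) \<Rightarrow> (nat \<Rightarrow> real^'n) \<Rightarrow> nat \<Rightarrow> real^'n \<Rightarrow> real^'n" where
  "ifs lam t i x = (\<chi> c. lam i c * x $ c + t i $ c)"

definition unit_cube :: "(real^'n::finite) set" where
  "unit_cube = {x. \<forall>c. 0 \<le> x $ c \<and> x $ c \<le> 1}"

primrec wcomp :: "(nat \<Rightarrow> 'a \<Rightarrow> 'a) \<Rightarrow> (nat \<Rightarrow> nat) \<Rightarrow> nat \<Rightarrow> 'a \<Rightarrow> 'a" where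
  "wcomp f w 0 = id"
| "wcomp f w (Suc k) = wcomp f w k \<circ> f (w k)"

definition coding :: "(nat \<Rightarrow> 'n::finite \<Rightarrow> real) \<Rightarrow> (nat \<Rightarrow> real^'n) \<Rightarrow> (nat \<Rightarrow> nat) \<Rightarrow> real^'n" where
  "coding lam t w = lim (\<lambda>k. wcomp (ifs lam t) w k 0)"

definition bernoulli :: "nat \<Rightarrow> (nat \<Rightarrow> real) \<Rightarrow> (nat \<Rightarrow> nat) measure" where
  "bernoulli N p = PiM UNIV (\<lambda>_::nat. point_measure {1..N} (\<lambda>i. ennreal (p i)))"

definition self_affine_measure ::
  "nat \<Rightarrow> (nat \<Rightarrow> 'n::finite \<Rightarrow> real) \<Rightarrow> (nat \<Rightarrow> real^'n) \<Rightarrow> (nat \<Rightarrow> real) \<Rightarrow> (real^'n) measure" where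
  "self_affine_measure N lam t p = distr (bernoulli N p) borel (coding lam t)"

definition msupp :: "'a::metric_space measure \<Rightarrow> 'a set" where
  "msupp \<nu> = {x. \<forall>e>0. 0 < emeasure \<nu> (ball x e)}"

definition assouad_dim_measure :: "'a::metric_space measure \<Rightarrow> ereal" where
  "assouad_dim_measure \<nu> = Inf {ereal s | s. s \<ge> 0 \<and> (\<exists>C>0. \<forall>x\<in>msupp \<nu>. \<forall>r R.
      0 < r \<and> r < R \<and> R < diameter (msupp \<nu>) \<longrightarrow>
      measure \<nu> (cball x R) / measure \<nu> (cball x r) \<le> C * (R / r) powr s)}"

definition lower_dim_measure :: "'a::metric_space measure \<Rightarrow> ereal" where
  "lower_dim_measure \<nu> = (if diameter (msupp \<nu>) = 0 then 0 else
     Sup {ereal s | s. s \<ge> 0 \<and> (\<exists>C>0. \<forall>x\<in>msupp \<nu>. \<forall>r R.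
      0 < r \<and> r < R \<and> R < diameter (msupp \<nu>) \<longrightarrow>
      measure \<nu> (cball x R) / measure \<nu> (cball x r) \<ge> C * (R / r) powr s)})"

definition prodw :: "(nat \<Rightarrow> 'n \<Rightarrow> real) \<Rightarrow> (nat \<Rightarrow> nat) \<Rightarrow> 'n \<Rightarrow> nat \<Rightarrow> real" where
  "prodw lam w c L = (\<Prod>l<L. lam (w l) c)"

text \<open>L_w(r,c); for 0<r<1 this is the unique integer of the paper.\<close>
definition Lstop :: "(nat \<Rightarrow> 'n \<Rightarrow> real) \<Rightarrow> (nat \<Rightarrow> nat) \<Rightarrow> real \<Rightarrow> 'n \<Rightarrow> nat" where
  "Lstop lam w r c = (LEAST L. prodw lam w c L \<le> r)"

definition strict_cylinder :: "(nat \<Rightarrow> 'n::finite \<Rightarrow> real) \<Rightarrow> (nat \<Rightarrow> nat) \<Rightarrow> real \<Rightarrow> 'n list \<Rightarrow> bool" where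
  "strict_cylinder lam w r \<sigma> =
     (let L = Lstop lam w r (\<sigma> ! (CARD('n) - 1)) in
      \<forall>n. n + 1 < CARD('n) \<longrightarrow> prodw lam w (\<sigma> ! (n+1)) L < prodw lam w (\<sigma> ! n) L)"

definition ordered_cube :: "(nat \<Rightarrow> 'n::{finite,linorder} \<Rightarrow> real) \<Rightarrow> (nat \<Rightarrow> nat) \<Rightarrow> real \<Rightarrow> 'n list \<Rightarrow> bool" where
  "ordered_cube lam w r \<sigma> =
     (\<forall>a b. a < b \<and> b < CARD('n) \<longrightarrow>
        (let x = \<sigma> ! a; y = \<sigma> ! b; Lx = Lstop lam w r x; Ly = Lstop lam w r y in
          Ly \<le> Lx \<and>
          (Lx = Ly \<longrightarrow> (x < y \<and> prodw lam w y Lx \<le> prodw lam w x Lx)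
                      \<or> (y < x \<and> prodw lam w y Lx < prodw lam w x Lx))))"

definition sym_space :: "nat \<Rightarrow> (nat \<Rightarrow> nat) set" where
  "sym_space N = {w. \<forall>l. w l \<in> {1..N}}"

definition permsA :: "nat \<Rightarrow> (nat \<Rightarrow> 'n::{finite,linorder} \<Rightarrow> real) \<Rightarrow> 'n list set" where
  "permsA N lam = {\<sigma> \<in> permutations_of_set UNIV.
      \<exists>w\<in>sym_space N. \<exists>r. 0 < r \<and> r < 1 \<and> ordered_cube lam w r \<sigma>}"

definition permsB :: "nat \<Rightarrow> (nat \<Rightarrow> 'n::finite \<Rightarrow> real) \<Rightarrow> 'n list set" where
  "permsB N lam = {\<sigma> \<in> permutations_of_set UNIV.
      \<exists>w\<in>sym_space N. \<exists>r. 0 < r \<and> r < 1 \<and> strict_cylinder lam w r \<sigma>}"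

definition proj :: "'n set \<Rightarrow> real^'n::finite \<Rightarrow> real^'n" where
  "proj S x = (\<chi> c. if c \<in> S then x $ c else 0)"

definition projE :: "('n::finite) list \<Rightarrow> nat \<Rightarrow> real^'n \<Rightarrow> real^'n" where
  "projE \<sigma> n = proj (set (take n \<sigma>))"

definition overlap_exact ::
  "(nat \<Rightarrow> 'n::finite \<Rightarrow> real) \<Rightarrow> (nat \<Rightarrow> real^'n) \<Rightarrow> 'n list \<Rightarrow> nat \<Rightarrow> nat \<Rightarrow> nat \<Rightarrow> bool" where
  "overlap_exact lam t \<sigma> n i j =
     (\<forall>x\<in>unit_cube. projE \<sigma> n (ifs lam t i x) = projE \<sigma> n (ifs lam t j x))"

definition very_strong_SPPC :: "nat \<Rightarrow> (nat \<Rightarrow> ('n::{finite,linorder}) \<Rightarrow> real) \<Rightarrow> (nat \<Rightarrow> real^('n::{finite,linorder})) \<Rightarrow> bool" where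
  "very_strong_SPPC N lam t =
     (\<forall>\<sigma>\<in>permsA N lam. \<forall>n\<in>{1..CARD('n)}. \<forall>i\<in>{1..N}. \<forall>j\<in>{1..N}.
        overlap_exact lam t \<sigma> n i j \<or>
        projE \<sigma> n ` (ifs lam t i ` unit_cube) \<inter> projE \<sigma> n ` (ifs lam t j ` unit_cube) = {})"

text \<open>I_n^sigma; the element 0 (not in {1..N}) plays the role of the empty word.\<close>
definition Iset :: "nat \<Rightarrow> (nat \<Rightarrow> 'n::finite \<Rightarrow> real) \<Rightarrow> (nat \<Rightarrow> real^'n) \<Rightarrow> 'n list \<Rightarrow> nat \<Rightarrow> nat set" where
  "Iset N lam t \<sigma> n =
     (if n = 0 then {0} else if n = CARD('n) then {1..N}
      else {j\<in>{1..N}. \<not> (\<exists>i\<in>{1..N}. i < j \<and> overlap_exact lam t \<sigma> n i j)})"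

definition Pi_idx :: "nat \<Rightarrow> (nat \<Rightarrow> 'n::finite \<Rightarrow> real) \<Rightarrow> (nat \<Rightarrow> real^'n) \<Rightarrow> 'n list \<Rightarrow> nat \<Rightarrow> nat \<Rightarrow> nat" where
  "Pi_idx N lam t \<sigma> n j =
     (if n = 0 then 0 else if n = CARD('n) then j
      else (THE i. i \<in> Iset N lam t \<sigma> n \<and> overlap_exact lam t \<sigma> n i j))"

definition p_marg :: "nat \<Rightarrow> (nat \<Rightarrow> 'n::finite \<Rightarrow> real) \<Rightarrow> (nat \<Rightarrow> real^'n) \<Rightarrow> (nat \<Rightarrow> real) \<Rightarrow> 'n list \<Rightarrow> nat \<Rightarrow> nat \<Rightarrow> real" where
  "p_marg N lam t p \<sigma> n i =
     (if n = 0 then 1 else (\<Sum>j\<in>{j\<in>{1..N}. Pi_idx N lam t \<sigma> n j = i}. p j))"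

definition P_cond :: "nat \<Rightarrow> (nat \<Rightarrow> 'n::finite \<Rightarrow> real) \<Rightarrow> (nat \<Rightarrow> real^'n) \<Rightarrow> (nat \<Rightarrow> real) \<Rightarrow> 'n list \<Rightarrow> nat \<Rightarrow> nat \<Rightarrow> real" where
  "P_cond N lam t p \<sigma> m i = p_marg N lam t p \<sigma> (m+1) i / p_marg N lam t p \<sigma> m (Pi_idx N lam t \<sigma> m i)"

definition S_upper :: "nat \<Rightarrow> (nat \<Rightarrow> 'n::finite \<Rightarrow> real) \<Rightarrow> (nat \<Rightarrow> real^'n) \<Rightarrow> (nat \<Rightarrow> real) \<Rightarrow> 'n list \<Rightarrow> real" where
  "S_upper N lam t p \<sigma> = (\<Sum>n\<in>{1..CARD('n)}.
     Max ((\<lambda>i. ln (P_cond N lam t p \<sigma> (n-1) i) / ln (lam i (\<sigma> ! (n-1)))) ` Iset N lam t \<sigma> n))"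

definition S_lower :: "nat \<Rightarrow> (nat \<Rightarrow> 'n::finite \<Rightarrow> real) \<Rightarrow> (nat \<Rightarrow> real^'n) \<Rightarrow> (nat \<Rightarrow> real) \<Rightarrow> 'n list \<Rightarrow> real" where
  "S_lower N lam t p \<sigma> = (\<Sum>n\<in>{1..CARD('n)}.
     Min ((\<lambda>i. ln (P_cond N lam t p \<sigma> (n-1) i) / ln (lam i (\<sigma> ! (n-1)))) ` Iset N lam t \<sigma> n))"

text \<open>s_n^sigma(i), for 0 <= n <= d-1 and i in I_n^sigma.\<close>
definition s_exp :: "nat \<Rightarrow> (nat \<Rightarrow> 'n::finite \<Rightarrow> real) \<Rightarrow> (nat \<Rightarrow> real^'n) \<Rightarrow> 'n list \<Rightarrow> nat \<Rightarrow> nat \<Rightarrow> real" where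
  "s_exp N lam t \<sigma> n i = (THE s. (\<Sum>j\<in>{j\<in>Iset N lam t \<sigma> (n+1). Pi_idx N lam t \<sigma> n j = i}.
       lam j (\<sigma> ! n) powr s) = 1)"

definition natural_q :: "nat \<Rightarrow> (nat \<Rightarrow> 'n::finite \<Rightarrow> real) \<Rightarrow> (nat \<Rightarrow> real^'n) \<Rightarrow> 'n list \<Rightarrow> nat \<Rightarrow> real" where
  "natural_q N lam t \<sigma> i = (\<Prod>n\<in>{1..CARD('n)}.
     lam (Pi_idx N lam t \<sigma> n i) (\<sigma> ! (n-1)) powr s_exp N lam t \<sigma> (n-1) (Pi_idx N lam t \<sigma> (n-1) i))"

end

theory Submission
  imports Defs
begin

text \<open>
  Around the point coded by \<open>w\<close>, the ball of radius \<open>r\<close> is comparable to the approximate cube of all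
  \<open>v\<close> whose letters agree with those of \<open>w\<close> in every coordinate in which they are visible at scale
  \<open>r\<close>; the separation half of this is the very strong SPPC. If \<open>\<sigma>\<close> orders the coordinates by their
  stopping times at scale \<open>r\<close>, then minus the logarithm of the measure of this cube is
  the sum over \<open>n\<close> and over \<open>l\<close> below the stopping time of \<open>\<sigma>\<close>'s \<open>n\<close>-th coordinate of \<open>-ln P_cond\<close>.

  Hence two scales at which the order is the same \<open>\<sigma>\<close> satisfy the wanted bounds with exponents
  \<open>S_upper \<sigma>\<close> and \<open>S_lower \<sigma>\<close>, no matter which orders occur in between. Jumping from each order to the
  last scale at which it occurs, one reaches any smaller scale in at most as many jumps as there are
  orders, so only a constant factor is lost; this gives the bounds over \<open>permsA\<close>.

  For \<open>\<sigma>\<close> in \<open>permsB\<close>, repeating a word with strictly \<open>\<sigma>\<close>-ordered products separates the stopping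
  times of the different coordinates arbitrarily far. Inserting at each of them a long run of the letter that
  is extremal for the corresponding term makes all terms extremal at once.
\<close>

subsection \<open>Sorting and colouring lemmas\<close>

text \<open>The order of the coordinates can change unboundedly often between two scales, so an
  error for every change is too much; only an error for every order is affordable. With the same
  \<sigma> at both ends the two costs are sums of the same terms \<open>psi\<close>, so only the
  letters between the two stopping times of each coordinate survive in the difference. Whatever the
  letters in the window of \<open>\<sigma> ! n\<close> are, their \<open>nlog\<close> in that
  coordinate adds up to the difference of the scales, up to \<open>nlog_max\<close>; bounding each
  \<open>psi\<close> by the extremal ratio times this \<open>nlog\<close> gives the n-th term of the
  dimension formula. The SPPC is assumed only for prefixes of orders in \<open>permsA\<close>. It
  applies to a visible set because every such set is a prefix of an order realised at that very
  scale. Exact overlap is handled as an equivalence relation on letters, one for each set of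
  coordinates. The representatives in \<open>Iset\<close> enter only in the translation to
  \<open>S_upper\<close> and \<open>S_lower\<close> and in the formulas for the natural
  measure.\<close>

lemma exists_sorted_wrt_list:
  assumes "finite A"
    and "\<And>x y z. \<lbrakk>x \<in> A; y \<in> A; z \<in> A; R x y; R y z\<rbrakk> \<Longrightarrow> R x z"
    and "\<And>x y. \<lbrakk>x \<in> A; y \<in> A; x \<noteq> y\<rbrakk> \<Longrightarrow> R x y \<or> R y x"
  shows "\<exists>xs. set xs = A \<and> distinct xs \<and> sorted_wrt R xs"
  using assms
proof (induction A rule: finite_induct)
  case empty
  show ?case by (intro exI[of _ "[]"]) auto
next
  case (insert a A)
  have tot: "R x y \<or> R y x" if "x \<in> insert a A" "y \<in> insert a A" "x \<noteq> y" for x y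
    using insert.prems(2) that by blast
  have tr: "R x z" if "x \<in> insert a A" "y \<in> insert a A" "z \<in> insert a A" "R x y" "R y z" for x y z
    using insert.prems(1) that by blast
  have "\<exists>xs. set xs = A \<and> distinct xs \<and> sorted_wrt R xs"
  proof (rule insert.IH)
    show "R x z" if "x \<in> A" "y \<in> A" "z \<in> A" "R x y" "R y z" for x y z
      using tr[of x y z] that by simp
    show "R x y \<or> R y x" if "x \<in> A" "y \<in> A" "x \<noteq> y" for x y
      using tot[of x y] that by simp
  qed
  then obtain xs where xs: "set xs = A" "distinct xs" "sorted_wrt R xs" by blast
  let ?ys = "filter (\<lambda>x. R x a) xs @ a # filter (\<lambda>x. \<not> R x a) xs"
  have R2: "R a x" if "x \<in> A" "\<not> R x a" for x
    using tot[of a x] that insert.hyps by auto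
  have R3: "R x y" if "x \<in> A" "R x a" "y \<in> A" "\<not> R y a" for x y
    using tr[of x a y] R2 that by auto
  have "sorted_wrt R ?ys"
    unfolding sorted_wrt_append using xs(1) R2 R3
    by (simp add: sorted_wrt_filter[OF xs(3)])
  moreover have "distinct ?ys" using xs(1,2) insert.hyps(2) by auto
  moreover have "set ?ys = insert a A" unfolding xs(1)[symmetric] by auto
  ultimately show ?case by blast
qed

text \<open>The time at which a colour is last seen splits off a stretch with equal end colours, and the
  colour does not occur afterwards.\<close>
lemma coloured_increment_bound:
  fixes g :: "nat \<Rightarrow> real" and col :: "nat \<Rightarrow> 'a"
  assumes same: "\<And>j k. j \<le> k \<Longrightarrow> k \<le> K \<Longrightarrow> col j = col k \<Longrightarrow> g k - g j \<le> s * real (k - j) + C"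
    and step: "\<And>k. k < K \<Longrightarrow> g (Suc k) - g k \<le> s + C"
    and "C \<ge> 0" "j \<le> K"
  shows "g K - g j \<le> s * real (K - j) + 2 * C * card (col ` {j..K})"
  using \<open>j \<le> K\<close>
proof (induction "K - j" arbitrary: j rule: less_induct)
  case less
  define k where "k = Max {k. j \<le> k \<and> k \<le> K \<and> col k = col j}"
  have fin: "finite {k. j \<le> k \<and> k \<le> K \<and> col k = col j}" by simp
  have "k \<in> {k. j \<le> k \<and> k \<le> K \<and> col k = col j}"
    unfolding k_def by (rule Max_in[OF fin]) (use less.prems in auto)
  then have k: "j \<le> k" "k \<le> K" "col k = col j" by auto
  have kmax: "k' \<le> k" if "j \<le> k'" "k' \<le> K" "col k' = col j" for k'
    unfolding k_def using Max_ge[OF fin] that by auto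
  have 1: "g k - g j \<le> s * real (k - j) + C" using same k by auto
  show ?case
  proof (cases "k = K")
    case True
    have "card (col ` {j..K}) \<ge> 1"
      using less.prems by (simp add: Suc_le_eq card_gt_0_iff)
    then have "C \<le> 2 * C * card (col ` {j..K})"
      using \<open>C \<ge> 0\<close> mult_left_mono[of 1 "real (card (col ` {j..K}))" C] by linarith
    then show ?thesis using 1 True by simp
  next
    case False
    then have kK: "Suc k \<le> K" using k by auto
    have "g K - g (Suc k) \<le> s * real (K - Suc k) + 2 * C * card (col ` {Suc k..K})"
      by (rule less.hyps) (use kK k in auto)
    \<comment> \<open>This single step leaves the colour for good; together with the error of the
      stretch it makes up the \<open>2 * C\<close> per colour.\<close>
    moreover have "g (Suc k) - g k \<le> s + C" using step kK by auto
    moreover have "real (card (col ` {j..K})) \<ge> 1 + real (card (col ` {Suc k..K}))"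
    proof -
      have "col ` {Suc k..K} \<subset> col ` {j..K}"
      proof
        show "col ` {Suc k..K} \<subseteq> col ` {j..K}" using k by auto
        have "col j \<notin> col ` {Suc k..K}"
        proof
          assume "col j \<in> col ` {Suc k..K}"
          then obtain k' where "Suc k \<le> k'" "k' \<le> K" "col k' = col j" by auto
          then show False using kmax[of k'] k by auto
        qed
        moreover have "col j \<in> col ` {j..K}" using less.prems by auto
        ultimately show "col ` {Suc k..K} \<noteq> col ` {j..K}" by blast
      qed
      then have "card (col ` {Suc k..K}) < card (col ` {j..K})"
        by (intro psubset_card_mono) auto
      then show ?thesis by simp
    qed
    then have "2 * C * card (col ` {j..K}) \<ge> 2 * C + 2 * C * card (col ` {Suc k..K})"
      using \<open>C \<ge> 0\<close> mult_left_mono[of "1 + real (card (col ` {Suc k..K}))" "real (card (col ` {j..K}))" "2*C"]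
      by (simp add: algebra_simps)
    moreover have "real (K - j) = real (K - Suc k) + 1 + real (k - j)"
      using kK k by (simp add: of_nat_diff)
    then have "s * real (K - j) = s * real (K - Suc k) + s + s * real (k - j)"
      by (simp add: algebra_simps)
    ultimately show ?thesis using 1 by linarith
  qed
qed

text \<open>Over the reals a last time of a colour need not exist, so the interval is sampled at
  equally spaced times. The error depends on the number of colours, not on the number of
  samples.\<close>

lemma coloured_increment_bound_real:
  fixes g :: "real \<Rightarrow> real" and col :: "real \<Rightarrow> 'a"
  assumes same: "\<And>T T'. 0 < T \<Longrightarrow> T \<le> T' \<Longrightarrow> col T = col T' \<Longrightarrow> g T' - g T \<le> s * (T' - T) + C"
    and step: "\<And>T T'. 0 < T \<Longrightarrow> T \<le> T' \<Longrightarrow> T' \<le> T + 1 \<Longrightarrow> g T' - g T \<le> s * (T' - T) + C"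
    and "C \<ge> 0" "finite A" "\<And>T. 0 < T \<Longrightarrow> col T \<in> A" "0 < T" "T \<le> T'"
  shows "g T' - g T \<le> s * (T' - T) + 2 * C * card A"
proof -
  \<comment> \<open>\<open>Suc\<close> keeps \<open>K\<close> positive even for
    \<open>T = T'\<close>, and the spacing \<open>h\<close> is at most 1, as the hypothesis on short
    steps requires.\<close>
  define K where "K = Suc (nat \<lceil>T' - T\<rceil>)"
  define h where "h = (T' - T) / K"
  have "K > 0" "T' - T \<le> K" unfolding K_def by (simp, linarith)
  then have h: "0 \<le> h" "h \<le> 1" "h * K = T' - T"
    unfolding h_def using assms(7) by (auto simp: divide_le_eq)
  define f where "f k = T + h * real k" for k
  have f: "f k \<ge> T" "f k > 0" for k using h assms(6) unfolding f_def by (auto intro: add_pos_nonneg)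
  have fd: "f k - f j = h * real (k - j)" if "j \<le> k" for j k
    unfolding f_def using that by (simp add: of_nat_diff algebra_simps)
  have "g (f K) - g (f 0) \<le> (s * h) * real (K - 0) + 2 * C * card ((\<lambda>k. col (f k)) ` {0..K})"
  proof (rule coloured_increment_bound)
    fix j k assume jk: "j \<le> k" "col (f j) = col (f k)"
    have "h * real (k - j) \<ge> 0" using h by simp
    then show "g (f k) - g (f j) \<le> s * h * real (k - j) + C"
      using same[of "f j" "f k"] f[of j] fd[OF jk(1)] jk(2) by (auto simp: mult.assoc)
  next
    fix k
    show "g (f (Suc k)) - g (f k) \<le> s * h + C"
      using step[of "f k" "f (Suc k)"] f[of k] fd[of k "Suc k"] h by auto
  qed (use \<open>C \<ge> 0\<close> in simp_all)
  moreover have "card ((\<lambda>k. col (f k)) ` {0..K}) \<le> card A"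
    by (intro card_mono) (use assms(4,5) f in blast)+
  then have "2 * C * card ((\<lambda>k. col (f k)) ` {0..K}) \<le> 2 * C * card A"
    using \<open>C \<ge> 0\<close> by (intro mult_left_mono) auto
  moreover have "f K = T'" "f 0 = T" using h unfolding f_def by auto
  moreover have "(s * h) * real (K - 0) = s * (T' - T)" using h by (simp add: mult.assoc)
  ultimately show ?thesis by (metis (no_types, lifting) add_left_mono order_trans)
qed

text \<open>This is what turns the set of coordinates visible at a letter into a prefix of the
  order.\<close>

lemma sorted_list_sublevel_set:
  fixes f :: "'a \<Rightarrow> nat"
  assumes "\<And>a b. a < b \<Longrightarrow> b < length xs \<Longrightarrow> f (xs ! b) \<le> f (xs ! a)"
  shows "\<exists>n\<le>length xs. \<forall>k<length xs. l < f (xs ! k) \<longleftrightarrow> k < n"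
proof -
  define n where "n = (LEAST n. n = length xs \<or> (n < length xs \<and> f (xs ! n) \<le> l))"
  have n: "n = length xs \<or> (n < length xs \<and> f (xs ! n) \<le> l)"
    unfolding n_def by (rule LeastI[of _ "length xs"]) simp
  have nl: "\<not> (k = length xs \<or> (k < length xs \<and> f (xs ! k) \<le> l))" if "k < n" for k
    by (rule not_less_Least) (use that in \<open>simp add: n_def\<close>)
  have "l < f (xs ! k) \<longleftrightarrow> k < n" if k: "k < length xs" for k
  proof
    show "l < f (xs ! k)" if "k < n" using nl[OF that] k by auto
    show "k < n" if "l < f (xs ! k)"
    proof (rule ccontr)
      assume "\<not> k < n"
      then have "f (xs ! k) \<le> f (xs ! n)" "f (xs ! n) \<le> l"
        using n k assms[of n k] by (cases "n = k"; auto)+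
      then show False using that by simp
    qed
  qed
  then show ?thesis using n by (intro exI[of _ n]) auto
qed

subsection \<open>Logarithmic scales and approximate cubes\<close>

locale sponge =
  fixes N :: nat
    and lam :: "nat \<Rightarrow> 'n::{finite,linorder} \<Rightarrow> real"
    and t :: "nat \<Rightarrow> real^('n::{finite,linorder})"
    and p :: "nat \<Rightarrow> real"
  assumes lam_range: "\<And>i c. i \<in> {1..N} \<Longrightarrow> 0 < lam i c \<and> lam i c < 1"
    and maps_in_cube: "\<And>i. i \<in> {1..N} \<Longrightarrow> ifs lam t i ` unit_cube \<subseteq> unit_cube"
    and maps_distinct: "\<And>i j. i \<in> {1..N} \<Longrightarrow> j \<in> {1..N} \<Longrightarrow> i \<noteq> j \<Longrightarrow>
                          \<not> (\<forall>x\<in>unit_cube. ifs lam t i x = ifs lam t j x)"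
    and distinguishable: "\<And>m n. m \<noteq> n \<Longrightarrow> \<exists>i\<in>{1..N}. lam i n \<noteq> lam i m"
    and SPPC: "very_strong_SPPC N lam t"
    and p_pos: "\<And>i. i \<in> {1..N} \<Longrightarrow> p i > 0"
    and p_sum: "(\<Sum>i\<in>{1..N}. p i) = 1"
begin

lemma N_pos: "1 \<le> N"
  using p_sum by (cases N) auto

text \<open>Scales are written as \<open>r = exp (-T)\<close>, so that contraction ratios become additive.\<close>
definition nlog :: "nat \<Rightarrow> 'n \<Rightarrow> real" where
  "nlog i c = - ln (lam i c)"

definition nlog_sum :: "(nat \<Rightarrow> nat) \<Rightarrow> 'n \<Rightarrow> nat \<Rightarrow> real" where
  "nlog_sum w c L = (\<Sum>l<L. nlog (w l) c)"

text \<open>\<open>nlog_min\<close> converts a bounded amount of scale into a bounded number of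
  letters; \<open>nlog_max\<close> below is the largest overshoot when a product crosses a
  scale.\<close>

definition nlog_min :: real where
  "nlog_min = Min ((\<lambda>(i,c). nlog i c) ` ({1..N} \<times> UNIV))"

definition nlog_max :: real where
  "nlog_max = Max ((\<lambda>(i,c). nlog i c) ` ({1..N} \<times> UNIV))"

lemma nlog_pos: "i \<in> {1..N} \<Longrightarrow> 0 < nlog i c"
  using lam_range[of i c] by (simp add: nlog_def ln_less_zero)

lemma nlog_ge_nlog_min: "i \<in> {1..N} \<Longrightarrow> nlog_min \<le> nlog i c"
  unfolding nlog_min_def by (rule Min_le) auto

lemma nlog_le_nlog_max: "i \<in> {1..N} \<Longrightarrow> nlog i c \<le> nlog_max"
  unfolding nlog_max_def by (rule Max_ge) auto

lemma nlog_min_pos: "0 < nlog_min"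
proof -
  have "nlog_min \<in> (\<lambda>(i,c). nlog i c) ` ({1..N} \<times> UNIV)"
    unfolding nlog_min_def by (rule Min_in) (use N_pos in auto)
  then show ?thesis using nlog_pos by auto
qed

lemma nlog_max_pos: "0 < nlog_max"
  using nlog_pos[of 1 undefined] nlog_le_nlog_max[of 1 undefined] N_pos by auto

lemma sym_spaceD: "w \<in> sym_space N \<Longrightarrow> w l \<in> {1..N}"
  by (simp add: sym_space_def)

lemma nlog_sum_0 [simp]: "nlog_sum w c 0 = 0" by (simp add: nlog_sum_def)

lemma nlog_sum_Suc: "nlog_sum w c (Suc L) = nlog_sum w c L + nlog (w L) c" by (simp add: nlog_sum_def)

lemma prodw_eq_exp:
  assumes "w \<in> sym_space N"
  shows "prodw lam w c L = exp (- nlog_sum w c L)"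
proof (induction L)
  case (Suc L)
  have "lam (w L) c = exp (- nlog (w L) c)"
    using lam_range[OF sym_spaceD[OF assms, of L], of c] by (simp add: nlog_def)
  then show ?case using Suc by (simp add: prodw_def nlog_sum_Suc mult_exp_exp)
qed (simp add: prodw_def)

lemma nlog_sum_diff_ge:
  assumes "w \<in> sym_space N" "l \<le> l'"
  shows "real (l' - l) * nlog_min \<le> nlog_sum w c l' - nlog_sum w c l"
  using assms(2)
proof (induction l' rule: dec_induct)
  case (step n)
  then show ?case using nlog_ge_nlog_min[OF sym_spaceD[OF assms(1), of n], of c]
    by (simp add: nlog_sum_Suc Suc_diff_le algebra_simps)
qed simp

lemma nlog_sum_diff_eq_sum:
  assumes "l \<le> l'"
  shows "nlog_sum w c l' - nlog_sum w c l = (\<Sum>k\<in>{l..<l'}. nlog (w k) c)"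
  using assms
proof (induction l' rule: dec_induct)
  case (step n)
  then show ?case by (simp add: nlog_sum_Suc algebra_simps)
qed simp

lemma nlog_sum_less: "w \<in> sym_space N \<Longrightarrow> l < l' \<Longrightarrow> nlog_sum w c l < nlog_sum w c l'"
proof -
  assume "w \<in> sym_space N" and l: "l < l'"
  then have "real (l' - l) * nlog_min \<le> nlog_sum w c l' - nlog_sum w c l" using nlog_sum_diff_ge by simp
  moreover have "0 < real (l' - l) * nlog_min" using l nlog_min_pos by simp
  ultimately show ?thesis by linarith
qed

lemma nlog_sum_less_iff: "w \<in> sym_space N \<Longrightarrow> nlog_sum w c l < nlog_sum w c l' \<longleftrightarrow> l < l'"
  by (metis nlog_sum_less less_irrefl linorder_neqE_nat less_trans)

lemma nlog_sum_le_iff: "w \<in> sym_space N \<Longrightarrow> nlog_sum w c l \<le> nlog_sum w c l' \<longleftrightarrow> l \<le> l'"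
  using nlog_sum_less_iff[of w c l' l] by (simp flip: not_less)

abbreviation stop :: "(nat \<Rightarrow> nat) \<Rightarrow> real \<Rightarrow> 'n \<Rightarrow> nat" where
  "stop w T c \<equiv> Lstop lam w (exp (- T)) c"

lemma stop_le_iff:
  assumes "w \<in> sym_space N"
  shows "stop w T c \<le> l \<longleftrightarrow> T \<le> nlog_sum w c l"
proof -
  have eq: "prodw lam w c L \<le> exp (- T) \<longleftrightarrow> T \<le> nlog_sum w c L" for L
    by (simp add: prodw_eq_exp[OF assms])
  \<comment> \<open>\<open>LEAST\<close> is meaningful only once some product falls below the scale:
    the sums grow at rate at least \<open>nlog_min\<close>.\<close>
  have ex: "\<exists>L. T \<le> nlog_sum w c L"
  proof -
    obtain n :: nat where "T / nlog_min < n" using reals_Archimedean2 by blast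
    then have "T \<le> nlog_sum w c n"
      using nlog_sum_diff_ge[OF assms, of 0 n c] nlog_min_pos by (simp add: divide_less_eq)
    then show ?thesis by blast
  qed
  have L: "T \<le> nlog_sum w c (stop w T c)"
    unfolding Lstop_def eq using LeastI_ex[OF ex] .
  show ?thesis
  proof
    assume "stop w T c \<le> l"
    then show "T \<le> nlog_sum w c l" using L nlog_sum_le_iff[OF assms, of c "stop w T c" l] by linarith
  next
    assume "T \<le> nlog_sum w c l"
    then show "stop w T c \<le> l" unfolding Lstop_def eq by (rule Least_le)
  qed
qed

lemma less_stop_iff: "w \<in> sym_space N \<Longrightarrow> l < stop w T c \<longleftrightarrow> nlog_sum w c l < T"
  using stop_le_iff[of w T c l] by (simp flip: not_le)

lemma nlog_sum_stop_ge: "w \<in> sym_space N \<Longrightarrow> T \<le> nlog_sum w c (stop w T c)"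
  using stop_le_iff by blast

text \<open>The stop overshoots by at most its last letter; \<open>0 < T\<close> guarantees that
  there is one.\<close>

lemma nlog_sum_stop_le:
  assumes "w \<in> sym_space N" "0 < T"
  shows "nlog_sum w c (stop w T c) \<le> T + nlog_max"
proof -
  have "0 < stop w T c" using less_stop_iff[OF assms(1)] assms(2) by simp
  then obtain m where m: "stop w T c = Suc m" using gr0_implies_Suc by blast
  then have "nlog_sum w c m < T" using less_stop_iff[OF assms(1), of m T c] by simp
  then show ?thesis using nlog_le_nlog_max[OF sym_spaceD[OF assms(1), of m], of c] m by (simp add: nlog_sum_Suc)
qed

lemma stop_mono: "w \<in> sym_space N \<Longrightarrow> T \<le> T' \<Longrightarrow> stop w T c \<le> stop w T' c"
  using stop_le_iff[of w T c "stop w T' c"] nlog_sum_stop_ge[of w T' c] by simp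

text \<open>Exact overlap expressed through the parameters, for arbitrary sets of coordinates. For
  prefixes of an order it is \<open>overlap_exact\<close>, see
  \<open>overlap_exact_iff_eqv\<close>.\<close>

definition eqv :: "'n set \<Rightarrow> nat \<Rightarrow> nat \<Rightarrow> bool" where
  "eqv S i j \<longleftrightarrow> (\<forall>c\<in>S. lam i c = lam j c \<and> t i $ c = t j $ c)"

text \<open>The weight of the overlap class of \<open>i\<close>; for prefixes of an order, the value
  of \<open>p_marg\<close> at the representative of \<open>i\<close>.\<close>

definition marg :: "'n set \<Rightarrow> nat \<Rightarrow> real" where
  "marg S i = (\<Sum>j\<in>{j\<in>{1..N}. eqv S i j}. p j)"

definition neg_ln_marg :: "'n set \<Rightarrow> nat \<Rightarrow> real" where
  "neg_ln_marg S i = - ln (marg S i)"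

lemma eqv_refl [simp]: "eqv S i i" by (simp add: eqv_def)

lemma marg_pos: "i \<in> {1..N} \<Longrightarrow> 0 < marg S i"
  unfolding marg_def by (rule sum_pos) (auto intro: p_pos)

lemma marg_antimono: "S \<subseteq> S' \<Longrightarrow> marg S' i \<le> marg S i"
  unfolding marg_def by (rule sum_mono2) (auto intro: less_imp_le[OF p_pos] simp: eqv_def)

lemma marg_empty [simp]: "marg {} i = 1"
proof -
  have "{j \<in> {1..N}. eqv {} i j} = {1..N}" by (auto simp: eqv_def)
  then show ?thesis using p_sum by (simp only: marg_def)
qed

lemma neg_ln_marg_empty [simp]: "neg_ln_marg {} i = 0" by (simp add: neg_ln_marg_def)

lemma neg_ln_marg_mono: "i \<in> {1..N} \<Longrightarrow> S \<subseteq> S' \<Longrightarrow> neg_ln_marg S i \<le> neg_ln_marg S' i"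
  unfolding neg_ln_marg_def using marg_pos[of i S'] marg_pos[of i S] marg_antimono[of S S' i] by simp

lemma neg_ln_marg_nonneg: "i \<in> {1..N} \<Longrightarrow> 0 \<le> neg_ln_marg S i"
  using neg_ln_marg_mono[of i "{}" S] by simp

definition neg_ln_marg_max :: real where
  "neg_ln_marg_max = Max (neg_ln_marg UNIV ` {1..N})"

lemma neg_ln_marg_le_neg_ln_marg_max: "i \<in> {1..N} \<Longrightarrow> neg_ln_marg S i \<le> neg_ln_marg_max"
  unfolding neg_ln_marg_max_def using neg_ln_marg_mono[of i S UNIV] by (auto intro: order_trans Max_ge)

lemma neg_ln_marg_max_nonneg: "0 \<le> neg_ln_marg_max"
  using neg_ln_marg_nonneg[of 1] neg_ln_marg_le_neg_ln_marg_max[of 1] N_pos by (meson atLeastAtMost_iff order_trans order_refl)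

text \<open>The coordinates in which the \<open>l\<close>-th letter is still visible at scale \<open>exp (-T)\<close>.\<close>
definition visible :: "(nat \<Rightarrow> nat) \<Rightarrow> real \<Rightarrow> nat \<Rightarrow> 'n set" where
  "visible w T l = {c. nlog_sum w c l < T}"

definition approx_cube :: "(nat \<Rightarrow> nat) \<Rightarrow> real \<Rightarrow> (nat \<Rightarrow> nat) set" where
  "approx_cube w T = {v \<in> sym_space N. \<forall>l. eqv (visible w T l) (w l) (v l)}"

text \<open>The sum of the stopping times instead of their maximum: any common upper bound serves as
  a cutoff beyond which no coordinate is visible.\<close>

definition depth_bound :: "(nat \<Rightarrow> nat) \<Rightarrow> real \<Rightarrow> nat" where
  "depth_bound w T = (\<Sum>c\<in>UNIV. stop w T c)"

text \<open>The Bernoulli measure of an approximate cube is \<open>exp (-cost)\<close>.\<close>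
definition cost :: "(nat \<Rightarrow> nat) \<Rightarrow> real \<Rightarrow> real" where
  "cost w T = (\<Sum>l<depth_bound w T. neg_ln_marg (visible w T l) (w l))"

lemma mem_visible_iff: "w \<in> sym_space N \<Longrightarrow> c \<in> visible w T l \<longleftrightarrow> l < stop w T c"
  by (simp add: visible_def less_stop_iff)

lemma stop_le_depth_bound: "stop w T c \<le> depth_bound w T"
  unfolding depth_bound_def by (rule member_le_sum) auto

lemma visible_empty: "w \<in> sym_space N \<Longrightarrow> depth_bound w T \<le> l \<Longrightarrow> visible w T l = {}"
  using mem_visible_iff stop_le_depth_bound by (metis all_not_in_conv le_trans not_less)

lemma visible_antimono: "w \<in> sym_space N \<Longrightarrow> l \<le> l' \<Longrightarrow> visible w T l' \<subseteq> visible w T l"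
  by (auto simp: mem_visible_iff)

lemma visible_mono: "T \<le> T' \<Longrightarrow> visible w T l \<subseteq> visible w T' l"
  by (auto simp: visible_def)

text \<open>Enlarging the cutoff only adds terms with empty visible set, which vanish; so two scales
  can be summed over one range.\<close>

lemma cost_eq:
  assumes "w \<in> sym_space N" "depth_bound w T \<le> K"
  shows "cost w T = (\<Sum>l<K. neg_ln_marg (visible w T l) (w l))"
  unfolding cost_def
  by (rule sum.mono_neutral_left) (use assms visible_empty in auto)

lemma cost_mono:
  assumes "w \<in> sym_space N" "T \<le> T'"
  shows "cost w T \<le> cost w T'"
proof -
  let ?K = "max (depth_bound w T) (depth_bound w T')"
  have "(\<Sum>l<?K. neg_ln_marg (visible w T l) (w l)) \<le> (\<Sum>l<?K. neg_ln_marg (visible w T' l) (w l))"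
    by (rule sum_mono) (use assms sym_spaceD in \<open>auto intro!: neg_ln_marg_mono visible_mono\<close>)
  then show ?thesis using cost_eq[OF assms(1), of T ?K] cost_eq[OF assms(1), of T' ?K] by simp
qed

lemma cost_nonneg: "w \<in> sym_space N \<Longrightarrow> 0 \<le> cost w T"
  unfolding cost_def by (rule sum_nonneg) (use sym_spaceD neg_ln_marg_nonneg in auto)

text \<open>A term changes only if \<open>l\<close> lies between the two stopping times of some
  coordinate, and such a window has at most \<open>(T' - T + nlog_max) / nlog_min\<close> letters.
  No order is involved, so the bound covers short steps across a change of order and, with
  \<open>T = 0\<close>, the cost at a fixed scale.\<close>

lemma cost_diff_crude:
  assumes w: "w \<in> sym_space N" and T: "0 < T'" "T \<le> T'"
  shows "cost w T' - cost w T \<le> neg_ln_marg_max * CARD('n) * ((T' - T + nlog_max) / nlog_min)"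
proof -
  let ?K = "max (depth_bound w T) (depth_bound w T')"
  have *: "neg_ln_marg (visible w T' l) (w l) - neg_ln_marg (visible w T l) (w l)
      \<le> (\<Sum>c\<in>UNIV. if stop w T c \<le> l \<and> l < stop w T' c then neg_ln_marg_max else 0)" for l
  proof (cases "visible w T' l = visible w T l")
    case True
    then show ?thesis using neg_ln_marg_max_nonneg by (auto intro!: sum_nonneg)
  next
    case False
    then obtain c where "c \<in> visible w T' l" "c \<notin> visible w T l" using visible_mono[OF T(2), of w l] by auto
    then have "stop w T c \<le> l \<and> l < stop w T' c" using w by (auto simp: mem_visible_iff)
    moreover have "(if stop w T c \<le> l \<and> l < stop w T' c then neg_ln_marg_max else 0)
        \<le> (\<Sum>c\<in>UNIV. if stop w T c \<le> l \<and> l < stop w T' c then neg_ln_marg_max else 0)"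
      by (rule member_le_sum) (use neg_ln_marg_max_nonneg in auto)
    moreover have "neg_ln_marg (visible w T' l) (w l) - neg_ln_marg (visible w T l) (w l) \<le> neg_ln_marg_max"
      using neg_ln_marg_nonneg[OF sym_spaceD[OF w, of l], of "visible w T l"]
        neg_ln_marg_le_neg_ln_marg_max[OF sym_spaceD[OF w, of l], of "visible w T' l"] by simp
    ultimately show ?thesis by simp
  qed
  have "cost w T' - cost w T = (\<Sum>l<?K. neg_ln_marg (visible w T' l) (w l) - neg_ln_marg (visible w T l) (w l))"
    using cost_eq[OF w, of T ?K] cost_eq[OF w, of T' ?K] by (simp add: sum_subtractf)
  also have "\<dots> \<le> (\<Sum>l<?K. \<Sum>c\<in>UNIV. if stop w T c \<le> l \<and> l < stop w T' c then neg_ln_marg_max else 0)"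
    by (rule sum_mono) (rule *)
  also have "\<dots> = (\<Sum>c\<in>UNIV. \<Sum>l<?K. if stop w T c \<le> l \<and> l < stop w T' c then neg_ln_marg_max else 0)"
    by (rule sum.swap)
  also have "\<dots> \<le> (\<Sum>c\<in>(UNIV::'n set). neg_ln_marg_max * ((T' - T + nlog_max) / nlog_min))"
  proof (rule sum_mono)
    fix c
    have "(\<Sum>l<?K. if stop w T c \<le> l \<and> l < stop w T' c then neg_ln_marg_max else 0)
        = (\<Sum>l\<in>{l\<in>{..<?K}. stop w T c \<le> l \<and> l < stop w T' c}. neg_ln_marg_max)"
      by (rule sum.inter_filter[symmetric]) simp
    also have "{l\<in>{..<?K}. stop w T c \<le> l \<and> l < stop w T' c} = {stop w T c..<stop w T' c}"
      using stop_le_depth_bound[of w T' c] by auto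
    also have "(\<Sum>l\<in>{stop w T c..<stop w T' c}. neg_ln_marg_max) = real (stop w T' c - stop w T c) * neg_ln_marg_max" by simp
    also have "\<dots> \<le> ((T' - T + nlog_max) / nlog_min) * neg_ln_marg_max"
    proof (rule mult_right_mono[OF _ neg_ln_marg_max_nonneg])
      have "real (stop w T' c - stop w T c) * nlog_min \<le> nlog_sum w c (stop w T' c) - nlog_sum w c (stop w T c)"
        by (rule nlog_sum_diff_ge[OF w stop_mono[OF w T(2)]])
      also have "\<dots> \<le> T' - T + nlog_max"
        using nlog_sum_stop_le[OF w, of T' c] nlog_sum_stop_ge[OF w, of T c] T by simp
      finally show "real (stop w T' c - stop w T c) \<le> (T' - T + nlog_max) / nlog_min"
        using nlog_min_pos by (simp add: le_divide_eq)
    qed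
    finally show "(\<Sum>l<?K. if stop w T c \<le> l \<and> l < stop w T' c then neg_ln_marg_max else 0)
        \<le> neg_ln_marg_max * ((T' - T + nlog_max) / nlog_min)" by (simp add: mult.commute)
  qed
  also have "\<dots> = neg_ln_marg_max * CARD('n) * ((T' - T + nlog_max) / nlog_min)" by simp
  finally show ?thesis .
qed

lemma nlog_sum_nonneg: "w \<in> sym_space N \<Longrightarrow> 0 \<le> nlog_sum w c l"
  using nlog_sum_le_iff[of w c 0 l] by simp

lemma cost_0: "w \<in> sym_space N \<Longrightarrow> cost w 0 = 0"
  using nlog_sum_nonneg by (simp add: cost_def visible_def not_less[THEN iffD2])

end

subsection \<open>Cost along a fixed order of the coordinates\<close>

lemma exists_ordered_cube:
  fixes lam :: "nat \<Rightarrow> 'n::{finite,linorder} \<Rightarrow> real"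
  shows "\<exists>\<sigma>\<in>permutations_of_set UNIV. ordered_cube lam w r \<sigma>"
proof -
  define L where "L x = Lstop lam w r x" for x
  define g where "g x = prodw lam w x (L x)" for x
  \<comment> \<open>The lexicographic order encoded in the tie rule: stopping time downwards,
    product at the stop downwards, coordinate upwards. The last key makes it total.\<close>
  define R where "R x y \<longleftrightarrow> L y < L x \<or> (L y = L x \<and> (g y < g x \<or> (g y = g x \<and> x < y)))" for x y
  have "\<exists>xs. set xs = (UNIV::'n set) \<and> distinct xs \<and> sorted_wrt R xs"
  proof (rule exists_sorted_wrt_list)
    show "R x z" if "R x y" "R y z" for x y z
      using that unfolding R_def by (elim disjE conjE) (simp_all, (meson less_trans)?)
    show "R x y \<or> R y x" if "x \<noteq> y" for x y
      using that unfolding R_def by (metis linorder_neqE)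
  qed simp
  then obtain xs where xs: "set xs = (UNIV::'n set)" "distinct xs" "sorted_wrt R xs" by blast
  then have len: "length xs = CARD('n)" using distinct_card by metis
  have "ordered_cube lam w r xs"
    unfolding ordered_cube_def Let_def
  proof (intro allI impI)
    fix a b assume ab: "a < b \<and> b < CARD('n)"
    then have R: "R (xs ! a) (xs ! b)"
      using xs(3) len by (simp add: sorted_wrt_iff_nth_less)
    have "L (xs ! b) \<le> L (xs ! a) \<and> (L (xs ! a) = L (xs ! b) \<longrightarrow>
      (xs ! a < xs ! b \<and> prodw lam w (xs ! b) (L (xs ! a)) \<le> prodw lam w (xs ! a) (L (xs ! a))) \<or>
      (xs ! b < xs ! a \<and> prodw lam w (xs ! b) (L (xs ! a)) < prodw lam w (xs ! a) (L (xs ! a))))"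
      using R unfolding R_def g_def
      by (metis less_le linorder_neqE order_refl)
    then show "Lstop lam w r (xs ! b) \<le> Lstop lam w r (xs ! a) \<and>
           (Lstop lam w r (xs ! a) = Lstop lam w r (xs ! b) \<longrightarrow>
            xs ! a < xs ! b \<and>
            prodw lam w (xs ! b) (Lstop lam w r (xs ! a)) \<le> prodw lam w (xs ! a) (Lstop lam w r (xs ! a)) \<or>
            xs ! b < xs ! a \<and>
            prodw lam w (xs ! b) (Lstop lam w r (xs ! a)) < prodw lam w (xs ! a) (Lstop lam w r (xs ! a)))"
      unfolding L_def .
  qed
  moreover have "xs \<in> permutations_of_set UNIV" using xs by (simp add: permutations_of_set_def)
  ultimately show ?thesis by blast
qed

lemma permutation_of_UNIV:
  assumes "\<sigma> \<in> permutations_of_set (UNIV::'n::finite set)"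
  shows "set \<sigma> = UNIV" "distinct \<sigma>" "length \<sigma> = CARD('n)"
  using assms distinct_card[of \<sigma>] by (auto simp: permutations_of_set_def)

context sponge
begin

text \<open>The tie rule is dropped: it decides membership in \<open>permsA\<close>, but the cost
  formula sees only the stopping times.\<close>

definition dec_order :: "(nat \<Rightarrow> nat) \<Rightarrow> real \<Rightarrow> 'n list \<Rightarrow> bool" where
  "dec_order w T \<sigma> \<longleftrightarrow> (\<forall>a b. a < b \<and> b < CARD('n) \<longrightarrow> stop w T (\<sigma> ! b) \<le> stop w T (\<sigma> ! a))"

lemma exists_permsA_dec_order:
  assumes "w \<in> sym_space N" "0 < T"
  shows "\<exists>\<sigma>\<in>permsA N lam. dec_order w T \<sigma>"
proof -
  obtain \<sigma> where \<sigma>: "\<sigma> \<in> permutations_of_set UNIV" "ordered_cube lam w (exp (- T)) \<sigma>"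
    using exists_ordered_cube by blast
  then have "\<sigma> \<in> permsA N lam"
    unfolding permsA_def using assms by (auto intro!: bexI[of _ w] exI[of _ "exp (- T)"])
  moreover have "dec_order w T \<sigma>" using \<sigma>(2) by (auto simp: dec_order_def ordered_cube_def Let_def)
  ultimately show ?thesis by blast
qed

text \<open>Coordinates later in \<sigma> stop no later than earlier ones, so those still running at
  letter \<open>l\<close> form a prefix.\<close>

lemma visible_eq_set_take:
  assumes "w \<in> sym_space N" "\<sigma> \<in> permutations_of_set UNIV" "dec_order w T \<sigma>"
  shows "\<exists>n\<le>CARD('n). visible w T l = set (take n \<sigma>) \<and> (\<forall>k<CARD('n). l < stop w T (\<sigma> ! k) \<longleftrightarrow> k < n)"
proof -
  note \<sigma> = permutation_of_UNIV[OF assms(2)]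
  have "\<exists>n\<le>length \<sigma>. \<forall>k<length \<sigma>. l < stop w T (\<sigma> ! k) \<longleftrightarrow> k < n"
    by (rule sorted_list_sublevel_set) (use \<sigma> assms(3) in \<open>auto simp: dec_order_def\<close>)
  then obtain n where n: "n \<le> CARD('n)" "\<And>k. k < CARD('n) \<Longrightarrow> l < stop w T (\<sigma> ! k) \<longleftrightarrow> k < n"
    using \<sigma>(3) by auto
  have "visible w T l = set (take n \<sigma>)"
  proof (rule set_eqI)
    fix c
    obtain k where k: "k < CARD('n)" "c = \<sigma> ! k" using \<sigma> by (metis UNIV_I in_set_conv_nth)
    have "c \<in> set (take n \<sigma>) \<longleftrightarrow> c \<in> nth \<sigma> ` {0..<n}" using nth_image[of n \<sigma>] n(1) \<sigma>(3) by simp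
    also have "\<dots> \<longleftrightarrow> k < n"
      using k n(1) \<sigma>(2,3) by (auto simp: nth_eq_iff_index_eq)
    finally show "c \<in> visible w T l \<longleftrightarrow> c \<in> set (take n \<sigma>)"
      using n(2)[OF k(1)] k mem_visible_iff[OF assms(1)] by simp
  qed
  then show ?thesis using n by blast
qed

text \<open>With \<open>n\<close> counted from \<open>0\<close>, this is \<open>-ln P_cond\<close> of the representative of \<open>i\<close> in
  \<open>Iset\<close> at level \<open>n + 1\<close>; see \<open>log_ratio_eq\<close> below.\<close>
definition psi :: "'n list \<Rightarrow> nat \<Rightarrow> nat \<Rightarrow> real" where
  "psi \<sigma> n i = neg_ln_marg (set (take (Suc n) \<sigma>)) i - neg_ln_marg (set (take n \<sigma>)) i"

lemma psi_nonneg: "i \<in> {1..N} \<Longrightarrow> 0 \<le> psi \<sigma> n i"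
  unfolding psi_def using neg_ln_marg_mono[of i "set (take n \<sigma>)" "set (take (Suc n) \<sigma>)"]
  by (simp add: set_take_subset_set_take)

lemma psi_le_neg_ln_marg_max: "i \<in> {1..N} \<Longrightarrow> psi \<sigma> n i \<le> neg_ln_marg_max"
  unfolding psi_def using neg_ln_marg_le_neg_ln_marg_max[of i "set (take (Suc n) \<sigma>)"] neg_ln_marg_nonneg[of i "set (take n \<sigma>)"]
  by simp

lemma neg_ln_marg_set_take: "neg_ln_marg (set (take n \<sigma>)) i = (\<Sum>k<n. psi \<sigma> k i)"
  by (induction n) (simp_all add: psi_def)

text \<open>Each term telescopes over its prefix into values of \<open>psi\<close>; exchanging the
  sums collects, for each coordinate, the letters read before its stop.\<close>

lemma cost_eq_ordered:
  assumes w: "w \<in> sym_space N" and \<sigma>: "\<sigma> \<in> permutations_of_set UNIV" "dec_order w T \<sigma>"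
  shows "cost w T = (\<Sum>n<CARD('n). \<Sum>l<stop w T (\<sigma> ! n). psi \<sigma> n (w l))"
proof -
  have *: "neg_ln_marg (visible w T l) (w l) = (\<Sum>k<CARD('n). if l < stop w T (\<sigma> ! k) then psi \<sigma> k (w l) else 0)" for l
  proof -
    obtain n where n: "n \<le> CARD('n)" "visible w T l = set (take n \<sigma>)"
      "\<And>k. k < CARD('n) \<Longrightarrow> l < stop w T (\<sigma> ! k) \<longleftrightarrow> k < n"
      using visible_eq_set_take[OF w \<sigma>, of l] by blast
    have "neg_ln_marg (visible w T l) (w l) = (\<Sum>k<n. psi \<sigma> k (w l))" using n neg_ln_marg_set_take by simp
    also have "{..<n} = {k\<in>{..<CARD('n)}. k < n}" using n(1) by auto
    also have "(\<Sum>k\<in>\<dots>. psi \<sigma> k (w l)) = (\<Sum>k<CARD('n). if k < n then psi \<sigma> k (w l) else 0)"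
      by (rule sum.inter_filter) simp
    also have "\<dots> = (\<Sum>k<CARD('n). if l < stop w T (\<sigma> ! k) then psi \<sigma> k (w l) else 0)"
      by (rule sum.cong) (use n(3) in auto)
    finally show ?thesis .
  qed
  have "cost w T = (\<Sum>k<CARD('n). \<Sum>l<depth_bound w T. if l < stop w T (\<sigma> ! k) then psi \<sigma> k (w l) else 0)"
    unfolding cost_def * by (rule sum.swap)
  also have "\<dots> = (\<Sum>k<CARD('n). \<Sum>l<stop w T (\<sigma> ! k). psi \<sigma> k (w l))"
  proof (rule sum.cong[OF refl])
    fix k
    have "(\<Sum>l<depth_bound w T. if l < stop w T (\<sigma> ! k) then psi \<sigma> k (w l) else 0)
        = (\<Sum>l\<in>{l\<in>{..<depth_bound w T}. l < stop w T (\<sigma> ! k)}. psi \<sigma> k (w l))"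
      by (rule sum.inter_filter[symmetric]) simp
    also have "{l\<in>{..<depth_bound w T}. l < stop w T (\<sigma> ! k)} = {..<stop w T (\<sigma> ! k)}"
      using stop_le_depth_bound[of w T "\<sigma> ! k"] by auto
    finally show "(\<Sum>l<depth_bound w T. if l < stop w T (\<sigma> ! k) then psi \<sigma> k (w l) else 0)
        = (\<Sum>l<stop w T (\<sigma> ! k). psi \<sigma> k (w l))" .
  qed
  finally show ?thesis .
qed

lemma cost_diff_ordered:
  assumes w: "w \<in> sym_space N" and \<sigma>: "\<sigma> \<in> permutations_of_set UNIV" "dec_order w T \<sigma>" "dec_order w T' \<sigma>"
    and T: "T \<le> T'"
  shows "cost w T' - cost w T = (\<Sum>n<CARD('n). \<Sum>l\<in>{stop w T (\<sigma> ! n)..<stop w T' (\<sigma> ! n)}. psi \<sigma> n (w l))"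
proof -
  have "(\<Sum>l<stop w T' (\<sigma> ! n). psi \<sigma> n (w l)) - (\<Sum>l<stop w T (\<sigma> ! n). psi \<sigma> n (w l))
      = (\<Sum>l\<in>{stop w T (\<sigma> ! n)..<stop w T' (\<sigma> ! n)}. psi \<sigma> n (w l))" for n
  proof -
    have "{..<stop w T' (\<sigma> ! n)} = {..<stop w T (\<sigma> ! n)} \<union> {stop w T (\<sigma> ! n)..<stop w T' (\<sigma> ! n)}"
      using stop_mono[OF w T, of "\<sigma> ! n"] by auto
    moreover have "{..<stop w T (\<sigma> ! n)} \<inter> {stop w T (\<sigma> ! n)..<stop w T' (\<sigma> ! n)} = {}" by auto
    ultimately show ?thesis by (simp add: sum.union_disjoint)
  qed
  then show ?thesis
    unfolding cost_eq_ordered[OF w \<sigma>(1,2)] cost_eq_ordered[OF w \<sigma>(1,3)]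
    by (simp flip: sum_subtractf)
qed

text \<open>The term of \<open>S_upper\<close> at level \<open>n + 1\<close>, taken over all letters
  instead of representatives. For \<open>n < CARD('n)\<close> the ratio is constant on overlap
  classes, so the maximum is the same; see \<open>log_ratio_image\<close>.\<close>

definition max_ratio :: "'n list \<Rightarrow> nat \<Rightarrow> real" where
  "max_ratio \<sigma> n = Max ((\<lambda>i. psi \<sigma> n i / nlog i (\<sigma> ! n)) ` {1..N})"

definition min_ratio :: "'n list \<Rightarrow> nat \<Rightarrow> real" where
  "min_ratio \<sigma> n = Min ((\<lambda>i. psi \<sigma> n i / nlog i (\<sigma> ! n)) ` {1..N})"

lemma psi_le_max_ratio: "i \<in> {1..N} \<Longrightarrow> psi \<sigma> n i \<le> max_ratio \<sigma> n * nlog i (\<sigma> ! n)"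
  using nlog_pos[of i "\<sigma> ! n"] Max_ge[of "(\<lambda>i. psi \<sigma> n i / nlog i (\<sigma> ! n)) ` {1..N}" "psi \<sigma> n i / nlog i (\<sigma> ! n)"]
  unfolding max_ratio_def by (auto simp: divide_le_eq)

lemma psi_ge_min_ratio: "i \<in> {1..N} \<Longrightarrow> min_ratio \<sigma> n * nlog i (\<sigma> ! n) \<le> psi \<sigma> n i"
  using nlog_pos[of i "\<sigma> ! n"] Min_le[of "(\<lambda>i. psi \<sigma> n i / nlog i (\<sigma> ! n)) ` {1..N}" "psi \<sigma> n i / nlog i (\<sigma> ! n)"]
  unfolding min_ratio_def by (auto simp: le_divide_eq)

lemma max_ratio_attained: "\<exists>i\<in>{1..N}. psi \<sigma> n i = max_ratio \<sigma> n * nlog i (\<sigma> ! n)"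
proof -
  have "max_ratio \<sigma> n \<in> (\<lambda>i. psi \<sigma> n i / nlog i (\<sigma> ! n)) ` {1..N}"
    unfolding max_ratio_def by (rule Max_in) (use N_pos in auto)
  then obtain i where "i \<in> {1..N}" "max_ratio \<sigma> n = psi \<sigma> n i / nlog i (\<sigma> ! n)" by blast
  then show ?thesis using nlog_pos[of i "\<sigma> ! n"] by (intro bexI[of _ i]) auto
qed

lemma min_ratio_attained: "\<exists>i\<in>{1..N}. psi \<sigma> n i = min_ratio \<sigma> n * nlog i (\<sigma> ! n)"
proof -
  have "min_ratio \<sigma> n \<in> (\<lambda>i. psi \<sigma> n i / nlog i (\<sigma> ! n)) ` {1..N}"
    unfolding min_ratio_def by (rule Min_in) (use N_pos in auto)
  then obtain i where "i \<in> {1..N}" "min_ratio \<sigma> n = psi \<sigma> n i / nlog i (\<sigma> ! n)" by blast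
  then show ?thesis using nlog_pos[of i "\<sigma> ! n"] by (intro bexI[of _ i]) auto
qed

lemma min_ratio_nonneg: "0 \<le> min_ratio \<sigma> n"
proof -
  obtain i where i: "i \<in> {1..N}" "psi \<sigma> n i = min_ratio \<sigma> n * nlog i (\<sigma> ! n)" using min_ratio_attained by blast
  then show ?thesis using nlog_pos[of i "\<sigma> ! n"] psi_nonneg[of i \<sigma> n]
    by (simp add: zero_le_mult_iff)
qed

lemma max_ratio_nonneg: "0 \<le> max_ratio \<sigma> n"
proof -
  obtain i where i: "i \<in> {1..N}" "psi \<sigma> n i = max_ratio \<sigma> n * nlog i (\<sigma> ! n)" using max_ratio_attained by blast
  then show ?thesis using nlog_pos[of i "\<sigma> ! n"] psi_nonneg[of i \<sigma> n]
    by (simp add: zero_le_mult_iff)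
qed

lemma cost_diff_same_order_upper:
  assumes w: "w \<in> sym_space N" and \<sigma>: "\<sigma> \<in> permutations_of_set UNIV" "dec_order w T \<sigma>" "dec_order w T' \<sigma>"
    and T: "0 < T" "T \<le> T'"
  shows "cost w T' - cost w T \<le> (\<Sum>n<CARD('n). max_ratio \<sigma> n) * (T' - T + nlog_max)"
proof -
  have "cost w T' - cost w T \<le> (\<Sum>n<CARD('n). max_ratio \<sigma> n * (T' - T + nlog_max))"
    unfolding cost_diff_ordered[OF w \<sigma> T(2)]
  proof (rule sum_mono)
    fix n
    let ?c = "\<sigma> ! n"
    have "(\<Sum>l\<in>{stop w T ?c..<stop w T' ?c}. psi \<sigma> n (w l)) \<le> (\<Sum>l\<in>{stop w T ?c..<stop w T' ?c}. max_ratio \<sigma> n * nlog (w l) ?c)"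
      by (rule sum_mono) (rule psi_le_max_ratio[OF sym_spaceD[OF w]])
    also have "\<dots> = max_ratio \<sigma> n * (nlog_sum w ?c (stop w T' ?c) - nlog_sum w ?c (stop w T ?c))"
      using nlog_sum_diff_eq_sum[OF stop_mono[OF w T(2), of ?c], of w ?c] by (simp add: sum_distrib_left)
    also have "\<dots> \<le> max_ratio \<sigma> n * (T' - T + nlog_max)"
      using nlog_sum_stop_le[OF w, of T' ?c] nlog_sum_stop_ge[OF w, of T ?c] T max_ratio_nonneg by (intro mult_left_mono) auto
    finally show "(\<Sum>l\<in>{stop w T ?c..<stop w T' ?c}. psi \<sigma> n (w l)) \<le> max_ratio \<sigma> n * (T' - T + nlog_max)" .
  qed
  then show ?thesis by (simp add: sum_distrib_right)
qed

text \<open>The overshoot now counts at the earlier scale, hence the minus sign. The second factor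
  may be negative; only the sign of \<open>min_ratio\<close> matters.\<close>

lemma cost_diff_same_order_lower:
  assumes w: "w \<in> sym_space N" and \<sigma>: "\<sigma> \<in> permutations_of_set UNIV" "dec_order w T \<sigma>" "dec_order w T' \<sigma>"
    and T: "0 < T" "T \<le> T'"
  shows "(\<Sum>n<CARD('n). min_ratio \<sigma> n) * (T' - T - nlog_max) \<le> cost w T' - cost w T"
proof -
  have "(\<Sum>n<CARD('n). min_ratio \<sigma> n * (T' - T - nlog_max)) \<le> cost w T' - cost w T"
    unfolding cost_diff_ordered[OF w \<sigma> T(2)]
  proof (rule sum_mono)
    fix n
    let ?c = "\<sigma> ! n"
    have "min_ratio \<sigma> n * (T' - T - nlog_max) \<le> min_ratio \<sigma> n * (nlog_sum w ?c (stop w T' ?c) - nlog_sum w ?c (stop w T ?c))"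
      using nlog_sum_stop_le[OF w, of T ?c] nlog_sum_stop_ge[OF w, of T' ?c] T min_ratio_nonneg by (intro mult_left_mono) auto
    also have "\<dots> = (\<Sum>l\<in>{stop w T ?c..<stop w T' ?c}. min_ratio \<sigma> n * nlog (w l) ?c)"
      using nlog_sum_diff_eq_sum[OF stop_mono[OF w T(2), of ?c], of w ?c] by (simp add: sum_distrib_left)
    also have "\<dots> \<le> (\<Sum>l\<in>{stop w T ?c..<stop w T' ?c}. psi \<sigma> n (w l))"
      by (rule sum_mono) (rule psi_ge_min_ratio[OF sym_spaceD[OF w]])
    finally show "min_ratio \<sigma> n * (T' - T - nlog_max) \<le> (\<Sum>l\<in>{stop w T ?c..<stop w T' ?c}. psi \<sigma> n (w l))" .
  qed
  then show ?thesis by (simp add: sum_distrib_right)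
qed

subsection \<open>Uniform bounds on the cost\<close>

lemma permsA_sub: "permsA N lam \<subseteq> permutations_of_set UNIV"
  by (auto simp: permsA_def)

lemma finite_permsA: "finite (permsA N lam)"
  by (rule finite_subset[OF permsA_sub]) simp

lemma sym_space_nonempty: "(\<lambda>_. 1) \<in> sym_space N"
  using N_pos by (simp add: sym_space_def)

lemma permsA_nonempty: "permsA N lam \<noteq> {}"
  using exists_permsA_dec_order[OF sym_space_nonempty, of 1] by auto

definition sum_max_ratio :: "'n list \<Rightarrow> real" where "sum_max_ratio \<sigma> = (\<Sum>n<CARD('n). max_ratio \<sigma> n)"
definition sum_min_ratio :: "'n list \<Rightarrow> real" where "sum_min_ratio \<sigma> = (\<Sum>n<CARD('n). min_ratio \<sigma> n)"

lemma sum_max_ratio_nonneg: "0 \<le> sum_max_ratio \<sigma>" unfolding sum_max_ratio_def by (rule sum_nonneg) (rule max_ratio_nonneg)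
lemma sum_min_ratio_nonneg: "0 \<le> sum_min_ratio \<sigma>" unfolding sum_min_ratio_def by (rule sum_nonneg) (rule min_ratio_nonneg)

lemma Max_sum_max_ratio_nonneg: "0 \<le> Max (sum_max_ratio ` permsA N lam)"
  using finite_permsA permsA_nonempty sum_max_ratio_nonneg by (auto simp: Max_ge_iff)

lemma Min_sum_min_ratio_nonneg: "0 \<le> Min (sum_min_ratio ` permsA N lam)"
  using finite_permsA permsA_nonempty sum_min_ratio_nonneg by auto

lemma cost_diff_upper:
  "\<exists>C\<ge>0. \<forall>w\<in>sym_space N. \<forall>T T'. 0 < T \<longrightarrow> T \<le> T' \<longrightarrow>
     cost w T' - cost w T \<le> Max (sum_max_ratio ` permsA N lam) * (T' - T) + C"
proof -
  define s where "s = Max (sum_max_ratio ` permsA N lam)"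
  \<comment> \<open>One constant for both sources of error, the overshoot between scales of equal
    order and the crude bound for steps of length at most 1. It does not depend on the word.\<close>
  define C where "C = max (s * nlog_max) (neg_ln_marg_max * CARD('n) * ((1 + nlog_max) / nlog_min))"
  have s0: "s \<ge> 0" unfolding s_def by (rule Max_sum_max_ratio_nonneg)
  have C0: "C \<ge> 0" unfolding C_def using s0 nlog_max_pos by (simp add: le_max_iff_disj)
  have "cost w T' - cost w T \<le> s * (T' - T) + 2 * C * card (permsA N lam)"
    if w: "w \<in> sym_space N" and T: "0 < T" "T \<le> T'" for w T T'
  proof -
    \<comment> \<open>Several orders may fit one scale; any choice can serve as the colour, since
      only equality at the two ends is used.\<close>
    define col where "col T = (SOME \<sigma>. \<sigma> \<in> permsA N lam \<and> dec_order w T \<sigma>)" for T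
    have col: "col T \<in> permsA N lam" "dec_order w T (col T)" if "0 < T" for T
      using someI_ex[of "\<lambda>\<sigma>. \<sigma> \<in> permsA N lam \<and> dec_order w T \<sigma>"]
        exists_permsA_dec_order[OF w that] unfolding col_def by auto
    show ?thesis
    proof (rule coloured_increment_bound_real[where col = col and g = "cost w"])
      fix T T' :: real assume T: "0 < T" "T \<le> T'" and eq: "col T = col T'"
      have "cost w T' - cost w T \<le> sum_max_ratio (col T) * (T' - T + nlog_max)"
        unfolding sum_max_ratio_def by (rule cost_diff_same_order_upper[OF w])
          (use col[of T] col[of T'] permsA_sub T eq in auto)
      also have "\<dots> \<le> s * (T' - T + nlog_max)"
        unfolding s_def by (intro mult_right_mono Max_ge) (use col[of T] finite_permsA T nlog_max_pos in auto)
      also have "\<dots> \<le> s * (T' - T) + C" unfolding C_def by (simp add: distrib_left)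
      finally show "cost w T' - cost w T \<le> s * (T' - T) + C" .
    next
      fix T T' :: real assume T: "0 < T" "T \<le> T'" "T' \<le> T + 1"
      have "cost w T' - cost w T \<le> neg_ln_marg_max * CARD('n) * ((T' - T + nlog_max) / nlog_min)"
        by (rule cost_diff_crude[OF w _ T(2)]) (use T in simp)
      also have "\<dots> \<le> neg_ln_marg_max * CARD('n) * ((1 + nlog_max) / nlog_min)"
        using T nlog_min_pos neg_ln_marg_max_nonneg by (intro mult_left_mono divide_right_mono) auto
      also have "\<dots> \<le> s * (T' - T) + C"
        using s0 T unfolding C_def by (simp add: add_increasing)
      finally show "cost w T' - cost w T \<le> s * (T' - T) + C" .
    qed (use C0 col T finite_permsA in auto)
  qed
  then show ?thesis using C0 unfolding s_def by (intro exI[of _ "2 * C * card (permsA N lam)"]) auto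
qed

lemma cost_diff_lower:
  "\<exists>C\<ge>0. \<forall>w\<in>sym_space N. \<forall>T T'. 0 < T \<longrightarrow> T \<le> T' \<longrightarrow>
     Min (sum_min_ratio ` permsA N lam) * (T' - T) - C \<le> cost w T' - cost w T"
proof -
  define s where "s = Min (sum_min_ratio ` permsA N lam)"
  \<comment> \<open>The overshoot is multiplied by the ratio sum of whichever order occurs, hence a
    maximum in the constant of a lower bound. Short steps are covered by monotonicity of the cost at
    the price of \<open>s\<close>.\<close>
  define s' where "s' = Max (sum_min_ratio ` permsA N lam)"
  define C where "C = max (s' * nlog_max) s"
  have s0: "s \<ge> 0" unfolding s_def by (rule Min_sum_min_ratio_nonneg)
  have C0: "C \<ge> 0" unfolding C_def using s0 by simp
  have "- cost w T' - (- cost w T) \<le> (- s) * (T' - T) + 2 * C * card (permsA N lam)"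
    if w: "w \<in> sym_space N" and T: "0 < T" "T \<le> T'" for w T T'
  proof -
    define col where "col T = (SOME \<sigma>. \<sigma> \<in> permsA N lam \<and> dec_order w T \<sigma>)" for T
    have col: "col T \<in> permsA N lam" "dec_order w T (col T)" if "0 < T" for T
      using someI_ex[of "\<lambda>\<sigma>. \<sigma> \<in> permsA N lam \<and> dec_order w T \<sigma>"]
        exists_permsA_dec_order[OF w that] unfolding col_def by auto
    show ?thesis
    proof (rule coloured_increment_bound_real[where col = col and g = "\<lambda>T. - cost w T"])
      fix T T' :: real assume T: "0 < T" "T \<le> T'" and eq: "col T = col T'"
      have "sum_min_ratio (col T) * (T' - T - nlog_max) \<le> cost w T' - cost w T"
        unfolding sum_min_ratio_def by (rule cost_diff_same_order_lower[OF w])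
          (use col[of T] col[of T'] permsA_sub T eq in auto)
      moreover have "s * (T' - T) \<le> sum_min_ratio (col T) * (T' - T)"
        unfolding s_def by (intro mult_right_mono Min_le) (use col[of T] finite_permsA T in auto)
      moreover have "sum_min_ratio (col T) * nlog_max \<le> s' * nlog_max"
        unfolding s'_def by (intro mult_right_mono Max_ge) (use col[of T] finite_permsA T nlog_max_pos in auto)
      moreover have "s' * nlog_max \<le> C" unfolding C_def by simp
      ultimately show "- cost w T' - - cost w T \<le> - s * (T' - T) + C" by (simp add: algebra_simps)
    next
      fix T T' :: real assume T: "0 < T" "T \<le> T'" "T' \<le> T + 1"
      have "s * (T' - T) \<le> s * 1" using T s0 by (intro mult_left_mono) auto
      moreover have "s \<le> C" unfolding C_def by simp
      ultimately show "- cost w T' - - cost w T \<le> - s * (T' - T) + C"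
        using cost_mono[OF w T(2)] by simp
    qed (use C0 col T finite_permsA in auto)
  qed
  then show ?thesis using C0 unfolding s_def
    by (intro exI[of _ "2 * C * card (permsA N lam)"]) (auto simp: algebra_simps)
qed

section \<open>Index sets, representatives and conditional weights in terms of overlap
  classes\<close>

lemma overlap_exact_iff_eqv: "overlap_exact lam t \<sigma> n i j \<longleftrightarrow> eqv (set (take n \<sigma>)) i j"
proof
  assume o: "overlap_exact lam t \<sigma> n i j"
  show "eqv (set (take n \<sigma>)) i j"
    unfolding eqv_def
  proof
    fix c assume c: "c \<in> set (take n \<sigma>)"
    have *: "projE \<sigma> n (ifs lam t i x) $ c = projE \<sigma> n (ifs lam t j x) $ c" if "x \<in> unit_cube" for x
      using o that unfolding overlap_exact_def by simp
    \<comment> \<open>Two corners of the cube suffice: the image of 0 gives the translation, and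
      then the image of the all-ones vector gives the ratio.\<close>
    have "0 \<in> unit_cube" "(\<chi> _. 1) \<in> unit_cube" by (auto simp: unit_cube_def)
    from *[OF this(1)] *[OF this(2)] show "lam i c = lam j c \<and> t i $ c = t j $ c"
      using c by (simp add: projE_def proj_def ifs_def)
  qed
next
  assume "eqv (set (take n \<sigma>)) i j"
  then show "overlap_exact lam t \<sigma> n i j"
    unfolding overlap_exact_def projE_def proj_def ifs_def eqv_def by (auto simp: vec_eq_iff)
qed

lemma eqv_UNIV: "i \<in> {1..N} \<Longrightarrow> j \<in> {1..N} \<Longrightarrow> eqv UNIV i j \<Longrightarrow> i = j"
  using maps_distinct[of i j] by (auto simp: eqv_def ifs_def vec_eq_iff)

lemma eqv_sym: "eqv S i j \<Longrightarrow> eqv S j i" by (auto simp: eqv_def)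

lemma eqv_trans: "eqv S i j \<Longrightarrow> eqv S j k \<Longrightarrow> eqv S i k" by (auto simp: eqv_def)

lemma eqv_subset: "eqv S i j \<Longrightarrow> S' \<subseteq> S \<Longrightarrow> eqv S' i j" by (auto simp: eqv_def)

context
  fixes \<sigma> :: "'n list"
  assumes perm: "\<sigma> \<in> permutations_of_set UNIV"
begin

lemma Iset_subset: "n \<ge> 1 \<Longrightarrow> Iset N lam t \<sigma> n \<subseteq> {1..N}"
  by (auto simp: Iset_def)

text \<open>Below the top level the members of \<open>Iset\<close> are least in their class; at the
  top level the classes are singletons because the maps are distinct.\<close>

lemma Iset_unique:
  assumes "n \<in> {1..CARD('n)}" "i \<in> Iset N lam t \<sigma> n" "j \<in> Iset N lam t \<sigma> n" "eqv (set (take n \<sigma>)) i j"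
  shows "i = j"
proof (cases "n = CARD('n)")
  case True
  then have "set (take n \<sigma>) = UNIV" using permutation_of_UNIV[OF perm] by simp
  then show ?thesis using assms Iset_subset[of n] by (intro eqv_UNIV) auto
next
  case False
  then show ?thesis using assms eqv_sym[OF assms(4)]
    by (auto simp: Iset_def overlap_exact_iff_eqv) (metis atLeastAtMost_iff linorder_neqE_nat)
qed

lemma Pi_idx_props:
  assumes n: "n \<in> {1..CARD('n)}" and j: "j \<in> {1..N}"
  shows "Pi_idx N lam t \<sigma> n j \<in> Iset N lam t \<sigma> n" "eqv (set (take n \<sigma>)) (Pi_idx N lam t \<sigma> n j) j"
proof -
  have "Pi_idx N lam t \<sigma> n j \<in> Iset N lam t \<sigma> n \<and> eqv (set (take n \<sigma>)) (Pi_idx N lam t \<sigma> n j) j"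
  proof (cases "n = CARD('n)")
    case True
    then show ?thesis using assms by (simp add: Pi_idx_def Iset_def)
  next
    case False
    \<comment> \<open>The least member of the class of \<open>j\<close> is its
      representative.\<close>
    define i where "i = (LEAST i. i \<in> {1..N} \<and> eqv (set (take n \<sigma>)) i j)"
    have i: "i \<in> {1..N} \<and> eqv (set (take n \<sigma>)) i j"
      unfolding i_def by (rule LeastI[of _ j]) (use j in simp)
    have "\<not> eqv (set (take n \<sigma>)) k i" if "k \<in> {1..N}" "k < i" for k
      using not_less_Least[OF that(2)[unfolded i_def]] that(1) i eqv_trans by blast
    then have iI: "i \<in> Iset N lam t \<sigma> n"
      using i False n by (auto simp: Iset_def overlap_exact_iff_eqv)
    have "Pi_idx N lam t \<sigma> n j = i"
      unfolding Pi_idx_def overlap_exact_iff_eqv using False n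
      by (auto intro!: the_equality iI i[THEN conjunct2] Iset_unique[of n] intro: eqv_trans eqv_sym
          simp: i[THEN conjunct2] dest: eqv_sym)
    then show ?thesis using iI i by simp
  qed
  then show "Pi_idx N lam t \<sigma> n j \<in> Iset N lam t \<sigma> n" "eqv (set (take n \<sigma>)) (Pi_idx N lam t \<sigma> n j) j"
    by auto
qed

lemma Pi_idx_eq_iff:
  assumes n: "n \<in> {1..CARD('n)}" and i: "i \<in> {1..N}" and j: "j \<in> {1..N}"
  shows "Pi_idx N lam t \<sigma> n i = Pi_idx N lam t \<sigma> n j \<longleftrightarrow> eqv (set (take n \<sigma>)) i j"
proof
  assume "Pi_idx N lam t \<sigma> n i = Pi_idx N lam t \<sigma> n j"
  then show "eqv (set (take n \<sigma>)) i j"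
    using Pi_idx_props(2)[OF n i] Pi_idx_props(2)[OF n j] by (metis eqv_sym eqv_trans)
next
  assume "eqv (set (take n \<sigma>)) i j"
  then show "Pi_idx N lam t \<sigma> n i = Pi_idx N lam t \<sigma> n j"
    using Pi_idx_props[OF n i] Pi_idx_props[OF n j] by (metis eqv_sym eqv_trans Iset_unique[OF n])
qed

lemma Pi_idx_in: "n \<in> {1..CARD('n)} \<Longrightarrow> j \<in> {1..N} \<Longrightarrow> Pi_idx N lam t \<sigma> n j \<in> {1..N}"
  using Pi_idx_props(1)[of n j] Iset_subset[of n] by auto

lemma Pi_idx_Iset:
  assumes "n \<in> {1..CARD('n)}" "i \<in> Iset N lam t \<sigma> n"
  shows "Pi_idx N lam t \<sigma> n i = i"
proof -
  have "i \<in> {1..N}" using Iset_subset[of n] assms by auto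
  then show ?thesis using Iset_unique[OF assms(1)] Pi_idx_props[OF assms(1)] assms(2) by blast
qed

lemma Iset_eq_image: "n \<in> {1..CARD('n)} \<Longrightarrow> Iset N lam t \<sigma> n = Pi_idx N lam t \<sigma> n ` {1..N}"
  using Pi_idx_props(1) Pi_idx_Iset Iset_subset[of n] by (auto simp: image_iff) force

lemma Pi_idx_Pi_idx:
  assumes "m \<le> n" "n \<in> {1..CARD('n)}" "j \<in> {1..N}"
  shows "Pi_idx N lam t \<sigma> m (Pi_idx N lam t \<sigma> n j) = Pi_idx N lam t \<sigma> m j"
proof (cases "m = 0")
  case False
  have "eqv (set (take m \<sigma>)) (Pi_idx N lam t \<sigma> n j) j"
    by (rule eqv_subset[OF Pi_idx_props(2)[OF assms(2,3)]]) (simp add: set_take_subset_set_take assms(1))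
  then show ?thesis using False assms Pi_idx_in[OF assms(2,3)] by (subst Pi_idx_eq_iff) auto
qed (simp add: Pi_idx_def)

lemma p_marg_Pi_idx:
  assumes "n \<in> {1..CARD('n)}" "i \<in> {1..N}"
  shows "p_marg N lam t q \<sigma> n (Pi_idx N lam t \<sigma> n i) = (\<Sum>j\<in>{j\<in>{1..N}. eqv (set (take n \<sigma>)) i j}. q j)"
proof -
  have "{j\<in>{1..N}. Pi_idx N lam t \<sigma> n j = Pi_idx N lam t \<sigma> n i} = {j\<in>{1..N}. eqv (set (take n \<sigma>)) i j}"
    using Pi_idx_eq_iff[OF assms(1) _ assms(2)] eqv_sym by blast
  then show ?thesis using assms by (simp add: p_marg_def)
qed

lemma lam_Pi_idx:
  assumes "n < CARD('n)" "i \<in> {1..N}"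
  shows "lam (Pi_idx N lam t \<sigma> (Suc n) i) (\<sigma> ! n) = lam i (\<sigma> ! n)"
proof -
  have "\<sigma> ! n \<in> set (take (Suc n) \<sigma>)"
    using assms(1) permutation_of_UNIV[OF perm] by (simp add: take_Suc_conv_app_nth)
  then show ?thesis using Pi_idx_props(2)[of "Suc n" i] assms by (auto simp: eqv_def)
qed

text \<open>The conditional weight is a quotient of class weights, so its \<open>ln\<close> is
  \<open>- psi\<close>; the sign cancels against \<open>ln lam = - nlog\<close>.\<close>

lemma log_ratio_eq:
  assumes "n < CARD('n)" "i \<in> {1..N}"
  shows "ln (P_cond N lam t p \<sigma> n (Pi_idx N lam t \<sigma> (Suc n) i)) / ln (lam (Pi_idx N lam t \<sigma> (Suc n) i) (\<sigma> ! n))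
       = psi \<sigma> n i / nlog i (\<sigma> ! n)"
proof -
  have m: "p_marg N lam t p \<sigma> m (Pi_idx N lam t \<sigma> m i) = marg (set (take m \<sigma>)) i" if "m \<le> CARD('n)" for m
  proof (cases "m = 0")
    case True then show ?thesis by (simp add: p_marg_def)
  next
    case False then show ?thesis using that p_marg_Pi_idx[of m i p] assms by (simp add: marg_def)
  qed
  have "P_cond N lam t p \<sigma> n (Pi_idx N lam t \<sigma> (Suc n) i) = marg (set (take (Suc n) \<sigma>)) i / marg (set (take n \<sigma>)) i"
    unfolding P_cond_def using m[of n] m[of "Suc n"] Pi_idx_Pi_idx[of n "Suc n" i] assms by simp
  then have "ln (P_cond N lam t p \<sigma> n (Pi_idx N lam t \<sigma> (Suc n) i)) = - psi \<sigma> n i"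
    using marg_pos[OF assms(2), of "set (take n \<sigma>)"] marg_pos[OF assms(2), of "set (take (Suc n) \<sigma>)"]
    by (simp add: ln_div psi_def neg_ln_marg_def)
  then show ?thesis unfolding lam_Pi_idx[OF assms] nlog_def by simp
qed

lemma log_ratio_image:
  assumes "n < CARD('n)"
  shows "(\<lambda>i. ln (P_cond N lam t p \<sigma> n i) / ln (lam i (\<sigma> ! n))) ` Iset N lam t \<sigma> (Suc n)
       = (\<lambda>i. psi \<sigma> n i / nlog i (\<sigma> ! n)) ` {1..N}"
  using assms log_ratio_eq[OF assms] by (simp add: Iset_eq_image image_image)

lemma S_upper_eq: "S_upper N lam t p \<sigma> = sum_max_ratio \<sigma>"
  unfolding S_upper_def sum_max_ratio_def
  by (simp add: sum.atLeast1_atMost_eq log_ratio_image max_ratio_def)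

lemma S_lower_eq: "S_lower N lam t p \<sigma> = sum_min_ratio \<sigma>"
  unfolding S_lower_def sum_min_ratio_def
  by (simp add: sum.atLeast1_atMost_eq log_ratio_image min_ratio_def)

end

end

subsection \<open>The coordinate-wise natural measure\<close>

text \<open>The sum is continuous and strictly decreasing in \<open>s\<close> and at least 1 at
  \<open>s = 0\<close>; the intermediate value theorem needs a point where it is at most 1.\<close>

lemma Moran_equation_unique_solution:
  fixes a :: "'a \<Rightarrow> real"
  assumes "finite J" "J \<noteq> {}" and a: "\<And>j. j \<in> J \<Longrightarrow> 0 < a j \<and> a j < 1"
  shows "\<exists>!s. (\<Sum>j\<in>J. a j powr s) = 1"
proof -
  define f where "f s = (\<Sum>j\<in>J. a j powr s)" for s
  have dec: "f y < f x" if "x < y" for x y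
    unfolding f_def using assms that by (intro sum_strict_mono powr_less_mono') auto
  define m where "m = Max (a ` J)"
  have "m \<in> a ` J" unfolding m_def using assms by (intro Max_in) auto
  then have m: "0 < m" "m < 1" using a by auto
  \<comment> \<open>With \<open>m\<close> the largest ratio, \<open>S\<close> solves
    \<open>card J * m powr S = 1\<close>.\<close>
  define S where "S = ln (real (card J)) / (- ln m)"
  have card: "real (card J) \<ge> 1" using assms by (simp add: Suc_le_eq card_gt_0_iff)
  have S0: "0 \<le> S" unfolding S_def using card m by (intro divide_nonneg_pos) (auto simp: ln_less_zero)
  have "f S \<le> (\<Sum>j\<in>J. m powr S)"
    unfolding f_def m_def using assms a S0 less_imp_le[OF conjunct1[OF a]]
    by (intro sum_mono powr_mono2) auto
  also have "\<dots> = real (card J) * m powr S" by simp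
  also have "m powr S = 1 / card J"
    unfolding S_def powr_def using m card by (simp add: exp_minus inverse_eq_divide)
  finally have fS: "f S \<le> 1" using card by simp
  have feq: "f = (\<lambda>s. \<Sum>j\<in>J. exp (s * ln (a j)))"
  proof
    fix s
    show "f s = (\<Sum>j\<in>J. exp (s * ln (a j)))"
      unfolding f_def using a by (intro sum.cong refl) (force simp: powr_def)
  qed
  have f0: "f 0 \<ge> 1" unfolding feq using card by simp
  have cont: "isCont f s" for s unfolding feq by (intro continuous_intros)
  obtain s where "f s = 1" using IVT2[OF fS f0 S0] cont by blast
  moreover have "s' = s" if "f s' = 1" for s'
    using dec[of s s'] dec[of s' s] that \<open>f s = 1\<close> by (cases s s' rule: linorder_cases) auto
  ultimately show ?thesis unfolding f_def by blast
qed

context sponge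
begin

context
  fixes \<sigma> :: "'n list"
  assumes perm: "\<sigma> \<in> permutations_of_set UNIV"
begin

private abbreviation "I \<equiv> Iset N lam t \<sigma>"
private abbreviation "Pj \<equiv> Pi_idx N lam t \<sigma>"
private abbreviation "se \<equiv> s_exp N lam t \<sigma>"
private abbreviation "q \<equiv> natural_q N lam t \<sigma>"

text \<open>Every class at level \<open>n\<close> is refined at level \<open>n + 1\<close>. So the
  sums defining \<open>s_exp\<close> are nonempty, and an extremum over the finer indices of a
  quantity depending only on the coarser one is an extremum over \<open>I n\<close>.\<close>

lemma Pi_idx_image_Iset_Suc:
  assumes "n < CARD('n)"
  shows "Pj n ` I (Suc n) = I n"
proof (cases "n = 0")
  case True
  have "I (Suc 0) \<noteq> {}" using Iset_eq_image[OF perm, of "Suc 0"] N_pos by simp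
  then show ?thesis using True by (auto simp: Pi_idx_def Iset_def)
next
  case False
  have "Pj n ` I (Suc n) = Pj n ` {1..N}"
    using assms Pi_idx_Pi_idx[OF perm, of n "Suc n"] by (simp add: Iset_eq_image[OF perm] image_image)
  then show ?thesis using False assms Iset_eq_image[OF perm, of n] by simp
qed

lemma s_exp_sum:
  assumes "n < CARD('n)" "i \<in> I n"
  shows "(\<Sum>j\<in>{j\<in>I (Suc n). Pj n j = i}. lam j (\<sigma> ! n) powr se n i) = 1"
proof -
  have "\<exists>!s. (\<Sum>j\<in>{j\<in>I (Suc n). Pj n j = i}. lam j (\<sigma> ! n) powr s) = 1"
  proof (rule Moran_equation_unique_solution)
    have sub: "I (Suc n) \<subseteq> {1..N}" by (rule Iset_subset[OF perm]) simp
    show "finite {j \<in> I (Suc n). Pj n j = i}" using finite_subset[OF sub] by simp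
    have "i \<in> Pj n ` I (Suc n)" by (simp only: Pi_idx_image_Iset_Suc[OF assms(1)] assms(2))
    then show "{j \<in> I (Suc n). Pj n j = i} \<noteq> {}" by auto
    show "0 < lam j (\<sigma> ! n) \<and> lam j (\<sigma> ! n) < 1" if "j \<in> {j \<in> I (Suc n). Pj n j = i}" for j
      using that sub by (intro lam_range) auto
  qed
  from theI'[OF this] show ?thesis by (simp add: s_exp_def)
qed

text \<open>The first \<open>n\<close> factors of \<open>natural_q\<close>;
  \<open>p_marg_natural_q\<close> identifies them as its marginal at level \<open>n\<close>.\<close>

definition natural_marg :: "nat \<Rightarrow> nat \<Rightarrow> real" where
  "natural_marg n i = (\<Prod>m<n. lam (Pj (Suc m) i) (\<sigma> ! m) powr se m (Pj m i))"

lemma natural_q_eq: "q i = natural_marg (CARD('n)) i"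
  unfolding natural_q_def natural_marg_def by (simp add: prod.atLeast1_atMost_eq)

lemma natural_marg_Pi_idx:
  assumes "n \<in> {1..CARD('n)}" "i \<in> {1..N}"
  shows "natural_marg n (Pj n i) = natural_marg n i"
  unfolding natural_marg_def
  by (rule prod.cong) (use Pi_idx_Pi_idx[OF perm _ assms] in auto)

lemma natural_marg_pos:
  assumes "i \<in> {1..N}" "n \<le> CARD('n)"
  shows "0 < natural_marg n i"
  unfolding natural_marg_def
proof (rule prod_pos)
  fix m assume "m \<in> {..<n}"
  then have "Pj (Suc m) i \<in> {1..N}" using assms by (intro Pi_idx_in[OF perm]) auto
  then show "0 < lam (Pj (Suc m) i) (\<sigma> ! m) powr se m (Pj m i)"
    using lam_range[of "Pj (Suc m) i" "\<sigma> ! m"] by simp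
qed

text \<open>Induction downwards from the full dimension: summing over the refinements of a class
  removes the last factor, which sums to 1 by the equation defining \<open>s_exp\<close>.\<close>

lemma p_marg_natural_q:
  assumes "n \<le> CARD('n)" "1 \<le> n"
  shows "\<forall>i\<in>I n. p_marg N lam t q \<sigma> n i = natural_marg n i"
  using assms
proof (induction n rule: inc_induct)
  case base
  show ?case
  proof
    fix i assume "i \<in> I (CARD('n))"
    then have "i \<in> {1..N}" using Iset_subset[OF perm, of "CARD('n)"] by auto
    then have "{j \<in> {1..N}. Pj (CARD('n)) j = i} = {i}" by (auto simp: Pi_idx_def)
    then have "(\<Sum>j\<in>{j \<in> {1..N}. Pj (CARD('n)) j = i}. q j) = q i" by (simp only: sum.insert) simp
    then show "p_marg N lam t q \<sigma> CARD('n) i = natural_marg CARD('n) i"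
      by (simp add: p_marg_def natural_q_eq)
  qed
next
  case (step n)
  have n: "n \<in> {1..CARD('n)}" "Suc n \<in> {1..CARD('n)}" using step by auto
  show ?case
  proof
    fix i assume i: "i \<in> I n"
    let ?J = "{k \<in> I (Suc n). Pj n k = i}"
    let ?A = "{j \<in> {1..N}. Pj n j = i}"
    have subI: "I (Suc n) \<subseteq> {1..N}" by (rule Iset_subset[OF perm]) simp
    have fJ: "finite ?J" using finite_subset[OF subI] by simp
    have "p_marg N lam t q \<sigma> n i = (\<Sum>j\<in>?A. q j)" using n by (simp add: p_marg_def)
    also have "\<dots> = (\<Sum>k\<in>?J. \<Sum>j\<in>{j\<in>?A. Pj (Suc n) j = k}. q j)"
      by (rule sum.group[symmetric])
        (use fJ Pi_idx_Pi_idx[OF perm _ n(2), of n] Pi_idx_props(1)[OF perm n(2)] in auto)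
    also have "\<dots> = (\<Sum>k\<in>?J. p_marg N lam t q \<sigma> (Suc n) k)"
    proof (rule sum.cong[OF refl])
      fix k assume k: "k \<in> ?J"
      have "{j\<in>?A. Pj (Suc n) j = k} = {j\<in>{1..N}. Pj (Suc n) j = k}"
        using k Pi_idx_Pi_idx[OF perm _ n(2), of n] by auto
      then show "(\<Sum>j\<in>{j\<in>?A. Pj (Suc n) j = k}. q j) = p_marg N lam t q \<sigma> (Suc n) k"
        by (simp add: p_marg_def)
    qed
    also have "\<dots> = (\<Sum>k\<in>?J. natural_marg n i * lam k (\<sigma> ! n) powr se n i)"
    proof (rule sum.cong[OF refl])
      fix k assume k: "k \<in> ?J"
      then have "k \<in> {1..N}" using subI by auto
      then have "natural_marg n k = natural_marg n i"
        using natural_marg_Pi_idx[OF n(1), of k] k by simp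
      moreover have "Pj (Suc n) k = k" using Pi_idx_Iset[OF perm n(2)] k by auto
      ultimately have "natural_marg (Suc n) k = natural_marg n i * lam k (\<sigma> ! n) powr se n i"
        using k by (simp add: natural_marg_def)
      then show "p_marg N lam t q \<sigma> (Suc n) k = natural_marg n i * lam k (\<sigma> ! n) powr se n i"
        using step.IH k by simp
    qed
    also have "\<dots> = natural_marg n i * (\<Sum>k\<in>?J. lam k (\<sigma> ! n) powr se n i)"
      by (simp add: sum_distrib_left)
    also have "\<dots> = natural_marg n i" using s_exp_sum[of n i] i n by simp
    finally show "p_marg N lam t q \<sigma> n i = natural_marg n i" .
  qed
qed

text \<open>Consecutive marginals differ by a single power of \<open>lam\<close>, so the logarithmic
  ratio is the exponent itself.\<close>

lemma natural_q_log_ratio: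
  assumes "n < CARD('n)" "i \<in> I (Suc n)"
  shows "ln (P_cond N lam t q \<sigma> n i) / ln (lam i (\<sigma> ! n)) = se n (Pj n i)"
proof -
  have iN: "i \<in> {1..N}" using Iset_subset[OF perm, of "Suc n"] assms by auto
  have d: "p_marg N lam t q \<sigma> n (Pj n i) = natural_marg n i"
  proof (cases "n = 0")
    case True
    then show ?thesis by (simp add: p_marg_def natural_marg_def)
  next
    case False
    then have n: "n \<in> {1..CARD('n)}" using assms by auto
    then show ?thesis using p_marg_natural_q[of n] Pi_idx_props(1)[OF perm n iN] natural_marg_Pi_idx[OF n iN]
      by simp
  qed
  have "Pj (Suc n) i = i" using assms by (intro Pi_idx_Iset[OF perm]) auto
  then have "p_marg N lam t q \<sigma> (Suc n) i = natural_marg n i * lam i (\<sigma> ! n) powr se n (Pj n i)"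
    using p_marg_natural_q[of "Suc n"] assms by (simp add: natural_marg_def)
  then have "P_cond N lam t q \<sigma> n i = lam i (\<sigma> ! n) powr se n (Pj n i)"
    unfolding P_cond_def using d natural_marg_pos[OF iN, of n] assms by simp
  moreover have "ln (lam i (\<sigma> ! n)) < 0" using lam_range[OF iN, of "\<sigma> ! n"] by (simp add: ln_less_zero)
  ultimately show ?thesis using lam_range[OF iN, of "\<sigma> ! n"] by (simp add: ln_powr)
qed

lemma natural_q_log_ratio_image:
  assumes "n < CARD('n)"
  shows "(\<lambda>i. ln (P_cond N lam t q \<sigma> n i) / ln (lam i (\<sigma> ! n))) ` I (Suc n) = se n ` I n"
proof -
  have "(\<lambda>i. ln (P_cond N lam t q \<sigma> n i) / ln (lam i (\<sigma> ! n))) ` I (Suc n) = (\<lambda>i. se n (Pj n i)) ` I (Suc n)"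
    by (rule image_cong) (use natural_q_log_ratio[OF assms] in auto)
  also have "\<dots> = se n ` Pj n ` I (Suc n)" by (simp add: image_image)
  finally show ?thesis unfolding Pi_idx_image_Iset_Suc[OF assms] .
qed

lemma sum_split_first:
  fixes f :: "nat \<Rightarrow> real"
  shows "(\<Sum>n<CARD('n). f n) = f 0 + (\<Sum>n\<in>{1..CARD('n)-1}. f n)"
proof -
  have "CARD('n) = Suc (CARD('n) - 1)" by simp
  then have "(\<Sum>n<CARD('n). f n) = f 0 + (\<Sum>n<CARD('n)-1. f (Suc n))"
    by (metis sum.lessThan_Suc_shift)
  then show ?thesis by (simp add: sum.atLeast1_atMost_eq)
qed

lemma S_upper_natural:
  "S_upper N lam t q \<sigma> = se 0 0 + (\<Sum>n\<in>{1..CARD('n)-1}. Max (se n ` I n))"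
proof -
  have "S_upper N lam t q \<sigma> = (\<Sum>n<CARD('n). Max (se n ` I n))"
    unfolding S_upper_def by (simp add: sum.atLeast1_atMost_eq natural_q_log_ratio_image)
  \<comment> \<open>The index set at level 0 is \<open>{0}\<close>, so the first extremum is the
    single value \<open>se 0 0\<close>.\<close>
  then show ?thesis unfolding sum_split_first by (simp add: Iset_def)
qed

lemma S_lower_natural:
  "S_lower N lam t q \<sigma> = se 0 0 + (\<Sum>n\<in>{1..CARD('n)-1}. Min (se n ` I n))"
proof -
  have "S_lower N lam t q \<sigma> = (\<Sum>n<CARD('n). Min (se n ` I n))"
    unfolding S_lower_def by (simp add: sum.atLeast1_atMost_eq natural_q_log_ratio_image)
  then show ?thesis unfolding sum_split_first by (simp add: Iset_def)
qed

end

end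

subsection \<open>Geometry of the coding map\<close>

lemma wcomp_add: "wcomp f w (k + m) = wcomp f w k \<circ> wcomp f (\<lambda>l. w (k + l)) m"
  by (induction m) (auto simp: comp_assoc)

lemma wcomp_ifs_nth:
  "wcomp (ifs lam t) w k x $ c = prodw lam w c k * x $ c + (\<Sum>l<k. prodw lam w c l * t (w l) $ c)"
proof (induction k arbitrary: x)
  case (Suc k)
  have "wcomp (ifs lam t) w (Suc k) x $ c = prodw lam w c k * ifs lam t (w k) x $ c
      + (\<Sum>l<k. prodw lam w c l * t (w l) $ c)"
    using Suc.IH by simp
  also have "\<dots> = prodw lam w c (Suc k) * x $ c + (\<Sum>l<Suc k. prodw lam w c l * t (w l) $ c)"
    by (simp add: ifs_def prodw_def algebra_simps)
  finally show ?case .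
qed (simp add: prodw_def)

context sponge
begin

lemma ifs_coordinate_bounds:
  assumes "i \<in> {1..N}"
  shows "0 \<le> t i $ c" "t i $ c + lam i c \<le> 1"
proof -
  have "0 \<in> unit_cube" "(\<chi> _. 1) \<in> unit_cube" by (auto simp: unit_cube_def)
  then have "ifs lam t i 0 \<in> unit_cube" "ifs lam t i (\<chi> _. 1) \<in> unit_cube"
    using maps_in_cube[OF assms] by blast+
  then show "0 \<le> t i $ c" "t i $ c + lam i c \<le> 1"
    by (auto simp: unit_cube_def ifs_def add.commute)
qed

lemma wcomp_in_cube:
  assumes "w \<in> sym_space N" "x \<in> unit_cube"
  shows "wcomp (ifs lam t) w k x \<in> unit_cube"
  using assms(2)
proof (induction k arbitrary: x)
  case (Suc k)
  then have "ifs lam t (w k) x \<in> unit_cube" using maps_in_cube[OF sym_spaceD[OF assms(1)]] by blast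
  then show ?case using Suc.IH by simp
qed simp

lemma prodw_pos: "w \<in> sym_space N \<Longrightarrow> 0 < prodw lam w c k"
  by (simp add: prodw_eq_exp)

text \<open>Translations are nonnegative because the maps send 0 into the cube; so each coordinate
  of the images of 0 increases, and it stays below 1.\<close>

lemma coding_LIMSEQ:
  assumes w: "w \<in> sym_space N"
  shows "(\<lambda>k. wcomp (ifs lam t) w k 0) \<longlonglongrightarrow> coding lam t w"
proof -
  have "\<exists>L. (\<lambda>k. wcomp (ifs lam t) w k 0 $ c) \<longlonglongrightarrow> L" for c
  proof -
    have "incseq (\<lambda>k. wcomp (ifs lam t) w k 0 $ c)"
      unfolding wcomp_ifs_nth
      using prodw_pos[OF w, of c] ifs_coordinate_bounds(1)[OF sym_spaceD[OF w], of _ c]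
      by (intro incseq_SucI) (auto intro!: mult_nonneg_nonneg simp: less_imp_le)
    moreover have "wcomp (ifs lam t) w k 0 $ c \<le> 1" for k
      using wcomp_in_cube[OF w, of 0 k] by (auto simp: unit_cube_def)
    ultimately show ?thesis using incseq_convergent[of "\<lambda>k. wcomp (ifs lam t) w k 0 $ c" 1] by metis
  qed
  then obtain L where "\<And>c. (\<lambda>k. wcomp (ifs lam t) w k 0 $ c) \<longlonglongrightarrow> L c" by metis
  then have "(\<lambda>k. wcomp (ifs lam t) w k 0) \<longlonglongrightarrow> (\<chi> c. L c)" by (intro vec_tendstoI) simp
  then show ?thesis unfolding coding_def using limI by metis
qed

lemma coding_in_cube:
  assumes w: "w \<in> sym_space N"
  shows "0 \<le> coding lam t w $ c" "coding lam t w $ c \<le> 1"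
proof -
  have l: "(\<lambda>k. wcomp (ifs lam t) w k 0 $ c) \<longlonglongrightarrow> coding lam t w $ c"
    by (intro tendsto_vec_nth coding_LIMSEQ[OF w])
  have b: "0 \<le> wcomp (ifs lam t) w k 0 $ c" "wcomp (ifs lam t) w k 0 $ c \<le> 1" for k
    using wcomp_in_cube[OF w, of 0 k] by (auto simp: unit_cube_def)
  show "0 \<le> coding lam t w $ c" by (rule LIMSEQ_le_const[OF l]) (use b in blast)
  show "coding lam t w $ c \<le> 1" by (rule LIMSEQ_le_const2[OF l]) (use b in blast)
qed

lemma shift_in_sym_space: "w \<in> sym_space N \<Longrightarrow> (\<lambda>l. w (k + l)) \<in> sym_space N"
  by (simp add: sym_space_def)

lemma coding_shift:
  assumes w: "w \<in> sym_space N"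
  shows "coding lam t w $ c
    = prodw lam w c k * coding lam t (\<lambda>l. w (k + l)) $ c + (\<Sum>l<k. prodw lam w c l * t (w l) $ c)"
proof (rule LIMSEQ_unique)
  show "(\<lambda>m. wcomp (ifs lam t) w (m + k) 0 $ c) \<longlonglongrightarrow> coding lam t w $ c"
    by (intro tendsto_vec_nth LIMSEQ_ignore_initial_segment[OF coding_LIMSEQ[OF w]])
  have "(\<lambda>m. prodw lam w c k * wcomp (ifs lam t) (\<lambda>l. w (k + l)) m 0 $ c
      + (\<Sum>l<k. prodw lam w c l * t (w l) $ c)) \<longlonglongrightarrow>
    prodw lam w c k * coding lam t (\<lambda>l. w (k + l)) $ c + (\<Sum>l<k. prodw lam w c l * t (w l) $ c)"
    by (intro tendsto_intros tendsto_vec_nth coding_LIMSEQ shift_in_sym_space[OF w])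
  then show "(\<lambda>m. wcomp (ifs lam t) w (m + k) 0 $ c) \<longlonglongrightarrow>
    prodw lam w c k * coding lam t (\<lambda>l. w (k + l)) $ c + (\<Sum>l<k. prodw lam w c l * t (w l) $ c)"
    by (simp add: add.commute[of _ k] wcomp_add wcomp_ifs_nth[of _ _ w k])
qed

text \<open>The maps act on each coordinate separately, so agreement of the letters in
  \<open>c\<close> alone makes the translation parts cancel.\<close>

lemma coding_common_prefix:
  assumes w: "w \<in> sym_space N" and v: "v \<in> sym_space N" and eq: "\<And>l. l < k \<Longrightarrow> eqv {c} (w l) (v l)"
  shows "coding lam t w $ c - coding lam t v $ c
    = prodw lam w c k * (coding lam t (\<lambda>l. w (k + l)) $ c - coding lam t (\<lambda>l. v (k + l)) $ c)"
proof -
  have p: "prodw lam w c m = prodw lam v c m" if "m \<le> k" for m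
    unfolding prodw_def by (rule prod.cong) (use eq that in \<open>auto simp: eqv_def\<close>)
  have "(\<Sum>l<k. prodw lam w c l * t (w l) $ c) = (\<Sum>l<k. prodw lam v c l * t (v l) $ c)"
    by (rule sum.cong) (use eq p in \<open>auto simp: eqv_def\<close>)
  then show ?thesis
    using coding_shift[OF w, of c k] coding_shift[OF v, of c k] p[of k] by (simp add: algebra_simps)
qed

lemma coding_dist_upper:
  assumes w: "w \<in> sym_space N" and v: "v \<in> sym_space N" and eq: "\<And>l. l < k \<Longrightarrow> eqv {c} (w l) (v l)"
  shows "\<bar>coding lam t w $ c - coding lam t v $ c\<bar> \<le> prodw lam w c k"
proof -
  have "\<bar>coding lam t (\<lambda>l. w (k + l)) $ c - coding lam t (\<lambda>l. v (k + l)) $ c\<bar> \<le> 1"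
    using coding_in_cube[OF shift_in_sym_space[OF w], of k c] coding_in_cube[OF shift_in_sym_space[OF v], of k c]
    by linarith
  moreover have "coding lam t w $ c - coding lam t v $ c
    = prodw lam w c k * (coding lam t (\<lambda>l. w (k + l)) $ c - coding lam t (\<lambda>l. v (k + l)) $ c)"
    by (rule coding_common_prefix[OF w v eq])
  ultimately show ?thesis using prodw_pos[OF w, of c k] by (simp add: abs_mult mult_left_le)
qed

lemma coding_first_letter:
  assumes w: "w \<in> sym_space N"
  shows "t (w 0) $ c \<le> coding lam t w $ c" "coding lam t w $ c \<le> t (w 0) $ c + lam (w 0) c"
proof -
  have "coding lam t w $ c = lam (w 0) c * coding lam t (\<lambda>l. w (1 + l)) $ c + t (w 0) $ c"
    using coding_shift[OF w, of c 1] by (simp add: prodw_def)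
  moreover have "0 \<le> lam (w 0) c * coding lam t (\<lambda>l. w (1 + l)) $ c"
      "lam (w 0) c * coding lam t (\<lambda>l. w (1 + l)) $ c \<le> lam (w 0) c"
    using coding_in_cube[OF shift_in_sym_space[OF w], of 1 c] lam_range[OF sym_spaceD[OF w, of 0], of c]
    by (auto simp: mult_left_le)
  ultimately show "t (w 0) $ c \<le> coding lam t w $ c" "coding lam t w $ c \<le> t (w 0) $ c + lam (w 0) c"
    by auto
qed

text \<open>Once the common prefix is removed, the tails lie in the first-level intervals of
  \<open>w k\<close> and \<open>v k\<close>, which are \<delta> apart.\<close>

lemma coding_dist_lower:
  assumes w: "w \<in> sym_space N" and v: "v \<in> sym_space N" and eq: "\<And>l. l < k \<Longrightarrow> eqv {c} (w l) (v l)"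
    and gap: "t (v k) $ c + lam (v k) c + \<delta> \<le> t (w k) $ c \<or> t (w k) $ c + lam (w k) c + \<delta> \<le> t (v k) $ c"
  shows "prodw lam w c k * \<delta> \<le> \<bar>coding lam t w $ c - coding lam t v $ c\<bar>"
proof -
  have "\<delta> \<le> \<bar>coding lam t (\<lambda>l. w (k + l)) $ c - coding lam t (\<lambda>l. v (k + l)) $ c\<bar>"
    using gap coding_first_letter[OF shift_in_sym_space[OF w], of k c]
      coding_first_letter[OF shift_in_sym_space[OF v], of k c] by auto
  moreover have "coding lam t w $ c - coding lam t v $ c
    = prodw lam w c k * (coding lam t (\<lambda>l. w (k + l)) $ c - coding lam t (\<lambda>l. v (k + l)) $ c)"
    by (rule coding_common_prefix[OF w v eq])
  ultimately show ?thesis using prodw_pos[OF w, of c k] by (simp add: abs_mult)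
qed

text \<open>The images of the cube are axis-parallel boxes, and disjoint boxes are already disjoint
  in one coordinate.\<close>

lemma SPPC_gap:
  assumes \<sigma>: "\<sigma> \<in> permsA N lam" and n: "n \<in> {1..CARD('n)}" and ij: "i \<in> {1..N}" "j \<in> {1..N}"
    and ne: "\<not> eqv (set (take n \<sigma>)) i j"
  shows "\<exists>c\<in>set (take n \<sigma>). t j $ c + lam j c < t i $ c \<or> t i $ c + lam i c < t j $ c"
proof (rule ccontr)
  assume "\<not> ?thesis"
  then have h: "t i $ c \<le> t j $ c + lam j c" "t j $ c \<le> t i $ c + lam i c" if "c \<in> set (take n \<sigma>)" for c
    using that by (auto simp: not_less)
  \<comment> \<open>If all the intervals met, the larger left endpoints would form a common point of
    the projected boxes; \<open>pt k\<close> is a preimage of it under map \<open>k\<close>.\<close>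
  define z where "z c = max (t i $ c) (t j $ c)" for c
  define pt where "pt k = (\<chi> c. if c \<in> set (take n \<sigma>) then (z c - t k $ c) / lam k c else 0)" for k
  have l: "0 < lam i c" "0 < lam j c" for c using lam_range ij by blast+
  have "0 \<le> z c - t i $ c" "0 \<le> z c - t j $ c" for c by (auto simp: z_def)
  moreover have "z c - t i $ c \<le> lam i c" "z c - t j $ c \<le> lam j c" if "c \<in> set (take n \<sigma>)" for c
    using h[OF that] l[of c] by (auto simp: z_def)
  ultimately have "pt i \<in> unit_cube" "pt j \<in> unit_cube"
    using l by (auto simp: unit_cube_def pt_def divide_le_eq intro!: divide_nonneg_pos)
  moreover have "projE \<sigma> n (ifs lam t i (pt i)) = projE \<sigma> n (ifs lam t j (pt j))"
    using l less_imp_neq[OF l(1)] less_imp_neq[OF l(2)]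
    by (auto simp: projE_def proj_def ifs_def pt_def vec_eq_iff)
  ultimately have "projE \<sigma> n ` (ifs lam t i ` unit_cube) \<inter> projE \<sigma> n ` (ifs lam t j ` unit_cube) \<noteq> {}"
    by blast
  then show False
    using SPPC \<sigma> n ij ne unfolding very_strong_SPPC_def overlap_exact_iff_eqv by blast
qed

text \<open>The positive gaps between first-level intervals; the extra 1 makes this finite set
  nonempty and caps its minimum.\<close>

definition gap_set :: "real set" where
  "gap_set = insert 1 {g \<in> (\<lambda>(i, j, c). t i $ c - (t j $ c + lam j c)) ` ({1..N} \<times> {1..N} \<times> UNIV). 0 < g}"

definition gap :: real where "gap = Min gap_set"

lemma finite_gap_set: "finite gap_set" by (simp add: gap_set_def)

lemma gap_pos: "0 < gap" and gap_le_1: "gap \<le> 1"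
proof -
  have "gap \<in> gap_set" unfolding gap_def by (rule Min_in[OF finite_gap_set]) (simp add: gap_set_def)
  then show "0 < gap" by (auto simp: gap_set_def)
  show "gap \<le> 1" unfolding gap_def by (rule Min_le[OF finite_gap_set]) (simp add: gap_set_def)
qed

lemma gap_le: "i \<in> {1..N} \<Longrightarrow> j \<in> {1..N} \<Longrightarrow> t j $ c + lam j c < t i $ c \<Longrightarrow> t j $ c + lam j c + gap \<le> t i $ c"
proof -
  assume a: "i \<in> {1..N}" "j \<in> {1..N}" "t j $ c + lam j c < t i $ c"
  then have "t i $ c - (t j $ c + lam j c) \<in> gap_set"
    unfolding gap_set_def by (auto intro!: image_eqI[of _ _ "(i, j, c)"])
  then have "gap \<le> t i $ c - (t j $ c + lam j c)" unfolding gap_def by (rule Min_le[OF finite_gap_set])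
  then show ?thesis by simp
qed

text \<open>At the first letter where \<open>w\<close> and \<open>v\<close> differ visibly, the SPPC
  separates them in a visible coordinate \<open>c\<close>. Visible sets shrink along the word, so
  all earlier letters agree in \<open>c\<close>, and the common product in \<open>c\<close> still
  exceeds \<open>exp (- T)\<close>.\<close>

lemma coding_separation:
  assumes w: "w \<in> sym_space N" and v: "v \<in> sym_space N" and T: "0 < T" and nv: "v \<notin> approx_cube w T"
  shows "\<exists>c. gap * exp (- T) < \<bar>coding lam t w $ c - coding lam t v $ c\<bar>"
proof -
  define l where "l = (LEAST l. \<not> eqv (visible w T l) (w l) (v l))"
  have ex: "\<exists>l. \<not> eqv (visible w T l) (w l) (v l)" using nv v by (auto simp: approx_cube_def)
  have l: "\<not> eqv (visible w T l) (w l) (v l)" unfolding l_def using LeastI_ex[OF ex] .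
  have lm: "eqv (visible w T m) (w m) (v m)" if "m < l" for m
    using not_less_Least[OF that[unfolded l_def]] by simp
  obtain \<sigma> where \<sigma>: "\<sigma> \<in> permsA N lam" "dec_order w T \<sigma>" using exists_permsA_dec_order[OF w T] by blast
  then obtain n where n: "n \<le> CARD('n)" "visible w T l = set (take n \<sigma>)"
    using visible_eq_set_take[OF w, of \<sigma> T l] permsA_sub by blast
  have "n \<noteq> 0"
  proof
    assume "n = 0"
    then have "visible w T l = {}" using n(2) by simp
    then show False using l by (simp add: eqv_def)
  qed
  then have "n \<in> {1..CARD('n)}" using n(1) by simp
  from SPPC_gap[OF \<sigma>(1) this sym_spaceD[OF w] sym_spaceD[OF v] l[unfolded n(2)]]
  obtain c where c: "c \<in> visible w T l" and g: "t (v l) $ c + lam (v l) c < t (w l) $ c \<or> t (w l) $ c + lam (w l) c < t (v l) $ c"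
    using n(2) by blast
  have "prodw lam w c l * gap \<le> \<bar>coding lam t w $ c - coding lam t v $ c\<bar>"
  proof (rule coding_dist_lower[OF w v])
    fix m assume "m < l"
    then show "eqv {c} (w m) (v m)"
      using lm[of m] visible_antimono[OF w, of m l T] c by (auto simp: eqv_def)
  next
    show "t (v l) $ c + lam (v l) c + gap \<le> t (w l) $ c \<or> t (w l) $ c + lam (w l) c + gap \<le> t (v l) $ c"
      using g gap_le[OF sym_spaceD[OF w] sym_spaceD[OF v]] gap_le[OF sym_spaceD[OF v] sym_spaceD[OF w]] by blast
  qed
  moreover have "exp (- T) < prodw lam w c l"
    using c by (simp add: visible_def prodw_eq_exp[OF w])
  then have "gap * exp (- T) < prodw lam w c l * gap" using gap_pos by simp
  ultimately show ?thesis by (intro exI[of _ c]) linarith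
qed

text \<open>In each coordinate the letters agree up to its stopping time; the factor
  \<open>CARD('n)\<close> comes from bounding the norm by the sum of the coordinates.\<close>

lemma approx_cube_dist:
  assumes w: "w \<in> sym_space N" and v: "v \<in> approx_cube w T"
  shows "dist (coding lam t w) (coding lam t v) \<le> CARD('n) * exp (- T)"
proof -
  have vs: "v \<in> sym_space N" and eq: "\<And>l. eqv (visible w T l) (w l) (v l)" using v by (auto simp: approx_cube_def)
  have "\<bar>coding lam t w $ c - coding lam t v $ c\<bar> \<le> exp (- T)" for c
  proof -
    have "\<bar>coding lam t w $ c - coding lam t v $ c\<bar> \<le> prodw lam w c (stop w T c)"
      by (rule coding_dist_upper[OF w vs]) (use eq mem_visible_iff[OF w] in \<open>auto simp: eqv_def\<close>)
    also have "\<dots> \<le> exp (- T)" using nlog_sum_stop_ge[OF w, of T c] by (simp add: prodw_eq_exp[OF w])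
    finally show ?thesis .
  qed
  then have "(\<Sum>c\<in>UNIV. \<bar>(coding lam t w - coding lam t v) $ c\<bar>) \<le> (\<Sum>c\<in>(UNIV::'n set). exp (- T))"
    by (intro sum_mono) simp
  then show ?thesis using norm_le_l1_cart[of "coding lam t w - coding lam t v"] by (simp add: dist_norm)
qed

subsection \<open>The self-affine measure of balls\<close>

lemma prob_space_letter: "prob_space (point_measure {1..N} (\<lambda>i. ennreal (p i)))"
proof
  have "emeasure (point_measure {1..N} (\<lambda>i. ennreal (p i))) {1..N} = (\<Sum>i\<in>{1..N}. ennreal (p i))"
    by (rule emeasure_point_measure_finite) auto
  also have "\<dots> = 1" using p_sum by (subst sum_ennreal) (auto intro: less_imp_le[OF p_pos])
  finally show "emeasure (point_measure {1..N} (\<lambda>i. ennreal (p i)))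
      (space (point_measure {1..N} (\<lambda>i. ennreal (p i)))) = 1"
    by (simp add: space_point_measure)
qed

lemma space_bernoulli: "space (bernoulli N p) = sym_space N"
  by (auto simp: bernoulli_def space_PiM space_point_measure sym_space_def PiE_def Pi_def)

lemma prob_space_bernoulli: "prob_space (bernoulli N p)"
  unfolding bernoulli_def by (rule prob_space_PiM) (rule prob_space_letter)

text \<open>Only finitely many letters are constrained, which makes the cube a cylinder set of the
  product space.\<close>

lemma approx_cube_eq_Collect:
  assumes w: "w \<in> sym_space N"
  shows "approx_cube w T = {v \<in> space (bernoulli N p). \<forall>l\<in>{..<depth_bound w T}. v l \<in> {j \<in> {1..N}. eqv (visible w T l) (w l) j}}"
proof -
  have "eqv (visible w T l) (w l) (v l)" if "l \<ge> depth_bound w T" for l v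
    using visible_empty[OF w that] by (simp add: eqv_def)
  then show ?thesis
    unfolding approx_cube_def space_bernoulli
    by (auto dest: sym_spaceD) (metis lessThan_iff not_le)
qed

lemma approx_cube_measure:
  assumes w: "w \<in> sym_space N"
  shows "approx_cube w T \<in> sets (bernoulli N p)"
    and "measure (bernoulli N p) (approx_cube w T) = exp (- cost w T)"
proof -
  let ?M = "\<lambda>_::nat. point_measure {1..N} (\<lambda>i. ennreal (p i))"
  let ?E = "\<lambda>l. {j \<in> {1..N}. eqv (visible w T l) (w l) j}"
  interpret letter: prob_space "?M i" for i by (rule prob_space_letter)
  interpret product_prob_space ?M UNIV ..
  have s: "?E l \<in> sets (?M l)" for l by (auto simp: sets_point_measure)
  have "emeasure (bernoulli N p) (approx_cube w T) = (\<Prod>l<depth_bound w T. emeasure (?M l) (?E l))"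
    unfolding approx_cube_eq_Collect[OF w] unfolding bernoulli_def
    by (rule emeasure_PiM_Collect) (use s in auto)
  also have "\<dots> = (\<Prod>l<depth_bound w T. ennreal (marg (visible w T l) (w l)))"
  proof (rule prod.cong[OF refl])
    fix l
    have "emeasure (?M l) (?E l) = (\<Sum>j\<in>?E l. ennreal (p j))"
      by (rule emeasure_point_measure_finite) auto
    also have "\<dots> = ennreal (\<Sum>j\<in>?E l. p j)" by (rule sum_ennreal) (auto intro: less_imp_le[OF p_pos])
    finally show "emeasure (?M l) (?E l) = ennreal (marg (visible w T l) (w l))" by (simp add: marg_def)
  qed
  also have "\<dots> = ennreal (\<Prod>l<depth_bound w T. marg (visible w T l) (w l))"
    by (rule prod_ennreal) (rule less_imp_le[OF marg_pos[OF sym_spaceD[OF w]]])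
  also have "(\<Prod>l<depth_bound w T. marg (visible w T l) (w l)) = exp (- cost w T)"
  proof -
    have "exp (- cost w T) = (\<Prod>l<depth_bound w T. exp (- neg_ln_marg (visible w T l) (w l)))"
      unfolding cost_def by (simp add: exp_sum flip: sum_negf)
    also have "\<dots> = (\<Prod>l<depth_bound w T. marg (visible w T l) (w l))"
      by (rule prod.cong) (use marg_pos[OF sym_spaceD[OF w]] in \<open>auto simp: neg_ln_marg_def\<close>)
    finally show ?thesis by simp
  qed
  finally show "measure (bernoulli N p) (approx_cube w T) = exp (- cost w T)"
    by (simp add: measure_def)
  show "approx_cube w T \<in> sets (bernoulli N p)"
  proof -
    have "{v \<in> space (PiM UNIV ?M). \<forall>l\<in>{..<depth_bound w T}. v l \<in> ?E l} \<in> sets (PiM UNIV ?M)"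
      using s by measurable
    then show ?thesis unfolding approx_cube_eq_Collect[OF w] by (simp add: bernoulli_def)
  qed
qed

lemma letter_measurable: "(\<lambda>w. g (w l)) \<in> borel_measurable (bernoulli N p)" for g :: "nat \<Rightarrow> real"
proof -
  have "(\<lambda>w. w l) \<in> measurable (bernoulli N p) (point_measure {1..N} (\<lambda>i. ennreal (p i)))"
    unfolding bernoulli_def by (rule measurable_component_singleton) simp
  moreover have "g \<in> borel_measurable (point_measure {1..N} (\<lambda>i. ennreal (p i)))"
    by (simp add: measurable_point_measure_eq1)
  ultimately show ?thesis by (rule measurable_compose)
qed

lemma coding_measurable: "coding lam t \<in> borel_measurable (bernoulli N p)"
proof -
  have m: "(\<lambda>w. wcomp (ifs lam t) w k 0 $ c) \<in> borel_measurable (bernoulli N p)" for k c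
    unfolding wcomp_ifs_nth prodw_def
    by (intro borel_measurable_add borel_measurable_times borel_measurable_sum borel_measurable_prod
        borel_measurable_const letter_measurable letter_measurable[of "\<lambda>i. t i $ c"])
  have c: "(\<lambda>w. coding lam t w $ c) \<in> borel_measurable (bernoulli N p)" for c
    by (rule borel_measurable_LIMSEQ_real[OF _ m])
      (auto simp: space_bernoulli intro!: tendsto_vec_nth coding_LIMSEQ)
  show ?thesis
    unfolding borel_measurable_euclidean_space[of "coding lam t"]
  proof
    fix b :: "real^('n::{finite,linorder})" assume "b \<in> Basis"
    then obtain c where "b = axis c 1" by (auto simp: Basis_vec_def)
    then show "(\<lambda>w. coding lam t w \<bullet> b) \<in> borel_measurable (bernoulli N p)"
      using c[of c] by (simp add: inner_axis)
  qed
qed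

abbreviation nu :: "(real^('n::{finite,linorder})) measure" where
  "nu \<equiv> self_affine_measure N lam t p"

lemma measure_nu:
  assumes "A \<in> sets borel"
  shows "measure nu A = measure (bernoulli N p) {w \<in> sym_space N. coding lam t w \<in> A}"
proof -
  have "coding lam t -` A \<inter> space (bernoulli N p) = {w \<in> sym_space N. coding lam t w \<in> A}"
    by (auto simp: space_bernoulli)
  then show ?thesis
    unfolding self_affine_measure_def using measure_distr[OF coding_measurable assms] by simp
qed

lemma prob_space_nu: "prob_space nu"
proof -
  interpret prob_space "bernoulli N p" by (rule prob_space_bernoulli)
  show ?thesis unfolding self_affine_measure_def by (rule prob_space_distr) (rule coding_measurable)
qed

lemma coding_vimage_sets: "A \<in> sets borel \<Longrightarrow> {w \<in> sym_space N. coding lam t w \<in> A} \<in> sets (bernoulli N p)"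
  using measurable_sets[OF coding_measurable, of A] by (simp add: space_bernoulli vimage_def Int_def conj_commute)

lemma ball_measure_upper:
  assumes w: "w \<in> sym_space N" and T: "0 < T"
  shows "measure nu (cball (coding lam t w) (gap * exp (- T))) \<le> exp (- cost w T)"
proof -
  interpret prob_space "bernoulli N p" by (rule prob_space_bernoulli)
  have sub: "{v \<in> sym_space N. coding lam t v \<in> cball (coding lam t w) (gap * exp (- T))} \<subseteq> approx_cube w T"
  proof
    fix v assume v: "v \<in> {v \<in> sym_space N. coding lam t v \<in> cball (coding lam t w) (gap * exp (- T))}"
    show "v \<in> approx_cube w T"
    proof (rule ccontr)
      assume "v \<notin> approx_cube w T"
      then obtain c where c: "gap * exp (- T) < \<bar>coding lam t w $ c - coding lam t v $ c\<bar>"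
        using coding_separation[OF w _ T] v by blast
      have "\<bar>coding lam t w $ c - coding lam t v $ c\<bar> \<le> dist (coding lam t w) (coding lam t v)"
        using component_le_norm_cart[of "coding lam t w - coding lam t v" c] by (simp add: dist_norm)
      then show False using c v by simp
    qed
  qed
  show ?thesis
    unfolding measure_nu[OF borel_closed[OF closed_cball]] approx_cube_measure(2)[OF w, symmetric]
    by (rule finite_measure_mono[OF sub approx_cube_measure(1)[OF w]])
qed

lemma ball_measure_lower:
  assumes w: "w \<in> sym_space N"
  shows "exp (- cost w T) \<le> measure nu (cball (coding lam t w) (CARD('n) * exp (- T)))"
proof -
  interpret prob_space "bernoulli N p" by (rule prob_space_bernoulli)
  have sub: "approx_cube w T \<subseteq> {v \<in> sym_space N. coding lam t v \<in> cball (coding lam t w) (CARD('n) * exp (- T))}"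
    using approx_cube_dist[OF w] by (auto simp: approx_cube_def)
  show ?thesis
    unfolding measure_nu[OF borel_closed[OF closed_cball]] approx_cube_measure(2)[OF w, symmetric]
    by (rule finite_measure_mono[OF sub coding_vimage_sets[OF borel_closed[OF closed_cball]]])
qed

section \<open>Support and diameter of the measure\<close>

lemma exists_scale:
  assumes "0 < e"
  shows "\<exists>T0>0. \<forall>T\<ge>T0. CARD('n) * exp (- T) < e"
proof -
  define T0 where "T0 = max 1 (ln (2 * CARD('n) / e))"
  have "CARD('n) * exp (- T) < e" if "T \<ge> T0" for T
  proof -
    have "exp (- T) \<le> exp (- ln (2 * CARD('n) / e))" using that by (simp add: T0_def)
    also have "\<dots> = e / (2 * CARD('n))" using assms by (simp add: exp_minus)
    finally have "CARD('n) * exp (- T) \<le> CARD('n) * (e / (2 * CARD('n)))" by (intro mult_left_mono) auto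
    then show ?thesis using assms by simp
  qed
  then show ?thesis by (intro exI[of _ T0]) (auto simp: T0_def)
qed

lemma coding_in_msupp:
  assumes w: "w \<in> sym_space N"
  shows "coding lam t w \<in> msupp nu"
  unfolding msupp_def
proof (intro CollectI allI impI)
  interpret prob_space nu by (rule prob_space_nu)
  fix e :: real assume "0 < e"
  then obtain T where T: "CARD('n) * exp (- T) < e" using exists_scale by blast
  have "0 < measure nu (cball (coding lam t w) (CARD('n) * exp (- T)))"
    using ball_measure_lower[OF w, of T] exp_gt_zero[of "- cost w T"] by linarith
  also have "\<dots> \<le> measure nu (ball (coding lam t w) e)"
    by (rule finite_measure_mono) (use T in \<open>auto simp: self_affine_measure_def\<close>)
  finally show "0 < emeasure nu (ball (coding lam t w) e)" by (simp add: emeasure_eq_measure)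
qed

text \<open>Density of the coded points in the support is enough for the dimension estimates: moving
  a centre by less than \<open>r / 2\<close> changes the radii by bounded factors only.\<close>

lemma msupp_approx:
  assumes x: "x \<in> msupp nu" and "0 < e"
  shows "\<exists>w\<in>sym_space N. dist x (coding lam t w) < e"
proof (rule ccontr)
  interpret prob_space nu by (rule prob_space_nu)
  assume "\<not> ?thesis"
  then have "{w \<in> sym_space N. coding lam t w \<in> ball x e} = {}" by auto
  then have "measure nu (ball x e) = measure (bernoulli N p) {}"
    using measure_nu[OF borel_open[OF open_ball], of x e] by (simp only:)
  then have "measure nu (ball x e) = 0" by simp
  then show False using assms by (auto simp: msupp_def emeasure_eq_measure)
qed

lemma dist_msupp_le:
  assumes "x \<in> msupp nu" "y \<in> msupp nu"
  shows "dist x y \<le> CARD('n)"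
proof (rule field_le_epsilon)
  fix e :: real assume "0 < e"
  obtain w where w: "w \<in> sym_space N" "dist x (coding lam t w) < e / 2"
    using msupp_approx[OF assms(1), of "e / 2"] \<open>0 < e\<close> by auto
  obtain v where v: "v \<in> sym_space N" "dist y (coding lam t v) < e / 2"
    using msupp_approx[OF assms(2), of "e / 2"] \<open>0 < e\<close> by auto
  have "\<bar>(coding lam t w - coding lam t v) $ c\<bar> \<le> 1" for c
    using coding_in_cube[OF w(1), of c] coding_in_cube[OF v(1), of c] by (simp add: abs_le_iff)
  then have "(\<Sum>c\<in>UNIV. \<bar>(coding lam t w - coding lam t v) $ c\<bar>) \<le> (\<Sum>c\<in>(UNIV::'n set). 1)"
    by (intro sum_mono) simp
  then have "dist (coding lam t w) (coding lam t v) \<le> CARD('n)"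
    using norm_le_l1_cart[of "coding lam t w - coding lam t v"] by (simp add: dist_norm)
  then show "dist x y \<le> CARD('n) + e"
    using w v dist_triangle[of x y "coding lam t w"] dist_triangle[of "coding lam t w" y "coding lam t v"]
    by (simp add: dist_commute)
qed

lemma diameter_msupp_le: "diameter (msupp nu) \<le> CARD('n)"
  by (rule diameter_le) (use dist_msupp_le in \<open>auto simp: dist_norm\<close>)

text \<open>Two distinct maps do not overlap on the whole space, so the points coded by their
  constant words differ. Hence diameter 0 forces \<open>N = 1\<close>.\<close>

lemma diameter_msupp_pos:
  assumes "2 \<le> N"
  shows "0 < diameter (msupp nu)"
proof -
  obtain \<sigma> where \<sigma>: "\<sigma> \<in> permsA N lam" using permsA_nonempty by blast
  let ?w = "\<lambda>_::nat. 1::nat" and ?v = "\<lambda>_::nat. 2::nat"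
  have wv: "?w \<in> sym_space N" "?v \<in> sym_space N" using assms by (auto simp: sym_space_def)
  have "set (take CARD('n) \<sigma>) = UNIV" using \<sigma> permsA_sub permutation_of_UNIV[of \<sigma>] by auto
  moreover have "\<not> eqv UNIV 1 2" using eqv_UNIV[of 1 2] assms by auto
  ultimately have "\<not> eqv (set (take CARD('n) \<sigma>)) 1 2" by simp
  then obtain c where "t 2 $ c + lam 2 c < t 1 $ c \<or> t 1 $ c + lam 1 c < t 2 $ c"
    using SPPC_gap[OF \<sigma>, of "CARD('n)" 1 2] assms by auto
  then have "coding lam t ?w $ c \<noteq> coding lam t ?v $ c"
    using coding_first_letter[OF wv(1), of c] coding_first_letter[OF wv(2), of c] by auto
  then have "0 < dist (coding lam t ?w) (coding lam t ?v)" by auto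
  moreover have "bounded (msupp nu)"
    unfolding bounded_two_points using dist_msupp_le by blast
  ultimately show ?thesis
    using diameter_bounded_bound[of "msupp nu" "coding lam t ?w" "coding lam t ?v"]
      coding_in_msupp[OF wv(1)] coding_in_msupp[OF wv(2)] by linarith
qed

end

subsection \<open>Bounds over all cube orders\<close>

lemma ln_4: "ln (4::real) = 2 * ln 2"
  using ln_realpow[of 2 2] by simp

context sponge
begin

lemma measure_nu_mono: "A \<subseteq> B \<Longrightarrow> B \<in> sets borel \<Longrightarrow> measure nu A \<le> measure nu B"
proof -
  interpret prob_space nu by (rule prob_space_nu)
  show "A \<subseteq> B \<Longrightarrow> B \<in> sets borel \<Longrightarrow> measure nu A \<le> measure nu B"
    by (rule finite_measure_mono) (auto simp: self_affine_measure_def)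
qed

lemma msupp_cball_pos:
  assumes "x \<in> msupp nu" "0 < r"
  shows "0 < measure nu (cball x r)"
proof -
  interpret prob_space nu by (rule prob_space_nu)
  have "0 < measure nu (ball x r)" using assms by (simp add: msupp_def emeasure_eq_measure)
  also have "\<dots> \<le> measure nu (cball x r)" by (rule measure_nu_mono) auto
  finally show ?thesis .
qed

lemma assouad_dim_upper:
  "assouad_dim_measure nu \<le> ereal (Max (sum_max_ratio ` permsA N lam))"
proof -
  interpret prob_space nu by (rule prob_space_nu)
  define s where "s = Max (sum_max_ratio ` permsA N lam)"
  have s0: "0 \<le> s" unfolding s_def by (rule Max_sum_max_ratio_nonneg)
  define d where "d = real CARD('n)"
  have d: "d \<ge> 1" unfolding d_def by (simp add: Suc_le_eq)
  obtain C0 where C0: "0 \<le> C0" "\<And>w T T'. w \<in> sym_space N \<Longrightarrow> 0 < T \<Longrightarrow> T \<le> T' \<Longrightarrow>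
      cost w T' - cost w T \<le> s * (T' - T) + C0"
    using cost_diff_upper unfolding s_def by blast
  \<comment> \<open>For large \<open>R\<close> the scale matching the outer ball need not be
    positive; it is then replaced by \<open>ln 2\<close>, and \<open>C1\<close> bounds the cost lost
    there.\<close>
  define C1 where "C1 = neg_ln_marg_max * CARD('n) * ((ln 2 + nlog_max) / nlog_min)"
  have C1: "cost w (ln 2) \<le> C1" if "w \<in> sym_space N" for w
    using cost_diff_crude[OF that, of "ln 2" 0] cost_0[OF that] unfolding C1_def by simp
  have C1_nonneg: "0 \<le> C1" using C1[OF sym_space_nonempty] cost_nonneg[OF sym_space_nonempty, of "ln 2"] by simp
  define C where "C = exp (C1 + C0 + s * ln (4 * d / gap))"
  have "measure nu (cball x R) / measure nu (cball x r) \<le> C * (R / r) powr s"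
    if x: "x \<in> msupp nu" and rR: "0 < r" "r < R" "R < diameter (msupp nu)" for x r R
  proof -
    obtain w where w: "w \<in> sym_space N" and y: "dist x (coding lam t w) < r / 2"
      using msupp_approx[OF x, of "r / 2"] rR by auto
    let ?y = "coding lam t w"
    have Rd: "R < d" using rR diameter_msupp_le unfolding d_def by simp
    \<comment> \<open>The scales are matched to the radii of the ball estimates: \<open>T'\<close>
      to a lower bound at radius \<open>r / 2\<close>, and \<open>T1\<close> below to an upper bound
      at radius \<open>2 * R\<close>.\<close>
    define T' where "T' = - ln (r / (2 * d))"
    have eT': "d * exp (- T') = r / 2" unfolding T'_def using rR d by simp
    have "r / (2 * d) \<le> 1 / 2" using rR Rd d by (simp add: divide_le_eq)
    then have "ln (r / (2 * d)) \<le> ln (1 / 2)" using rR d by (intro ln_mono) auto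
    then have T'2: "ln 2 \<le> T'" unfolding T'_def by (simp add: ln_div)
    have "exp (- cost w T') \<le> measure nu (cball ?y (r / 2))"
      using ball_measure_lower[OF w, of T'] eT' unfolding d_def by simp
    also have "\<dots> \<le> measure nu (cball x r)"
      by (rule measure_nu_mono) (use y in \<open>auto simp: cball_subset_cball_iff dist_commute\<close>)
    finally have den: "exp (- cost w T') \<le> measure nu (cball x r)" .
    define T1 where "T1 = - ln (2 * R / gap)"
    \<comment> \<open>The truncation keeps \<open>T\<close> positive and does not push it beyond
      \<open>T'\<close>, since \<open>R < d\<close> gives \<open>ln 2 \<le> T'\<close>.\<close>
    define T where "T = max (ln 2) T1"
    have eT1: "gap * exp (- T1) = 2 * R" unfolding T1_def using rR gap_pos by simp
    have "measure nu (cball x R) \<le> measure nu (cball ?y (2 * R))"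
      by (rule measure_nu_mono) (use y rR in \<open>auto simp: cball_subset_cball_iff\<close>)
    also have "\<dots> \<le> exp (C1 - cost w T)"
    proof (cases "ln 2 \<le> T1")
      case True
      then have "T = T1" "0 < T1" unfolding T_def using less_le_trans[of 0 "ln 2::real"] by auto
      then have "measure nu (cball ?y (2 * R)) \<le> exp (- cost w T)"
        using ball_measure_upper[OF w, of T1] eT1 by simp
      also have "\<dots> \<le> exp (C1 - cost w T)" using C1_nonneg by simp
      finally show ?thesis .
    next
      case False
      then have "T = ln 2" unfolding T_def by simp
      then have "1 \<le> exp (C1 - cost w T)" using C1[OF w] by simp
      then show ?thesis using prob_le_1[of "cball ?y (2 * R)"] by linarith
    qed
    finally have num: "measure nu (cball x R) \<le> exp (C1 - cost w T)" .
    have "r / (2 * d) \<le> 2 * R / gap"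
    proof -
      have "r * gap \<le> 2 * R * (2 * d)"
        using mult_mono[of r "2 * R" gap "2 * d"] rR gap_le_1 gap_pos d by simp
      then show ?thesis using d gap_pos by (simp add: divide_le_eq le_divide_eq mult.commute)
    qed
    then have "ln (r / (2 * d)) \<le> ln (2 * R / gap)" using rR d by (intro ln_mono) auto
    then have TT': "T \<le> T'" unfolding T_def T1_def using T'2 unfolding T'_def by simp
    have T0: "0 < T" unfolding T_def using less_le_trans[of 0 "ln 2::real"] by auto
    have "T' - T \<le> T' - T1" unfolding T_def by simp
    also have "\<dots> = ln (R / r) + ln (4 * d / gap)"
      unfolding T'_def T1_def using rR d gap_pos by (simp add: ln_div ln_mult ln_4)
    finally have TT: "T' - T \<le> ln (R / r) + ln (4 * d / gap)" .
    have "measure nu (cball x R) / measure nu (cball x r) \<le> exp (C1 - cost w T) / exp (- cost w T')"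
      using num den by (intro frac_le) (auto simp: measure_nonneg)
    also have "\<dots> = exp (C1 + (cost w T' - cost w T))" by (simp flip: exp_diff)
    also have "\<dots> \<le> exp (C1 + (s * (T' - T) + C0))" using C0(2)[OF w T0 TT'] by simp
    also have "\<dots> \<le> exp (C1 + (s * (ln (R / r) + ln (4 * d / gap)) + C0))"
      using mult_left_mono[OF TT s0] by simp
    also have "\<dots> = C * (R / r) powr s"
      unfolding C_def powr_def using rR by (simp add: algebra_simps flip: exp_add)
    finally show ?thesis .
  qed
  moreover have "C > 0" unfolding C_def by simp
  ultimately have "ereal s \<in> {ereal s | s. s \<ge> 0 \<and> (\<exists>C>0. \<forall>x\<in>msupp nu. \<forall>r R.
      0 < r \<and> r < R \<and> R < diameter (msupp nu) \<longrightarrow>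
      measure nu (cball x R) / measure nu (cball x r) \<le> C * (R / r) powr s)}"
    using s0 by (intro CollectI exI[of _ s]) blast
  then show ?thesis unfolding assouad_dim_measure_def s_def by (rule Inf_lower)
qed

text \<open>The only letter has weight 1 in every set of coordinates, so all \<open>psi\<close>
  vanish.\<close>

lemma single_map_sum_max_ratio_sum_min_ratio:
  assumes "N = 1"
  shows "sum_max_ratio \<sigma> = 0" "sum_min_ratio \<sigma> = 0"
proof -
  have N: "{1..N} = {1}" using assms by simp
  have "p 1 = 1" using p_sum unfolding N by simp
  moreover have "{j \<in> {1..N}. eqv S 1 j} = {1}" for S unfolding N by auto
  ultimately have "marg S 1 = 1" for S unfolding marg_def by simp
  then have psi: "psi \<sigma> n 1 = 0" for n by (simp add: psi_def neg_ln_marg_def)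
  show "sum_max_ratio \<sigma> = 0" "sum_min_ratio \<sigma> = 0" unfolding sum_max_ratio_def sum_min_ratio_def max_ratio_def min_ratio_def N using psi by simp_all
qed

lemma lower_dim_lower:
  "ereal (Min (sum_min_ratio ` permsA N lam)) \<le> lower_dim_measure nu"
proof (cases "diameter (msupp nu) = 0")
  case True
  then have "N = 1" using diameter_msupp_pos N_pos by (cases "N \<ge> 2") auto
  then have "sum_min_ratio ` permsA N lam = {0}" using single_map_sum_max_ratio_sum_min_ratio(2) permsA_nonempty by auto
  then show ?thesis using True by (simp add: lower_dim_measure_def)
next
  case False
  interpret prob_space nu by (rule prob_space_nu)
  define s where "s = Min (sum_min_ratio ` permsA N lam)"
  have s0: "0 \<le> s" unfolding s_def by (rule Min_sum_min_ratio_nonneg)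
  define d where "d = real CARD('n)"
  have d: "d \<ge> 1" unfolding d_def by (simp add: Suc_le_eq)
  obtain C0 where C0: "0 \<le> C0" "\<And>w T T'. w \<in> sym_space N \<Longrightarrow> 0 < T \<Longrightarrow> T \<le> T' \<Longrightarrow>
      s * (T' - T) - C0 \<le> cost w T' - cost w T"
    using cost_diff_lower unfolding s_def by blast
  define C where "C = exp (- C0 - s * ln (4 * d / gap))"
  have "C * (R / r) powr s \<le> measure nu (cball x R) / measure nu (cball x r)"
    if x: "x \<in> msupp nu" and rR: "0 < r" "r < R" "R < diameter (msupp nu)" for x r R
  proof -
    obtain w where w: "w \<in> sym_space N" and y: "dist x (coding lam t w) < r / 2"
      using msupp_approx[OF x, of "r / 2"] rR by auto
    let ?y = "coding lam t w"
    have Rd: "R < d" using rR diameter_msupp_le unfolding d_def by simp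
    \<comment> \<open>Compared with the Assouad bound the estimates change places: the outer ball
      needs the lower bound, the inner ball the upper one.\<close>
    define T where "T = - ln (R / (2 * d))"
    define T' where "T' = - ln (2 * r / gap)"
    have TT: "T' - T = ln (R / r) - ln (4 * d / gap)"
      unfolding T'_def T_def using rR d gap_pos by (simp add: ln_div ln_mult ln_4)
    have eT: "d * exp (- T) = R / 2" unfolding T_def using rR d by simp
    have eT': "gap * exp (- T') = 2 * r" unfolding T'_def using rR gap_pos by simp
    have T0: "0 < T" unfolding T_def using rR Rd d by (simp add: ln_less_zero divide_less_eq)
    have CC: "C * (R / r) powr s = exp (s * (T' - T) - C0)"
      unfolding C_def powr_def TT using rR by (simp add: algebra_simps flip: exp_add)
    have pos: "0 < measure nu (cball x r)" by (rule msupp_cball_pos[OF x rR(1)])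
    show ?thesis
    proof (cases "T \<le> T'")
      case True
      have "exp (- cost w T) \<le> measure nu (cball ?y (R / 2))"
        using ball_measure_lower[OF w, of T] eT unfolding d_def by simp
      also have "\<dots> \<le> measure nu (cball x R)"
        by (rule measure_nu_mono) (use y rR in \<open>auto simp: cball_subset_cball_iff dist_commute\<close>)
      finally have num: "exp (- cost w T) \<le> measure nu (cball x R)" .
      have "measure nu (cball x r) \<le> measure nu (cball ?y (2 * r))"
        by (rule measure_nu_mono) (use y rR in \<open>auto simp: cball_subset_cball_iff\<close>)
      also have "\<dots> \<le> exp (- cost w T')"
        using ball_measure_upper[OF w, of T'] eT' True T0 by simp
      finally have den: "measure nu (cball x r) \<le> exp (- cost w T')" .
      have "exp (s * (T' - T) - C0) \<le> exp (cost w T' - cost w T)"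
        using C0(2)[OF w T0 True] by simp
      also have "\<dots> = exp (- cost w T) / exp (- cost w T')" by (simp flip: exp_diff)
      also have "\<dots> \<le> measure nu (cball x R) / measure nu (cball x r)"
        using num den pos by (intro frac_le) auto
      finally show ?thesis unfolding CC .
    next
      case False
      \<comment> \<open>Here the radii differ by less than the constant factor
        \<open>4 * d / gap\<close>, and monotonicity of the measure suffices.\<close>
      then have "s * (T' - T) \<le> 0" using s0 by (simp add: mult_nonneg_nonpos)
      then have "C * (R / r) powr s \<le> 1" unfolding CC using C0(1) by simp
      also have "1 \<le> measure nu (cball x R) / measure nu (cball x r)"
        using pos measure_nu_mono[of "cball x r" "cball x R"] rR by (simp add: le_divide_eq subset_cball)
      finally show ?thesis .
    qed
  qed
  moreover have "C > 0" unfolding C_def by simp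
  ultimately have "ereal s \<in> {ereal s | s. s \<ge> 0 \<and> (\<exists>C>0. \<forall>x\<in>msupp nu. \<forall>r R.
      0 < r \<and> r < R \<and> R < diameter (msupp nu) \<longrightarrow>
      measure nu (cball x R) / measure nu (cball x r) \<ge> C * (R / r) powr s)}"
    using s0 by (intro CollectI exI[of _ s]) blast
  then show ?thesis using False unfolding lower_dim_measure_def s_def by (simp only: if_False) (rule Sup_upper)
qed

subsection \<open>Words realising a strict order\<close>

definition nlog_list :: "nat list \<Rightarrow> 'n \<Rightarrow> real" where
  "nlog_list v c = (\<Sum>i\<leftarrow>v. nlog i c)"

lemma nlog_list_append [simp]: "nlog_list (u @ v) c = nlog_list u c + nlog_list v c" by (simp add: nlog_list_def)
lemma nlog_list_Nil [simp]: "nlog_list [] c = 0" by (simp add: nlog_list_def)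
lemma nlog_list_replicate [simp]: "nlog_list (replicate k i) c = k * nlog i c" by (simp add: nlog_list_def sum_list_replicate)
lemma nlog_list_concat_replicate [simp]: "nlog_list (concat (replicate k u)) c = k * nlog_list u c"
  by (induction k) (simp_all add: algebra_simps)

lemma nlog_list_pos: "set u \<subseteq> {1..N} \<Longrightarrow> u \<noteq> [] \<Longrightarrow> 0 < nlog_list u c"
proof (induction u)
  case (Cons a u)
  then show ?case using nlog_pos[of a c] by (cases "u = []") (auto simp: nlog_list_def intro: add_pos_pos)
qed simp

lemma nlog_list_le: "set u \<subseteq> {1..N} \<Longrightarrow> nlog_list u c \<le> length u * nlog_max"
proof (induction u)
  case (Cons a u)
  then show ?case using nlog_le_nlog_max[of a c] by (auto simp: nlog_list_def algebra_simps)
qed simp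

text \<open>The padding letter 1 only makes the word infinite; the stopping estimates hold for any
  continuation.\<close>

definition extend :: "nat list \<Rightarrow> nat \<Rightarrow> nat" where
  "extend v l = (if l < length v then v ! l else 1)"

lemma extend_sym_space: "set v \<subseteq> {1..N} \<Longrightarrow> extend v \<in> sym_space N"
  using N_pos by (auto simp: extend_def sym_space_def dest: nth_mem)

lemma nlog_sum_extend: "l \<le> length v \<Longrightarrow> nlog_sum (extend v) c l = nlog_list (take l v) c"
proof (induction l)
  case (Suc l)
  then show ?case by (simp add: nlog_sum_Suc take_Suc_conv_app_nth) (simp add: extend_def nlog_list_def)
qed simp

lemma le_stop: "w \<in> sym_space N \<Longrightarrow> nlog_sum w c b \<le> T \<Longrightarrow> b \<le> stop w T c"
  using nlog_sum_stop_ge[of w T c] nlog_sum_less[of w "stop w T c" b c] by (meson not_le order_trans less_le_trans less_irrefl)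

lemma stop_le_add:
  assumes "w \<in> sym_space N" "T \<le> nlog_sum w c b + C * nlog_min"
  shows "stop w T c \<le> b + C"
  using nlog_sum_diff_ge[OF assms(1), of b "b + C" c] assms(2) by (simp add: stop_le_iff[OF assms(1)])

text \<open>The word consists of copies of \<open>u\<close>, interrupted by a run of \<open>io j\<close> of length about
  \<open>D / nlog (io j) (cc j)\<close> at the moment when the \<open>cc j\<close>-product reaches scale \<open>exp (-T)\<close>. As the
  \<open>cc j\<close>-product of \<open>u\<close> increases with \<open>j\<close>, these moments drift apart when \<open>T\<close> grows.\<close>
lemma exists_word_with_runs:
  fixes cc :: "nat \<Rightarrow> 'n" and io :: "nat \<Rightarrow> nat" and d :: nat
  assumes u: "set u \<subseteq> {1..N}" "u \<noteq> []"
    and io: "\<And>j. io j \<in> {1..N}"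
    and dec: "\<And>j. Suc j < d \<Longrightarrow> nlog_list u (cc (Suc j)) < nlog_list u (cc j)"
    and D: "0 < D"
    and C_def: "C = nat \<lceil>(length u * nlog_max + nlog_max) / nlog_min\<rceil>"
    and \<kappa>_def: "\<kappa> = (\<lambda>j. nat \<lceil>D / nlog (io j) (cc j)\<rceil>)"
  shows "\<exists>w\<in>sym_space N. \<exists>T>T0. \<exists>b.
     (\<forall>j<d. b j \<le> stop w T (cc j) \<and> stop w T (cc j) \<le> b j + C \<and>
        b j + \<kappa> j \<le> stop w (T + D + nlog_max) (cc j) \<and> stop w (T + D + nlog_max) (cc j) \<le> b j + \<kappa> j + C \<and>
        (\<forall>l\<in>{b j..<b j + \<kappa> j}. w l = io j)) \<and>
     (\<forall>i j. i < j \<longrightarrow> j < d \<longrightarrow> b i + \<kappa> i + C < b j)"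
proof -
  define Au where "Au j = nlog_list u (cc j)" for j
  have Au: "0 < Au j" "Au j \<le> length u * nlog_max" for j unfolding Au_def using nlog_list_pos[OF u] nlog_list_le[OF u(1)] by auto
  \<comment> \<open>\<open>C\<close> letters make up for a copy of \<open>u\<close> that no longer
    fits and for one letter of overshoot.\<close>
  have C: "length u * nlog_max + nlog_max \<le> C * nlog_min"
  proof -
    have "(length u * nlog_max + nlog_max) / nlog_min \<le> C" unfolding C_def by linarith
    then show ?thesis using nlog_min_pos by (simp add: divide_le_eq)
  qed
  have \<kappa>: "D \<le> \<kappa> j * nlog (io j) (cc j)" "\<kappa> j * nlog (io j) (cc j) \<le> D + nlog_max" for j
  proof -
    have x: "0 < nlog (io j) (cc j)" "nlog (io j) (cc j) \<le> nlog_max" using nlog_pos nlog_le_nlog_max io by auto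
    have "0 < D / nlog (io j) (cc j)" using D x by simp
    then have k: "D / nlog (io j) (cc j) \<le> \<kappa> j" "\<kappa> j \<le> D / nlog (io j) (cc j) + 1"
      unfolding \<kappa>_def by linarith+
    show "D \<le> \<kappa> j * nlog (io j) (cc j)" using k(1) x by (simp add: divide_le_eq)
    have "\<kappa> j * nlog (io j) (cc j) \<le> (D / nlog (io j) (cc j) + 1) * nlog (io j) (cc j)"
      using k(2) x by (intro mult_right_mono) auto
    then show "\<kappa> j * nlog (io j) (cc j) \<le> D + nlog_max" using x by (simp add: distrib_right)
  qed
  \<comment> \<open>\<open>rst\<close> is the contribution of the earlier runs to coordinate
    \<open>c\<close>; \<open>cnt T j\<close> below is the number of copies of \<open>u\<close> that
    still fit before coordinate \<open>cc j\<close> passes \<open>T\<close>.\<close>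
  define rst where "rst j c = (\<Sum>i<j. \<kappa> i * nlog (io i) c)" for j c
  have rst_nonneg: "0 \<le> rst j c" for j c
    unfolding rst_def using less_imp_le[OF nlog_pos[OF io]] by (intro sum_nonneg mult_nonneg_nonneg) auto
  define cnt where "cnt T j = nat \<lfloor>(T - rst j (cc j)) / Au j\<rfloor>" for T j
  \<comment> \<open>\<open>cnt T j\<close> grows like \<open>T / Au j\<close> and \<open>Au\<close>
    decreases in \<open>j\<close>, so the differences of consecutive counts tend to infinity;
    \<open>C + 1\<close> more copies suffice to separate the runs.\<close>
  have "\<forall>\<^sub>F T in at_top. T > T0 \<and> (\<forall>j\<in>{..<d}. rst j (cc j) \<le> T \<and> (Suc j < d \<longrightarrow> cnt T j + C + 1 \<le> cnt T (Suc j)))"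
  proof (intro eventually_conj eventually_gt_at_top eventually_ball_finite ballI)
    fix j
    show "\<forall>\<^sub>F T in at_top. rst j (cc j) \<le> T" by (rule eventually_ge_at_top)
    show "\<forall>\<^sub>F T in at_top. Suc j < d \<longrightarrow> cnt T j + C + 1 \<le> cnt T (Suc j)"
    proof (cases "Suc j < d")
      case True
      let ?A = "Au j" and ?A' = "Au (Suc j)" and ?a = "rst j (cc j)" and ?a' = "rst (Suc j) (cc (Suc j))"
      have AA: "?A' < ?A" using dec[OF True] unfolding Au_def .
      then have inv: "0 < 1 / ?A' - 1 / ?A" using Au by (simp add: frac_less2)
      have "cnt T j + C + 1 \<le> cnt T (Suc j)"
        if T: "T \<ge> max 0 ((C + 2 + ?a' / ?A') / (1 / ?A' - 1 / ?A))" for T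
      proof -
        have "C + 2 + ?a' / ?A' \<le> T * (1 / ?A' - 1 / ?A)" using T inv by (simp add: divide_le_eq)
        then have 1: "T / ?A + C + 2 \<le> (T - ?a') / ?A'" by (simp add: algebra_simps diff_divide_distrib)
        have "(T - ?a) / ?A \<le> T / ?A" using rst_nonneg[of j "cc j"] Au[of j] by (simp add: divide_right_mono)
        moreover have "0 \<le> T / ?A" using T Au[of j] by simp
        ultimately have "real (cnt T j) \<le> T / ?A" unfolding cnt_def by linarith
        moreover have "(T - ?a') / ?A' - 1 \<le> real (cnt T (Suc j))" unfolding cnt_def by linarith
        ultimately have "real (cnt T j) + C + 1 \<le> real (cnt T (Suc j))" using 1 by linarith
        then show ?thesis by linarith
      qed
      then show ?thesis unfolding eventually_at_top_linorder by blast
    qed simp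
  qed simp
  then obtain T where T: "T > T0" "\<And>j. j < d \<Longrightarrow> rst j (cc j) \<le> T"
      "\<And>j. Suc j < d \<Longrightarrow> cnt T j + C + 1 \<le> cnt T (Suc j)"
    using eventually_happens'[OF trivial_limit_at_top_linorder] by fastforce
  \<comment> \<open>The index is shifted by one: \<open>q j\<close> copies of \<open>u\<close>
    precede block \<open>j\<close>, and its run begins after \<open>q (Suc j)\<close>
    copies.\<close>
  define q where "q j = (case j of 0 \<Rightarrow> 0 | Suc i \<Rightarrow> cnt T i)" for j
  have q_mono: "q j \<le> q (Suc j)" if "j < d" for j
    using T(3)[of "j - 1"] that by (cases j) (auto simp: q_def)
  define blk where "blk j = concat (replicate (q (Suc j) - q j) u) @ replicate (\<kappa> j) (io j)" for j
  define pre where "pre j = concat (map blk [0..<j])" for j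
  have pre_Suc: "pre (Suc j) = pre j @ blk j" for j by (simp add: pre_def)
  have pre_set: "set (pre j) \<subseteq> {1..N}" for j
    unfolding pre_def blk_def using u io by auto
  have X_pre: "nlog_list (pre j) c = q j * nlog_list u c + rst j c" if "j \<le> d" for j c
    using that
  proof (induction j)
    case 0 then show ?case by (simp add: pre_def q_def rst_def)
  next
    case (Suc j)
    then have "real (q (Suc j) - q j) = real (q (Suc j)) - real (q j)" using q_mono[of j] by simp
    then show ?case using Suc by (simp add: pre_Suc blk_def rst_def algebra_simps)
  qed
  define b where "b j = length (pre j) + (q (Suc j) - q j) * length u" for j
  have len_cr: "length (concat (replicate k u)) = k * length u" for k
    by (induction k) auto
  have len_Suc: "length (pre (Suc j)) = b j + \<kappa> j" for j
    by (simp add: pre_Suc blk_def b_def len_cr)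
  define w where "w = extend (pre d)"
  have w: "w \<in> sym_space N" unfolding w_def by (rule extend_sym_space[OF pre_set])
  have split: "pre d = pre (Suc j) @ concat (map blk [Suc j..<d])" if "j < d" for j
  proof -
    have "[0..<d] = [0..<Suc j] @ [Suc j..<d]" using that by (metis Suc_leI le_add_diff_inverse upt_add_eq_append zero_le)
    then show ?thesis unfolding pre_def by (simp del: upt_Suc)
  qed
  have le_len: "b j + \<kappa> j \<le> length (pre d)" if "j < d" for j
    unfolding split[OF that] using len_Suc[of j] by simp
  have take_b: "take (b j) (pre d) = pre j @ concat (replicate (q (Suc j) - q j) u)" if "j < d" for j
    unfolding split[OF that] pre_Suc blk_def b_def by (simp add: len_cr)
  have take_e: "take (b j + \<kappa> j) (pre d) = pre (Suc j)" if "j < d" for j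
    unfolding split[OF that] using len_Suc[of j] by simp
  \<comment> \<open>The floor in \<open>cnt\<close> leaves room for at most one more copy of
    \<open>u\<close>, so the run begins within \<open>Au j\<close> of \<open>T\<close>.\<close>
  have Xb: "T - Au j \<le> nlog_sum w (cc j) (b j)" "nlog_sum w (cc j) (b j) \<le> T" if "j < d" for j
  proof -
    have "nlog_sum w (cc j) (b j) = nlog_list (take (b j) (pre d)) (cc j)"
      unfolding w_def by (rule nlog_sum_extend) (use le_len[OF that] in simp)
    also have "\<dots> = q j * Au j + rst j (cc j) + (q (Suc j) - q j) * Au j"
      unfolding take_b[OF that] using X_pre[of j] that by (simp add: Au_def)
    also have "\<dots> = q (Suc j) * Au j + rst j (cc j)"
      using q_mono[OF that] by (simp add: algebra_simps)
    finally have eq: "nlog_sum w (cc j) (b j) = q (Suc j) * Au j + rst j (cc j)" .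
    have nn: "0 \<le> (T - rst j (cc j)) / Au j" using T(2)[OF that] Au[of j] by simp
    have "q (Suc j) = nat \<lfloor>(T - rst j (cc j)) / Au j\<rfloor>" by (simp add: q_def cnt_def)
    then have "real (q (Suc j)) \<le> (T - rst j (cc j)) / Au j" "(T - rst j (cc j)) / Au j \<le> real (q (Suc j)) + 1"
      using nn by linarith+
    then have "q (Suc j) * Au j \<le> T - rst j (cc j)" "T - rst j (cc j) \<le> (real (q (Suc j)) + 1) * Au j"
      using Au[of j] by (simp_all add: le_divide_eq divide_le_eq)
    then show "T - Au j \<le> nlog_sum w (cc j) (b j)" "nlog_sum w (cc j) (b j) \<le> T"
      unfolding eq by (simp_all add: distrib_right)
  qed
  have Xe: "nlog_sum w (cc j) (b j + \<kappa> j) = nlog_sum w (cc j) (b j) + \<kappa> j * nlog (io j) (cc j)" if "j < d" for j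
  proof -
    have "nlog_sum w (cc j) (b j + \<kappa> j) = nlog_list (pre (Suc j)) (cc j)"
      unfolding w_def take_e[OF that, symmetric] by (rule nlog_sum_extend) (use le_len[OF that] in simp)
    moreover have "nlog_sum w (cc j) (b j) = nlog_list (take (b j) (pre d)) (cc j)"
      unfolding w_def by (rule nlog_sum_extend) (use le_len[OF that] in simp)
    ultimately show ?thesis unfolding take_b[OF that] pre_Suc blk_def by simp
  qed
  have letters: "w l = io j" if "j < d" "l \<in> {b j..<b j + \<kappa> j}" for j l
  proof -
    have l: "l < length (pre d)" using le_len[OF that(1)] that(2) by simp
    have "w l = pre (Suc j) ! l"
      unfolding w_def extend_def using l that split[OF that(1)] len_Suc[of j] by (simp add: nth_append)
    also have "pre (Suc j) = (pre j @ concat (replicate (q (Suc j) - q j) u)) @ replicate (\<kappa> j) (io j)"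
      by (simp add: pre_Suc blk_def)
    also have "\<dots> ! l = io j"
      using that(2) by (subst nth_append) (auto simp: b_def len_cr)
    finally show ?thesis .
  qed
  have step: "b j + \<kappa> j + C < b (Suc j)" if "Suc j < d" for j
  proof -
    have "C + 1 \<le> q (Suc (Suc j)) - q (Suc j)" using T(3)[OF that] by (simp add: q_def)
    moreover have "1 \<le> length u" using u(2) by (cases u) auto
    ultimately have "C + 1 \<le> (q (Suc (Suc j)) - q (Suc j)) * length u"
      using mult_le_mono[of "C + 1" "q (Suc (Suc j)) - q (Suc j)" 1 "length u"] by simp
    then show ?thesis using len_Suc[of j] by (simp add: b_def)
  qed
  have sep: "b i + \<kappa> i + C < b j" if "i < j" "j < d" for i j
    using that
  proof (induction j)
    case (Suc j)
    show ?case
    proof (cases "i = j")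
      case True then show ?thesis using step Suc by simp
    next
      case False
      then have "b i + \<kappa> i + C < b j" using Suc by simp
      then show ?thesis using step[of j] Suc.prems by simp
    qed
  qed simp
  have main: "b j \<le> stop w T (cc j) \<and> stop w T (cc j) \<le> b j + C \<and>
        b j + \<kappa> j \<le> stop w (T + D + nlog_max) (cc j) \<and> stop w (T + D + nlog_max) (cc j) \<le> b j + \<kappa> j + C"
    if j: "j < d" for j
  proof (intro conjI)
    show "b j \<le> stop w T (cc j)" by (rule le_stop[OF w Xb(2)[OF j]])
    show "stop w T (cc j) \<le> b j + C"
      by (rule stop_le_add[OF w]) (use Xb(1)[OF j] Au[of j] C nlog_max_pos in linarith)
    \<comment> \<open>Rounded up to whole letters, a run exceeds \<open>D\<close> by at most
      \<open>nlog_max\<close>; this is why the second scale is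
      \<open>T + D + nlog_max\<close>.\<close>
    show "b j + \<kappa> j \<le> stop w (T + D + nlog_max) (cc j)"
      by (rule le_stop[OF w]) (use Xe[OF j] Xb(2)[OF j] \<kappa>[of j] in linarith)
    show "stop w (T + D + nlog_max) (cc j) \<le> b j + \<kappa> j + C"
      by (rule stop_le_add[OF w]) (use Xe[OF j] Xb(1)[OF j] \<kappa>[of j] Au[of j] C in linarith)
  qed
  show ?thesis
    using w T(1) main letters sep by (intro bexI[of _ w] exI[of _ T] exI[of _ b] conjI) blast+
qed

text \<open>The word of the cylinder is cut at its stop: strictly decreasing products are strictly
  increasing sums, and a finite word can be repeated.\<close>

lemma permsB_exists_word:
  assumes "\<sigma> \<in> permsB N lam"
  shows "\<exists>u. set u \<subseteq> {1..N} \<and> u \<noteq> [] \<and> (\<forall>n. Suc n < CARD('n) \<longrightarrow> nlog_list u (\<sigma> ! n) < nlog_list u (\<sigma> ! Suc n))"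
proof -
  obtain w r where w: "w \<in> sym_space N" and r: "0 < r" "r < 1" and sc: "strict_cylinder lam w r \<sigma>"
    using assms by (auto simp: permsB_def)
  define L where "L = Lstop lam w r (\<sigma> ! (CARD('n) - 1))"
  \<comment> \<open>This needs \<open>r < 1\<close>; otherwise the stop could be 0 and the word
    empty.\<close>
  have "0 < L"
    using less_stop_iff[OF w, of 0 "- ln r" "\<sigma> ! (CARD('n) - 1)"] r unfolding L_def
    by (simp add: ln_less_zero)
  define u where "u = map w [0..<L]"
  have Xu: "nlog_list u c = nlog_sum w c L" for c
    by (simp add: u_def nlog_list_def nlog_sum_def comp_def interv_sum_list_conv_sum_set_nat lessThan_atLeast0)
  have "nlog_list u (\<sigma> ! n) < nlog_list u (\<sigma> ! Suc n)" if "Suc n < CARD('n)" for n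
  proof -
    have "prodw lam w (\<sigma> ! Suc n) L < prodw lam w (\<sigma> ! n) L"
      using sc that by (auto simp: strict_cylinder_def Let_def L_def)
    then show ?thesis by (simp add: Xu prodw_eq_exp[OF w])
  qed
  moreover have "set u \<subseteq> {1..N}" using sym_spaceD[OF w] by (auto simp: u_def)
  moreover have "u \<noteq> []" using \<open>0 < L\<close> by (simp add: u_def)
  ultimately show ?thesis by blast
qed

text \<open>\<open>C\<close> is fixed before the letters, \<open>D\<close> and \<open>T0\<close>, so
  it stays bounded while \<open>D\<close> tends to infinity. The strict inequalities at the end make
  \<sigma> the order at both scales.\<close>

lemma permsB_word_with_runs:
  assumes \<sigma>: "\<sigma> \<in> permsB N lam"
  shows "\<exists>C::nat. \<forall>\<iota> D T0. (\<forall>n. \<iota> n \<in> {1..N}) \<longrightarrow> 0 < D \<longrightarrow>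
    (\<exists>w\<in>sym_space N. \<exists>T>T0. \<exists>b k.
      (\<forall>n<CARD('n). b n \<le> stop w T (\<sigma> ! n) \<and> stop w T (\<sigma> ! n) \<le> b n + C \<and>
         b n + k n \<le> stop w (T + D + nlog_max) (\<sigma> ! n) \<and> stop w (T + D + nlog_max) (\<sigma> ! n) \<le> b n + k n + C \<and>
         (\<forall>l\<in>{b n..<b n + k n}. w l = \<iota> n) \<and>
         D \<le> k n * nlog (\<iota> n) (\<sigma> ! n) \<and> k n * nlog (\<iota> n) (\<sigma> ! n) \<le> D + nlog (\<iota> n) (\<sigma> ! n)) \<and>
      (\<forall>n m. n < m \<longrightarrow> m < CARD('n) \<longrightarrow> stop w T (\<sigma> ! m) < stop w T (\<sigma> ! n) \<and>
         stop w (T + D + nlog_max) (\<sigma> ! m) < stop w (T + D + nlog_max) (\<sigma> ! n)))"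
proof -
  obtain u where u: "set u \<subseteq> {1..N}" "u \<noteq> []"
    and mono: "\<And>n. Suc n < CARD('n) \<Longrightarrow> nlog_list u (\<sigma> ! n) < nlog_list u (\<sigma> ! Suc n)"
    using permsB_exists_word[OF \<sigma>] by blast
  define C where "C = nat \<lceil>(length u * nlog_max + nlog_max) / nlog_min\<rceil>"
  let ?d = "CARD('n)"
  show ?thesis
  proof (intro exI[of _ C] allI impI)
    fix \<iota> :: "nat \<Rightarrow> nat" and D T0 :: real assume \<iota>: "\<forall>n. \<iota> n \<in> {1..N}" and D: "0 < D"
    \<comment> \<open>Runs are laid out in the order of stopping, which is the reverse of \<sigma>:
      its last coordinate stops first.\<close>
    define rv where "rv j = ?d - 1 - j" for j
    define k where "k n = nat \<lceil>D / nlog (\<iota> n) (\<sigma> ! n)\<rceil>" for n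
    have "\<exists>w\<in>sym_space N. \<exists>T>T0. \<exists>b.
     (\<forall>j<?d. b j \<le> stop w T (\<sigma> ! rv j) \<and> stop w T (\<sigma> ! rv j) \<le> b j + C \<and>
        b j + k (rv j) \<le> stop w (T + D + nlog_max) (\<sigma> ! rv j) \<and> stop w (T + D + nlog_max) (\<sigma> ! rv j) \<le> b j + k (rv j) + C \<and>
        (\<forall>l\<in>{b j..<b j + k (rv j)}. w l = \<iota> (rv j))) \<and>
     (\<forall>i j. i < j \<longrightarrow> j < ?d \<longrightarrow> b i + k (rv i) + C < b j)"
    proof (rule exists_word_with_runs[OF u _ _ D C_def])
      show "nlog_list u (\<sigma> ! rv (Suc j)) < nlog_list u (\<sigma> ! rv j)" if "Suc j < ?d" for j
        using mono[of "rv (Suc j)"] that by (simp add: rv_def Suc_diff_Suc)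
    qed (use \<iota> in \<open>auto simp: k_def\<close>)
    then obtain w T b where w: "w \<in> sym_space N" and T: "T > T0"
      and b: "\<And>j. j < ?d \<Longrightarrow> b j \<le> stop w T (\<sigma> ! rv j) \<and> stop w T (\<sigma> ! rv j) \<le> b j + C \<and>
        b j + k (rv j) \<le> stop w (T + D + nlog_max) (\<sigma> ! rv j) \<and> stop w (T + D + nlog_max) (\<sigma> ! rv j) \<le> b j + k (rv j) + C \<and>
        (\<forall>l\<in>{b j..<b j + k (rv j)}. w l = \<iota> (rv j))"
      and sep: "\<And>i j. i < j \<Longrightarrow> j < ?d \<Longrightarrow> b i + k (rv i) + C < b j"
      by blast
    have rv: "rv n < ?d" "rv (rv n) = n" if "n < ?d" for n using that by (auto simp: rv_def)
    have kb: "D \<le> k n * nlog (\<iota> n) (\<sigma> ! n)" "k n * nlog (\<iota> n) (\<sigma> ! n) \<le> D + nlog (\<iota> n) (\<sigma> ! n)" for n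
    proof -
      have x: "0 < nlog (\<iota> n) (\<sigma> ! n)" using nlog_pos \<iota> by auto
      have "0 < D / nlog (\<iota> n) (\<sigma> ! n)" using D x by simp
      then have kk: "D / nlog (\<iota> n) (\<sigma> ! n) \<le> k n" "k n \<le> D / nlog (\<iota> n) (\<sigma> ! n) + 1"
        unfolding k_def by linarith+
      show "D \<le> k n * nlog (\<iota> n) (\<sigma> ! n)" using kk(1) x by (simp add: divide_le_eq)
      have "k n * nlog (\<iota> n) (\<sigma> ! n) \<le> (D / nlog (\<iota> n) (\<sigma> ! n) + 1) * nlog (\<iota> n) (\<sigma> ! n)"
        using kk(2) x by (intro mult_right_mono) auto
      then show "k n * nlog (\<iota> n) (\<sigma> ! n) \<le> D + nlog (\<iota> n) (\<sigma> ! n)" using x by (simp add: distrib_right)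
    qed
    have b': "b (rv n) \<le> stop w T (\<sigma> ! n) \<and> stop w T (\<sigma> ! n) \<le> b (rv n) + C \<and>
         b (rv n) + k n \<le> stop w (T + D + nlog_max) (\<sigma> ! n) \<and> stop w (T + D + nlog_max) (\<sigma> ! n) \<le> b (rv n) + k n + C \<and>
         (\<forall>l\<in>{b (rv n)..<b (rv n) + k n}. w l = \<iota> n)" if "n < ?d" for n
      using b[OF rv(1)[OF that]] unfolding rv(2)[OF that] .
    have all: "b (rv n) \<le> stop w T (\<sigma> ! n) \<and> stop w T (\<sigma> ! n) \<le> b (rv n) + C \<and>
         b (rv n) + k n \<le> stop w (T + D + nlog_max) (\<sigma> ! n) \<and> stop w (T + D + nlog_max) (\<sigma> ! n) \<le> b (rv n) + k n + C \<and>
         (\<forall>l\<in>{b (rv n)..<b (rv n) + k n}. w l = \<iota> n) \<and>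
         D \<le> k n * nlog (\<iota> n) (\<sigma> ! n) \<and> k n * nlog (\<iota> n) (\<sigma> ! n) \<le> D + nlog (\<iota> n) (\<sigma> ! n)" if "n < ?d" for n
      using b'[OF that] kb[of n] by (elim conjE) (intro conjI; assumption)
    have ord: "stop w T (\<sigma> ! m) < stop w T (\<sigma> ! n) \<and> stop w (T + D + nlog_max) (\<sigma> ! m) < stop w (T + D + nlog_max) (\<sigma> ! n)"
      if "n < m" "m < ?d" for n m
    proof -
      have "rv m < rv n" using that by (simp add: rv_def)
      then have "b (rv m) + k m + C < b (rv n)" using sep[of "rv m" "rv n"] rv that by simp
      then show ?thesis using b'[of m] b'[of n] that by linarith
    qed
    show "\<exists>w\<in>sym_space N. \<exists>T>T0. \<exists>b k.
      (\<forall>n<CARD('n). b n \<le> stop w T (\<sigma> ! n) \<and> stop w T (\<sigma> ! n) \<le> b n + C \<and>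
         b n + k n \<le> stop w (T + D + nlog_max) (\<sigma> ! n) \<and> stop w (T + D + nlog_max) (\<sigma> ! n) \<le> b n + k n + C \<and>
         (\<forall>l\<in>{b n..<b n + k n}. w l = \<iota> n) \<and>
         D \<le> k n * nlog (\<iota> n) (\<sigma> ! n) \<and> k n * nlog (\<iota> n) (\<sigma> ! n) \<le> D + nlog (\<iota> n) (\<sigma> ! n)) \<and>
      (\<forall>n m. n < m \<longrightarrow> m < CARD('n) \<longrightarrow> stop w T (\<sigma> ! m) < stop w T (\<sigma> ! n) \<and>
         stop w (T + D + nlog_max) (\<sigma> ! m) < stop w (T + D + nlog_max) (\<sigma> ! n))"
    proof (rule bexI[OF _ w], rule exI[of _ T], rule conjI[OF T], rule exI[of _ "\<lambda>n. b (rv n)"],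
        rule exI[of _ k], rule conjI)
    qed ((intro allI impI, rule all, assumption), (intro allI impI, rule ord, assumption, assumption))
  qed
qed

lemma permsB_sub: "permsB N lam \<subseteq> permutations_of_set UNIV"
  by (auto simp: permsB_def)

lemma permsB_cost_lower:
  assumes \<sigma>: "\<sigma> \<in> permsB N lam"
  shows "\<exists>C. \<forall>D>0. \<forall>T0. \<exists>w\<in>sym_space N. \<exists>T>T0.
    D * sum_max_ratio \<sigma> - C \<le> cost w (T + D + nlog_max) - cost w T"
proof -
  obtain C :: nat where C: "\<And>\<iota> D T0. (\<forall>n. \<iota> n \<in> {1..N}) \<Longrightarrow> 0 < D \<Longrightarrow>
    (\<exists>w\<in>sym_space N. \<exists>T>T0. \<exists>b k.
      (\<forall>n<CARD('n). b n \<le> stop w T (\<sigma> ! n) \<and> stop w T (\<sigma> ! n) \<le> b n + C \<and>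
         b n + k n \<le> stop w (T + D + nlog_max) (\<sigma> ! n) \<and> stop w (T + D + nlog_max) (\<sigma> ! n) \<le> b n + k n + C \<and>
         (\<forall>l\<in>{b n..<b n + k n}. w l = \<iota> n) \<and>
         D \<le> k n * nlog (\<iota> n) (\<sigma> ! n) \<and> k n * nlog (\<iota> n) (\<sigma> ! n) \<le> D + nlog (\<iota> n) (\<sigma> ! n)) \<and>
      (\<forall>n m. n < m \<longrightarrow> m < CARD('n) \<longrightarrow> stop w T (\<sigma> ! m) < stop w T (\<sigma> ! n) \<and>
         stop w (T + D + nlog_max) (\<sigma> ! m) < stop w (T + D + nlog_max) (\<sigma> ! n)))"
    using permsB_word_with_runs[OF \<sigma>] by blast
  obtain \<iota> where \<iota>: "\<And>n. \<iota> n \<in> {1..N}" "\<And>n. psi \<sigma> n (\<iota> n) = max_ratio \<sigma> n * nlog (\<iota> n) (\<sigma> ! n)"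
    using max_ratio_attained[of \<sigma>] by metis
  have \<sigma>p: "\<sigma> \<in> permutations_of_set UNIV" using \<sigma> permsB_sub by blast
  show ?thesis
  proof (intro exI[of _ "CARD('n) * (C * neg_ln_marg_max)"] allI impI)
    fix D T0 :: real assume D: "0 < D"
    obtain w T b k where w: "w \<in> sym_space N" and T: "T > T0"
      and b: "\<And>n. n < CARD('n) \<Longrightarrow> b n \<le> stop w T (\<sigma> ! n) \<and> stop w T (\<sigma> ! n) \<le> b n + C \<and>
         b n + k n \<le> stop w (T + D + nlog_max) (\<sigma> ! n) \<and> stop w (T + D + nlog_max) (\<sigma> ! n) \<le> b n + k n + C \<and>
         (\<forall>l\<in>{b n..<b n + k n}. w l = \<iota> n) \<and>
         D \<le> k n * nlog (\<iota> n) (\<sigma> ! n) \<and> k n * nlog (\<iota> n) (\<sigma> ! n) \<le> D + nlog (\<iota> n) (\<sigma> ! n)"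
      and ord: "\<And>n m. n < m \<Longrightarrow> m < CARD('n) \<Longrightarrow> stop w T (\<sigma> ! m) < stop w T (\<sigma> ! n) \<and>
         stop w (T + D + nlog_max) (\<sigma> ! m) < stop w (T + D + nlog_max) (\<sigma> ! n)"
      using C[of \<iota> D T0] \<iota>(1) D by blast
    let ?T' = "T + D + nlog_max"
    have ds: "dec_order w T \<sigma>" "dec_order w ?T' \<sigma>"
      unfolding dec_order_def using ord less_imp_le by blast+
    have "D * sum_max_ratio \<sigma> - CARD('n) * (C * neg_ln_marg_max) = (\<Sum>n<CARD('n). D * max_ratio \<sigma> n - C * neg_ln_marg_max)"
      by (simp add: sum_max_ratio_def sum_subtractf sum_distrib_left)
    also have "\<dots> \<le> (\<Sum>n<CARD('n). \<Sum>l\<in>{stop w T (\<sigma> ! n)..<stop w ?T' (\<sigma> ! n)}. psi \<sigma> n (w l))"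
    proof (rule sum_mono)
      fix n assume "n \<in> {..<CARD('n)}"
      then have n: "n < CARD('n)" by simp
      note bn = b[OF n]
      have "D * max_ratio \<sigma> n \<le> k n * psi \<sigma> n (\<iota> n)"
        using mult_right_mono[of D "k n * nlog (\<iota> n) (\<sigma> ! n)" "max_ratio \<sigma> n"] bn max_ratio_nonneg[of \<sigma> n]
        by (simp add: \<iota>(2) mult_ac)
      moreover have "C * psi \<sigma> n (\<iota> n) \<le> C * neg_ln_marg_max"
        using psi_le_neg_ln_marg_max[OF \<iota>(1)] by (intro mult_left_mono) auto
      \<comment> \<open>The window of \<open>\<sigma> ! n\<close> contains the run except for at
        most its first \<open>C\<close> letters; truncated subtraction errs on the safe side if the
        run is shorter.\<close>
      moreover have "(real (k n) - C) * psi \<sigma> n (\<iota> n) \<le> real (k n - C) * psi \<sigma> n (\<iota> n)"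
        using psi_nonneg[OF \<iota>(1)] by (intro mult_right_mono) auto
      ultimately have "D * max_ratio \<sigma> n - C * neg_ln_marg_max \<le> real (k n - C) * psi \<sigma> n (\<iota> n)"
        by (simp add: left_diff_distrib)
      also have "\<dots> = (\<Sum>l\<in>{b n + C..<b n + k n}. psi \<sigma> n (\<iota> n))" by simp
      also have "\<dots> = (\<Sum>l\<in>{b n + C..<b n + k n}. psi \<sigma> n (w l))"
        by (rule sum.cong) (use bn in auto)
      also have "\<dots> \<le> (\<Sum>l\<in>{stop w T (\<sigma> ! n)..<stop w ?T' (\<sigma> ! n)}. psi \<sigma> n (w l))"
        by (rule sum_mono2) (use bn psi_nonneg[OF sym_spaceD[OF w]] in auto)
      finally show "D * max_ratio \<sigma> n - C * neg_ln_marg_max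
          \<le> (\<Sum>l\<in>{stop w T (\<sigma> ! n)..<stop w ?T' (\<sigma> ! n)}. psi \<sigma> n (w l))" .
    qed
    also have "\<dots> = cost w ?T' - cost w T"
      using cost_diff_ordered[OF w \<sigma>p ds] D nlog_max_pos by simp
    finally show "\<exists>w\<in>sym_space N. \<exists>T>T0.
        D * sum_max_ratio \<sigma> - CARD('n) * (C * neg_ln_marg_max) \<le> cost w (T + D + nlog_max) - cost w T"
      using w T by blast
  qed
qed

lemma permsB_cost_upper:
  assumes \<sigma>: "\<sigma> \<in> permsB N lam"
  shows "\<exists>C. \<forall>D>0. \<forall>T0. \<exists>w\<in>sym_space N. \<exists>T>T0.
    cost w (T + D + nlog_max) - cost w T \<le> D * sum_min_ratio \<sigma> + C"
proof -
  obtain C :: nat where C: "\<And>\<iota> D T0. (\<forall>n. \<iota> n \<in> {1..N}) \<Longrightarrow> 0 < D \<Longrightarrow>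
    (\<exists>w\<in>sym_space N. \<exists>T>T0. \<exists>b k.
      (\<forall>n<CARD('n). b n \<le> stop w T (\<sigma> ! n) \<and> stop w T (\<sigma> ! n) \<le> b n + C \<and>
         b n + k n \<le> stop w (T + D + nlog_max) (\<sigma> ! n) \<and> stop w (T + D + nlog_max) (\<sigma> ! n) \<le> b n + k n + C \<and>
         (\<forall>l\<in>{b n..<b n + k n}. w l = \<iota> n) \<and>
         D \<le> k n * nlog (\<iota> n) (\<sigma> ! n) \<and> k n * nlog (\<iota> n) (\<sigma> ! n) \<le> D + nlog (\<iota> n) (\<sigma> ! n)) \<and>
      (\<forall>n m. n < m \<longrightarrow> m < CARD('n) \<longrightarrow> stop w T (\<sigma> ! m) < stop w T (\<sigma> ! n) \<and>
         stop w (T + D + nlog_max) (\<sigma> ! m) < stop w (T + D + nlog_max) (\<sigma> ! n)))"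
    using permsB_word_with_runs[OF \<sigma>] by blast
  obtain \<iota> where \<iota>: "\<And>n. \<iota> n \<in> {1..N}" "\<And>n. psi \<sigma> n (\<iota> n) = min_ratio \<sigma> n * nlog (\<iota> n) (\<sigma> ! n)"
    using min_ratio_attained[of \<sigma>] by metis
  have \<sigma>p: "\<sigma> \<in> permutations_of_set UNIV" using \<sigma> permsB_sub by blast
  show ?thesis
  proof (intro exI[of _ "CARD('n) * (neg_ln_marg_max + C * neg_ln_marg_max)"] allI impI)
    fix D T0 :: real assume D: "0 < D"
    obtain w T b k where w: "w \<in> sym_space N" and T: "T > T0"
      and b: "\<And>n. n < CARD('n) \<Longrightarrow> b n \<le> stop w T (\<sigma> ! n) \<and> stop w T (\<sigma> ! n) \<le> b n + C \<and>
         b n + k n \<le> stop w (T + D + nlog_max) (\<sigma> ! n) \<and> stop w (T + D + nlog_max) (\<sigma> ! n) \<le> b n + k n + C \<and>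
         (\<forall>l\<in>{b n..<b n + k n}. w l = \<iota> n) \<and>
         D \<le> k n * nlog (\<iota> n) (\<sigma> ! n) \<and> k n * nlog (\<iota> n) (\<sigma> ! n) \<le> D + nlog (\<iota> n) (\<sigma> ! n)"
      and ord: "\<And>n m. n < m \<Longrightarrow> m < CARD('n) \<Longrightarrow> stop w T (\<sigma> ! m) < stop w T (\<sigma> ! n) \<and>
         stop w (T + D + nlog_max) (\<sigma> ! m) < stop w (T + D + nlog_max) (\<sigma> ! n)"
      using C[of \<iota> D T0] \<iota>(1) D by blast
    let ?T' = "T + D + nlog_max"
    have ds: "dec_order w T \<sigma>" "dec_order w ?T' \<sigma>"
      unfolding dec_order_def using ord less_imp_le by blast+
    have "cost w ?T' - cost w T = (\<Sum>n<CARD('n). \<Sum>l\<in>{stop w T (\<sigma> ! n)..<stop w ?T' (\<sigma> ! n)}. psi \<sigma> n (w l))"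
      using cost_diff_ordered[OF w \<sigma>p ds] D nlog_max_pos by simp
    also have "\<dots> \<le> (\<Sum>n<CARD('n). D * min_ratio \<sigma> n + (neg_ln_marg_max + C * neg_ln_marg_max))"
    proof (rule sum_mono)
      fix n assume "n \<in> {..<CARD('n)}"
      then have n: "n < CARD('n)" by simp
      note bn = b[OF n]
      \<comment> \<open>The window is covered by the run and \<open>C\<close> further letters, each
        of cost at most \<open>neg_ln_marg_max\<close>.\<close>
      have "(\<Sum>l\<in>{stop w T (\<sigma> ! n)..<stop w ?T' (\<sigma> ! n)}. psi \<sigma> n (w l))
          \<le> (\<Sum>l\<in>{b n..<b n + k n} \<union> {b n + k n..<b n + k n + C}. psi \<sigma> n (w l))"
        by (rule sum_mono2) (use bn psi_nonneg[OF sym_spaceD[OF w]] in auto)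
      also have "\<dots> = (\<Sum>l\<in>{b n..<b n + k n}. psi \<sigma> n (w l)) + (\<Sum>l\<in>{b n + k n..<b n + k n + C}. psi \<sigma> n (w l))"
        by (rule sum.union_disjoint) auto
      also have "(\<Sum>l\<in>{b n..<b n + k n}. psi \<sigma> n (w l)) = (\<Sum>l\<in>{b n..<b n + k n}. psi \<sigma> n (\<iota> n))"
        by (rule sum.cong) (use bn in auto)
      also have "\<dots> = k n * psi \<sigma> n (\<iota> n)" by simp
      \<comment> \<open>Rounding the run up to whole letters adds at most one letter.\<close>
      also have "\<dots> \<le> D * min_ratio \<sigma> n + psi \<sigma> n (\<iota> n)"
        using mult_right_mono[of "k n * nlog (\<iota> n) (\<sigma> ! n)" "D + nlog (\<iota> n) (\<sigma> ! n)" "min_ratio \<sigma> n"] bn min_ratio_nonneg[of \<sigma> n]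
        by (simp add: \<iota>(2) algebra_simps)
      also have "psi \<sigma> n (\<iota> n) \<le> neg_ln_marg_max" by (rule psi_le_neg_ln_marg_max[OF \<iota>(1)])
      also have "(\<Sum>l\<in>{b n + k n..<b n + k n + C}. psi \<sigma> n (w l)) \<le> (\<Sum>l\<in>{b n + k n..<b n + k n + C}. neg_ln_marg_max)"
        by (rule sum_mono) (rule psi_le_neg_ln_marg_max[OF sym_spaceD[OF w]])
      finally show "(\<Sum>l\<in>{stop w T (\<sigma> ! n)..<stop w ?T' (\<sigma> ! n)}. psi \<sigma> n (w l))
          \<le> D * min_ratio \<sigma> n + (neg_ln_marg_max + C * neg_ln_marg_max)" by simp
    qed
    also have "\<dots> = D * sum_min_ratio \<sigma> + CARD('n) * (neg_ln_marg_max + C * neg_ln_marg_max)"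
      by (simp add: sum_min_ratio_def sum.distrib sum_distrib_left)
    finally show "\<exists>w\<in>sym_space N. \<exists>T>T0.
        cost w (T + D + nlog_max) - cost w T \<le> D * sum_min_ratio \<sigma> + CARD('n) * (neg_ln_marg_max + C * neg_ln_marg_max)"
      using w T by blast
  qed
qed

end

subsection \<open>Bounds over the strict cylinder orders\<close>

lemma linear_bound_imp_nonpos:
  fixes a :: real
  assumes "\<And>D. D > D0 \<Longrightarrow> D * a \<le> K"
  shows "a \<le> 0"
proof (rule ccontr)
  assume "\<not> a \<le> 0"
  then have a: "a > 0" by simp
  define D where "D = max (D0 + 1) ((\<bar>K\<bar> + 1) / a)"
  have "(\<bar>K\<bar> + 1) / a * a \<le> D * a" unfolding D_def using a by (intro mult_right_mono) auto
  moreover have "D * a \<le> K" by (rule assms) (simp add: D_def)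
  ultimately show False using a by simp
qed

context sponge
begin

lemma bounded_msupp: "bounded (msupp nu)"
  unfolding bounded_two_points using dist_msupp_le by blast

text \<open>An admissible exponent is tested at a coded point with radii
  \<open>CARD('n) * exp (- T)\<close> and \<open>gap * exp (- (T + D + nlog_max))\<close>: the
  logarithm of the measure ratio is at least \<open>D * sum_max_ratio \<sigma>\<close> and that of
  the ratio of the radii is \<open>D\<close>, up to constants independent of
  \<open>D\<close>.\<close>

lemma assouad_dim_lower:
  assumes \<sigma>: "\<sigma> \<in> permsB N lam"
  shows "ereal (sum_max_ratio \<sigma>) \<le> assouad_dim_measure nu"
  unfolding assouad_dim_measure_def
proof (rule Inf_greatest)
  fix z assume "z \<in> {ereal s | s. s \<ge> 0 \<and> (\<exists>C>0. \<forall>x\<in>msupp nu. \<forall>r R.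
      0 < r \<and> r < R \<and> R < diameter (msupp nu) \<longrightarrow>
      measure nu (cball x R) / measure nu (cball x r) \<le> C * (R / r) powr s)}"
  then obtain s C where z: "z = ereal s" and s: "s \<ge> 0" and C: "C > 0"
    and bound: "\<And>x r R. x \<in> msupp nu \<Longrightarrow> 0 < r \<Longrightarrow> r < R \<Longrightarrow> R < diameter (msupp nu) \<Longrightarrow>
      measure nu (cball x R) / measure nu (cball x r) \<le> C * (R / r) powr s" by blast
  have "sum_max_ratio \<sigma> \<le> s"
  \<comment> \<open>With a single map there may be no admissible radii to test, but then the ratio
    sum is 0.\<close>
  proof (cases "N = 1")
    case True
    then show ?thesis using single_map_sum_max_ratio_sum_min_ratio(1)[of \<sigma>] s by simp
  next
    case False
    then have diam: "0 < diameter (msupp nu)" using diameter_msupp_pos N_pos by simp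
    define d where "d = real CARD('n)"
    have d: "d \<ge> 1" unfolding d_def by (simp add: Suc_le_eq)
    obtain T0 where T0: "T0 > 0" "\<And>T. T \<ge> T0 \<Longrightarrow> d * exp (- T) < diameter (msupp nu)"
      using exists_scale[OF diam] unfolding d_def by blast
    obtain K where K: "\<And>D T0. D > 0 \<Longrightarrow> \<exists>w\<in>sym_space N. \<exists>T>T0. D * sum_max_ratio \<sigma> - K \<le> cost w (T + D + nlog_max) - cost w T"
      using permsB_cost_lower[OF \<sigma>] by blast
    have "D * (sum_max_ratio \<sigma> - s) \<le> K + ln C + s * (ln (d / gap) + nlog_max)" if D: "D > 0" for D
    proof -
      obtain w T where w: "w \<in> sym_space N" and T: "T > T0"
        and cst: "D * sum_max_ratio \<sigma> - K \<le> cost w (T + D + nlog_max) - cost w T" using K[OF D, of T0] by blast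
      let ?T' = "T + D + nlog_max"
      let ?x = "coding lam t w" and ?R = "d * exp (- T)" and ?r = "gap * exp (- ?T')"
      have x: "?x \<in> msupp nu" by (rule coding_in_msupp[OF w])
      have r0: "0 < ?r" using gap_pos by simp
      have "?r < 1 * exp (- T)"
        using gap_pos gap_le_1 D nlog_max_pos by (intro mult_le_less_imp_less) auto
      also have "\<dots> \<le> ?R" using d by simp
      finally have rR: "?r < ?R" .
      have pos: "0 < measure nu (cball ?x ?r)" by (rule msupp_cball_pos[OF x r0])
      have "exp (D * sum_max_ratio \<sigma> - K) \<le> exp (cost w ?T' - cost w T)" using cst by simp
      also have "\<dots> = exp (- cost w T) / exp (- cost w ?T')" by (simp flip: exp_diff)
      also have "\<dots> \<le> measure nu (cball ?x ?R) / measure nu (cball ?x ?r)"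
        using ball_measure_lower[OF w, of T] ball_measure_upper[OF w, of ?T'] pos T T0(1) D nlog_max_pos
        unfolding d_def by (intro frac_le) auto
      also have "\<dots> \<le> C * (?R / ?r) powr s"
        by (rule bound[OF x r0 rR]) (use T0(2)[of T] T in simp)
      also have "\<dots> = exp (ln C + s * (ln (d / gap) + D + nlog_max))"
      proof -
        have "ln (?R / ?r) = ln (d / gap) + D + nlog_max"
          using d gap_pos by (simp add: ln_div ln_mult)
        moreover have "0 < ?R / ?r" using d r0 by simp
        ultimately show ?thesis using C d gap_pos by (simp add: powr_def exp_add)
      qed
      finally have "D * sum_max_ratio \<sigma> - K \<le> ln C + s * (ln (d / gap) + D + nlog_max)" by simp
      then show ?thesis by (simp add: algebra_simps)
    qed
    then have "sum_max_ratio \<sigma> - s \<le> 0" by (rule linear_bound_imp_nonpos)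
    then show ?thesis by simp
  qed
  then show "ereal (sum_max_ratio \<sigma>) \<le> z" unfolding z by simp
qed

text \<open>The same test with the constants \<open>gap\<close> and \<open>CARD('n)\<close>
  exchanged, so that the outer ball is bounded above and the inner one below.\<close>

lemma lower_dim_upper:
  assumes \<sigma>: "\<sigma> \<in> permsB N lam"
  shows "lower_dim_measure nu \<le> ereal (sum_min_ratio \<sigma>)"
proof (cases "diameter (msupp nu) = 0")
  case True
  then show ?thesis using sum_min_ratio_nonneg[of \<sigma>] by (simp add: lower_dim_measure_def)
next
  case False
  then have diam: "0 < diameter (msupp nu)"
    using diameter_ge_0[of "msupp nu"] bounded_msupp by simp
  have "Sup {ereal s | s. s \<ge> 0 \<and> (\<exists>C>0. \<forall>x\<in>msupp nu. \<forall>r R.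
      0 < r \<and> r < R \<and> R < diameter (msupp nu) \<longrightarrow>
      measure nu (cball x R) / measure nu (cball x r) \<ge> C * (R / r) powr s)} \<le> ereal (sum_min_ratio \<sigma>)"
  proof (rule Sup_least)
    fix z assume "z \<in> {ereal s | s. s \<ge> 0 \<and> (\<exists>C>0. \<forall>x\<in>msupp nu. \<forall>r R.
      0 < r \<and> r < R \<and> R < diameter (msupp nu) \<longrightarrow>
      measure nu (cball x R) / measure nu (cball x r) \<ge> C * (R / r) powr s)}"
    then obtain s C where z: "z = ereal s" and s: "s \<ge> 0" and C: "C > 0"
      and bound: "\<And>x r R. x \<in> msupp nu \<Longrightarrow> 0 < r \<Longrightarrow> r < R \<Longrightarrow> R < diameter (msupp nu) \<Longrightarrow>
        C * (R / r) powr s \<le> measure nu (cball x R) / measure nu (cball x r)" by blast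
    define d where "d = real CARD('n)"
    have d: "d \<ge> 1" unfolding d_def by (simp add: Suc_le_eq)
    obtain T0 where T0: "T0 > 0" "\<And>T. T \<ge> T0 \<Longrightarrow> d * exp (- T) < diameter (msupp nu)"
      using exists_scale[OF diam] unfolding d_def by blast
    obtain K where K: "\<And>D T0. D > 0 \<Longrightarrow> \<exists>w\<in>sym_space N. \<exists>T>T0. cost w (T + D + nlog_max) - cost w T \<le> D * sum_min_ratio \<sigma> + K"
      using permsB_cost_upper[OF \<sigma>] by blast
    \<comment> \<open>After the exchange of constants the inner radius lies below the outer one only
      for large \<open>D\<close>.\<close>
    have "D * (s - sum_min_ratio \<sigma>) \<le> K - ln C - s * (ln (gap / d) + nlog_max)" if D: "D > max 0 (ln (d / gap))" for D
    proof -
      obtain w T where w: "w \<in> sym_space N" and T: "T > T0"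
        and cst: "cost w (T + D + nlog_max) - cost w T \<le> D * sum_min_ratio \<sigma> + K" using K[of D T0] D by auto
      let ?T' = "T + D + nlog_max"
      let ?x = "coding lam t w" and ?R = "gap * exp (- T)" and ?r = "d * exp (- ?T')"
      have x: "?x \<in> msupp nu" by (rule coding_in_msupp[OF w])
      have r0: "0 < ?r" using d by simp
      have lnR: "ln (?R / ?r) = ln (gap / d) + D + nlog_max"
        using d gap_pos by (simp add: ln_div ln_mult)
      have Rr: "0 < ?R / ?r" using gap_pos r0 by simp
      have "ln (gap / d) = - ln (d / gap)" using d gap_pos by (simp add: ln_div)
      then have "0 < ln (?R / ?r)" unfolding lnR using D nlog_max_pos by simp
      then have "1 < ?R / ?r" using Rr by simp
      then have rR: "?r < ?R" using r0 by (simp add: less_divide_eq)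
      have "?R \<le> d * exp (- T)" using gap_le_1 d by (intro mult_right_mono) auto
      then have Rd: "?R < diameter (msupp nu)" using T0(2)[of T] T by linarith
      have "exp (ln C + s * (ln (gap / d) + D + nlog_max)) = C * (?R / ?r) powr s"
        using C d gap_pos lnR Rr by (simp add: powr_def exp_add)
      also have "\<dots> \<le> measure nu (cball ?x ?R) / measure nu (cball ?x ?r)"
        by (rule bound[OF x r0 rR Rd])
      also have "\<dots> \<le> exp (- cost w T) / exp (- cost w ?T')"
        using ball_measure_lower[OF w, of ?T'] ball_measure_upper[OF w, of T] T T0(1)
        unfolding d_def by (intro frac_le) auto
      also have "\<dots> = exp (cost w ?T' - cost w T)" by (simp flip: exp_diff)
      also have "\<dots> \<le> exp (D * sum_min_ratio \<sigma> + K)" using cst by simp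
      finally have "ln C + s * (ln (gap / d) + D + nlog_max) \<le> D * sum_min_ratio \<sigma> + K" by simp
      then show ?thesis by (simp add: algebra_simps)
    qed
    then have "s - sum_min_ratio \<sigma> \<le> 0" by (rule linear_bound_imp_nonpos)
    then show "z \<le> ereal (sum_min_ratio \<sigma>)" unfolding z by simp
  qed
  then show ?thesis using False by (simp add: lower_dim_measure_def)
qed

section \<open>Existence of strict cylinder orders\<close>

text \<open>The letter \<open>i\<close> is used \<open>m ^ i\<close> times: two coordinates have equal products only if \<open>m\<close> is
  a root of a nonzero polynomial.\<close>
lemma exists_word_distinct_products:
  "\<exists>u. set u \<subseteq> {1..N} \<and> u \<noteq> [] \<and> inj (nlog_list u)"
proof -
  \<comment> \<open>Coefficients of the polynomial whose value at \<open>m\<close> is the difference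
    of the two sums; letters start at 1, so index 0 is padded with 0.\<close>
  define coe where "coe c c' i = (if i \<in> {1..N} then nlog i c - nlog i c' else 0)" for c c' i
  define Z where "Z c c' = {x::real. (\<Sum>i\<le>N. coe c c' i * x ^ i) = 0}" for c c'
  have "finite (Z c c')" if ne: "c \<noteq> c'" for c c'
  proof -
    obtain i where i: "i \<in> {1..N}" "lam i c \<noteq> lam i c'" using distinguishable[OF ne[symmetric]] by blast
    then have "coe c c' i \<noteq> 0"
      using lam_range[OF i(1), of c] lam_range[OF i(1), of c'] by (simp add: coe_def nlog_def)
    then show ?thesis unfolding Z_def polyfun_finite_roots using i(1) by auto
  qed
  then have "finite (\<Union>c. \<Union>c'\<in>- {c}. Z c c')" by auto
  then have "finite (real -` (\<Union>c. \<Union>c'\<in>- {c}. Z c c'))"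
    by (rule finite_vimageI) (simp add: inj_on_def)
  \<comment> \<open>Excluding 0 as well makes the letter 1 occur, so that the word is
    nonempty.\<close>
  then have fin: "finite (insert 0 (real -` (\<Union>c. \<Union>c'\<in>- {c}. Z c c')))" by simp
  obtain m where "m \<notin> insert 0 (real -` (\<Union>c. \<Union>c'\<in>- {c}. Z c c'))"
    using ex_new_if_finite[OF infinite_UNIV_nat fin] ..
  then have m: "m \<noteq> 0" "\<And>c c'. c \<noteq> c' \<Longrightarrow> real m \<notin> Z c c'" by auto
  define u where "u = concat (map (\<lambda>i. replicate (m ^ i) i) [1..<Suc N])"
  have Xc: "nlog_list (concat (map (\<lambda>i. replicate (m ^ i) i) js)) c = (\<Sum>i\<leftarrow>js. real m ^ i * nlog i c)" for js c
    by (induction js) (simp_all add: of_nat_power)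
  have Xu: "nlog_list u c = (\<Sum>i\<in>{1..N}. real m ^ i * nlog i c)" for c
  proof -
    have "{1..<Suc N} = {1..N}" by auto
    then show ?thesis unfolding u_def Xc by (simp add: interv_sum_list_conv_sum_set_nat del: upt_Suc)
  qed
  have "c = c'" if eq: "nlog_list u c = nlog_list u c'" for c c'
  proof (rule ccontr)
    assume ne: "c \<noteq> c'"
    have "(\<Sum>i\<le>N. coe c c' i * real m ^ i) = (\<Sum>i\<in>{1..N}. (nlog i c - nlog i c') * real m ^ i)"
      by (rule sum.mono_neutral_cong_right) (auto simp: coe_def)
    also have "\<dots> = nlog_list u c - nlog_list u c'" unfolding Xu by (simp add: algebra_simps flip: sum_subtractf)
    finally have "real m \<in> Z c c'" using eq by (simp add: Z_def)
    then show False using m(2)[OF ne] by simp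
  qed
  then have "inj (nlog_list u)" by (rule injI)
  moreover have "set u \<subseteq> {1..N}" by (auto simp: u_def)
  moreover have "u \<noteq> []"
  proof -
    have "1 \<in> set u" using m(1) N_pos by (auto simp: u_def)
    then show ?thesis by auto
  qed
  ultimately show ?thesis by blast
qed

text \<open>Needed for the extrema over \<open>permsB\<close> to be attained. Coordinates are sorted
  by the sums of a word that tells them apart; the scale is the product of the last coordinate,
  which therefore stops exactly at the end of the word.\<close>

lemma permsB_nonempty: "permsB N lam \<noteq> {}"
proof -
  obtain u where u: "set u \<subseteq> {1..N}" "u \<noteq> []" "inj (nlog_list u)" using exists_word_distinct_products by blast
  have "\<exists>\<sigma>. set \<sigma> = (UNIV::'n set) \<and> distinct \<sigma> \<and> sorted_wrt (\<lambda>x y. nlog_list u x < nlog_list u y) \<sigma>"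
  proof (rule exists_sorted_wrt_list)
    show "nlog_list u x < nlog_list u y \<or> nlog_list u y < nlog_list u x" if "x \<noteq> y" for x y
      using injD[OF u(3)] that by (metis linorder_neqE)
  qed auto
  then obtain \<sigma> where \<sigma>: "set \<sigma> = (UNIV::'n set)" "distinct \<sigma>" "sorted_wrt (\<lambda>x y. nlog_list u x < nlog_list u y) \<sigma>" by blast
  then have len: "length \<sigma> = CARD('n)" using distinct_card by metis
  define w where "w = extend u"
  have w: "w \<in> sym_space N" unfolding w_def by (rule extend_sym_space[OF u(1)])
  have nlog_sum: "nlog_sum w c (length u) = nlog_list u c" for c unfolding w_def using nlog_sum_extend[of "length u" u c] by simp
  define c where "c = \<sigma> ! (CARD('n) - 1)"
  have "stop w (nlog_list u c) c = length u"
    using le_stop[OF w, of c "length u" "nlog_list u c"] stop_le_iff[OF w, of "nlog_list u c" c "length u"] nlog_sum by simp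
  then have "strict_cylinder lam w (exp (- nlog_list u c)) \<sigma>"
    unfolding strict_cylinder_def c_def[symmetric] Let_def
    using \<sigma>(3) len by (auto simp: prodw_eq_exp[OF w] nlog_sum sorted_wrt_iff_nth_less)
  moreover have "\<sigma> \<in> permutations_of_set UNIV" using \<sigma> by (simp add: permutations_of_set_def)
  moreover have "exp (- nlog_list u c) < 1" using nlog_list_pos[OF u(1,2)] by simp
  ultimately have "\<sigma> \<in> permsB N lam" unfolding permsB_def using w exp_gt_zero by blast
  then show ?thesis by blast
qed

lemma finite_permsB: "finite (permsB N lam)"
  by (rule finite_subset[OF permsB_sub]) simp

end

theorem theorem2p5:
  fixes N :: nat
    and lam :: "nat \<Rightarrow> 'n::{finite,linorder} \<Rightarrow> real"
    and t :: "nat \<Rightarrow> real^('n::{finite,linorder})"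
    and p :: "nat \<Rightarrow> real"
  assumes lam_range: "\<And>i c. i \<in> {1..N} \<Longrightarrow> 0 < lam i c \<and> lam i c < 1"
    and maps_in_cube: "\<And>i. i \<in> {1..N} \<Longrightarrow> ifs lam t i ` unit_cube \<subseteq> unit_cube"
    and maps_distinct: "\<And>i j. i \<in> {1..N} \<Longrightarrow> j \<in> {1..N} \<Longrightarrow> i \<noteq> j \<Longrightarrow>
                          \<not> (\<forall>x\<in>unit_cube. ifs lam t i x = ifs lam t j x)"
    and distinguishable: "\<And>m n. m \<noteq> n \<Longrightarrow> \<exists>i\<in>{1..N}. lam i n \<noteq> lam i m"
    and SPPC: "very_strong_SPPC N lam t"
    and p_pos: "\<And>i. i \<in> {1..N} \<Longrightarrow> p i > 0"
    and p_sum: "(\<Sum>i\<in>{1..N}. p i) = 1"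
  shows "ereal (Max ((\<lambda>\<sigma>. S_upper N lam t p \<sigma>) ` permsB N lam))
            \<le> assouad_dim_measure (self_affine_measure N lam t p)
       \<and> assouad_dim_measure (self_affine_measure N lam t p)
            \<le> ereal (Max ((\<lambda>\<sigma>. S_upper N lam t p \<sigma>) ` permsA N lam))
       \<and> ereal (Min ((\<lambda>\<sigma>. S_lower N lam t p \<sigma>) ` permsA N lam))
            \<le> lower_dim_measure (self_affine_measure N lam t p)
       \<and> lower_dim_measure (self_affine_measure N lam t p)
            \<le> ereal (Min ((\<lambda>\<sigma>. S_lower N lam t p \<sigma>) ` permsB N lam))
       \<and> (\<forall>\<sigma>\<in>permutations_of_set (UNIV::'n set).
            S_upper N lam t (natural_q N lam t \<sigma>) \<sigma>
              = s_exp N lam t \<sigma> 0 0 + (\<Sum>n\<in>{1..CARD('n)-1}. Max (s_exp N lam t \<sigma> n ` Iset N lam t \<sigma> n))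
          \<and> S_lower N lam t (natural_q N lam t \<sigma>) \<sigma>
              = s_exp N lam t \<sigma> 0 0 + (\<Sum>n\<in>{1..CARD('n)-1}. Min (s_exp N lam t \<sigma> n ` Iset N lam t \<sigma> n)))"
proof -
  interpret sponge N lam t p
    by (intro sponge.intro assms)
  have A: "(\<lambda>\<sigma>. S_upper N lam t p \<sigma>) ` permsA N lam = sum_max_ratio ` permsA N lam"
    "(\<lambda>\<sigma>. S_lower N lam t p \<sigma>) ` permsA N lam = sum_min_ratio ` permsA N lam"
    using permsA_sub S_upper_eq S_lower_eq by (auto intro!: image_cong)
  have "Max ((\<lambda>\<sigma>. S_upper N lam t p \<sigma>) ` permsB N lam) \<in> (\<lambda>\<sigma>. S_upper N lam t p \<sigma>) ` permsB N lam"
    by (rule Max_in) (use finite_permsB permsB_nonempty in auto)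
  then obtain \<sigma> where \<sigma>: "\<sigma> \<in> permsB N lam" "Max ((\<lambda>\<sigma>. S_upper N lam t p \<sigma>) ` permsB N lam) = S_upper N lam t p \<sigma>"
    by blast
  have "Min ((\<lambda>\<sigma>. S_lower N lam t p \<sigma>) ` permsB N lam) \<in> (\<lambda>\<sigma>. S_lower N lam t p \<sigma>) ` permsB N lam"
    by (rule Min_in) (use finite_permsB permsB_nonempty in auto)
  then obtain \<tau> where \<tau>: "\<tau> \<in> permsB N lam" "Min ((\<lambda>\<sigma>. S_lower N lam t p \<sigma>) ` permsB N lam) = S_lower N lam t p \<tau>"
    by blast
  have \<sigma>\<tau>: "S_upper N lam t p \<sigma> = sum_max_ratio \<sigma>" "S_lower N lam t p \<tau> = sum_min_ratio \<tau>"
    using S_upper_eq S_lower_eq \<sigma>(1) \<tau>(1) permsB_sub by blast+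
  show ?thesis
    unfolding A \<sigma>(2) \<tau>(2) \<sigma>\<tau>
    using assouad_dim_lower[OF \<sigma>(1)] assouad_dim_upper lower_dim_lower lower_dim_upper[OF \<tau>(1)]
      S_upper_natural S_lower_natural by blast
qed

end
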